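(* Let $\{\lambda_i : i\geq 1\}$ be a collection of positive real numbers with $\inf_{i}\lambda_i=\alpha>0$, and let $\mathbf{P}=\{P_i : i\geq 1\}$ be a collection of independent random variables such that, for every $i\ge1$, $P_i$ has the law of $(P(\lambda_i)-\lambda_i)/\sqrt{\lambda_i}$, where $P(\lambda_i)$ is a Poisson random variable with parameter $\lambda_i$. Fix integers $d\geq 1$ and $q_d\geq\cdots\geq q_1\geq 1$. For every $j=1,\dots,d$ let $\{N_j^{(n)}:n\ge1\}$ be a sequence of integers, $N_j^{(n)}\ge q_j$, going to infinity, and for every $n\ge 1$ let $f_j^{(n)}:[N_j^{(n)}]^{q_j}\to\mathbb{R}$ be symmetric and vanishing on diagonals. Consider the random vectors $F^{(n)}=(F_1^{(n)},\dots,F_d^{(n)})$, $n\ge1$, where for $1\le j\le d$ $$F_j^{(n)}=Q_{q_j}(N_j^{(n)},f_j^{(n)},\mathbf{P})=\sum_{1\le i_1,\dots,i_{q_j}\le N_j^{(n)}} f_j^{(n)}(i_1,\dots,i_{q_j})P_{i_1}\cdots P_{i_{q_j}}=I_{q_j}(g_j^{(n)}),$$ $$g_j^{(n)}=\sum_{1\le i_1,\dots,i_{q_j}\le N_j^{(n)}} f_j^{(n)}(i_1,\dots,i_{q_j})\,g_{i_1}\otimes\cdots\otimes g_{i_{q_j}},$$ where the functions $g_i=\mathbf{1}_{A_i}/\sqrt{\lambda_i}$ on $(Z,\mathcal{Z},\mu)$ and the multiple integrals $I_{q_j}$ are as described in the context. Given a $d\times d$ positive definite matrix $C=(C(i,j))_{i,j=1,\dots,d}$,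 suppose that $\lim_{n\to\infty}\mathbb{E}[F_i^{(n)}F_j^{(n)}]=C(i,j)$ for every $i,j=1,\dots,d$. Then the following four statements are equivalent, as $n\to\infty$: (1) $F^{(n)}$ converges in law to $(Y_1,\dots,Y_d)\sim\mathcal{N}_d(0,C)$, the $d$-dimensional centered Gaussian distribution with covariance matrix $C$; (2) for each $j=1,\dots,d$, $\mathbb{E}[(F_j^{(n)})^4]\to 3C(j,j)^2$; (3) for each $j=1,\dots,d$ such that $q_j\ge2$ and for all $r=1,\dots,q_j-1$, $\|g_j^{(n)}\star_r^r g_j^{(n)}\|_{L^2(\mu^{2q_j-2r})}\to 0$, and, for every $j$ such that $q_j=1$, $\displaystyle\sum_{i=1}^{N_j^{(n)}} f_j^{(n)}(i)^4\frac{1}{\lambda_i}\to 0$; (4) for each $j=1,\dots,d$, $F_j^{(n)}$ converges in law to $\mathcal{N}(0,C(j,j))$.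
   Context: Notation: $[N]=\{1,\dots,N\}$. A function $f:[N]^q\to\mathbb{R}$ vanishes on diagonals if $f(i_1,\dots,i_q)=0$ whenever $i_k=i_l$ for some $k\neq l$. For integers $1\le q\le N$, a sequence $\mathbf{X}=\{X_i:i\ge1\}$ of independent random variables and $f:[N]^q\to\mathbb{R}$ symmetric and vanishing on diagonals, $Q_q(N,f,\mathbf{X})=\sum_{1\le i_1,\dots,i_q\le N}f(i_1,\dots,i_q)X_{i_1}\cdots X_{i_q}$ is the homogeneous sum of order $q$. Representation: $(Z,\mathcal{Z},\mu)$ is a Borel space with a $\sigma$-finite non-atomic measure $\mu$, $\{A_i:i\ge1\}\subset\mathcal{Z}$ are pairwise disjoint sets with $\mu(A_i)=\lambda_i$, and $g_i=\mathbf{1}_{A_i}/\sqrt{\lambda_i}$. $\hat\eta$ is a compensated Poisson measure on $(Z,\mathcal{Z})$ with control $\mu$ (values on disjoint sets of finite measure are independent and $\hat\eta(B)$ has the law of a Poisson variable of parameter $\mu(B)$ minus $\mu(B)$), and $I_q$ denotes the multiple Wiener–Itô integral of order $q$ with respect to $\hat\eta$. Without loss of generality $P_i$ is realized as $P_i=I_1(g_i)=\hat\eta(A_i)/\sqrt{\lambda_i}$. The symbol $\otimes$ is the tensor product of functions: $(h_1\otimes\cdots\otimes h_q)(x_1,\dots,x_q)=h_1(x_1)\cdots h_q(x_q)$. Contractions: for symmetric $g\in L^2(\mu^q)$ and $1\le r\le q$, $$g\star_r^r g(t_1,\dots,t_{q-r},s_1,\dots,s_{q-r})=\int_{Z^r}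 g(z_1,\dots,z_r,t_1,\dots,t_{q-r})\,g(z_1,\dots,z_r,s_1,\dots,s_{q-r})\,\mu^r(dz_1,\dots,dz_r).$$ *)

theory Defs
  imports "HOL-Probability.Probability"
begin

section \<open>Homogeneous sums\<close>

text \<open>A $q$-tuple over $[N]$ is an extensional function in \<open>{..<q} \<rightarrow>\<^sub>E {1..N}\<close>, so positions are
  counted from 0 and values from 1. A function on $[N]^q$ is only ever evaluated on this set.\<close>

definition index_tuples :: "nat \<Rightarrow> nat \<Rightarrow> (nat \<Rightarrow> nat) set" where
  "index_tuples q N = {..<q} \<rightarrow>\<^sub>E {1..N}"

definition symmetric_on_tuples :: "nat \<Rightarrow> nat \<Rightarrow> ((nat \<Rightarrow> nat) \<Rightarrow> real) \<Rightarrow> bool" where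
  "symmetric_on_tuples q N f \<longleftrightarrow>
     (\<forall>i\<in>index_tuples q N. \<forall>\<pi>. \<pi> permutes {..<q} \<longrightarrow> f (i \<circ> \<pi>) = f i)"

definition vanishes_on_diagonals :: "nat \<Rightarrow> nat \<Rightarrow> ((nat \<Rightarrow> nat) \<Rightarrow> real) \<Rightarrow> bool" where
  "vanishes_on_diagonals q N f \<longleftrightarrow>
     (\<forall>i\<in>index_tuples q N. (\<exists>k<q. \<exists>l<q. k \<noteq> l \<and> i k = i l) \<longrightarrow> f i = 0)"

definition hom_sum ::
  "nat \<Rightarrow> nat \<Rightarrow> ((nat \<Rightarrow> nat) \<Rightarrow> real) \<Rightarrow> (nat \<Rightarrow> 'w \<Rightarrow> real) \<Rightarrow> 'w \<Rightarrow> real" where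
  "hom_sum q N f X \<omega> = (\<Sum>i\<in>index_tuples q N. f i * (\<Prod>k<q. X (i k) \<omega>))"


section \<open>Functions on $Z^q$\<close>

abbreviation power_measure :: "'z measure \<Rightarrow> nat \<Rightarrow> (nat \<Rightarrow> 'z) measure" where
  "power_measure \<mu> q \<equiv> PiM {..<q} (\<lambda>_. \<mu>)"

definition tensor :: "nat \<Rightarrow> (nat \<Rightarrow> 'z \<Rightarrow> real) \<Rightarrow> (nat \<Rightarrow> 'z) \<Rightarrow> real" where
  "tensor q h x = (\<Prod>k<q. h k (x k))"

definition tensor_sum ::
  "nat \<Rightarrow> nat \<Rightarrow> ((nat \<Rightarrow> nat) \<Rightarrow> real) \<Rightarrow> (nat \<Rightarrow> 'z \<Rightarrow> real) \<Rightarrow> (nat \<Rightarrow> 'z) \<Rightarrow> real" where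
  "tensor_sum q N f h x = (\<Sum>i\<in>index_tuples q N. f i * tensor q (\<lambda>k. h (i k)) x)"

text \<open>The argument \<open>y\<close> is the concatenation $(t_1,\dots,t_{q-r},s_1,\dots,s_{q-r})$.\<close>

definition contraction ::
  "'z measure \<Rightarrow> nat \<Rightarrow> nat \<Rightarrow> ((nat \<Rightarrow> 'z) \<Rightarrow> real) \<Rightarrow> (nat \<Rightarrow> 'z) \<Rightarrow> real" where
  "contraction \<mu> q r g y =
     (\<integral>z. g (\<lambda>k\<in>{..<q}. if k < r then z k else y (k - r)) *
          g (\<lambda>k\<in>{..<q}. if k < r then z k else y ((q - r) + (k - r))) \<partial>power_measure \<mu> r)"

definition L2_norm :: "'a measure \<Rightarrow> ('a \<Rightarrow> real) \<Rightarrow> real" where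
  "L2_norm M h = sqrt (\<integral>x. (h x)\<^sup>2 \<partial>M)"


section \<open>The control measure space\<close>

text \<open>A Borel space is a measurable space isomorphic to a Borel subset of the real line.\<close>

definition borel_isomorphic_space :: "'z measure \<Rightarrow> bool" where
  "borel_isomorphic_space M \<longleftrightarrow>
     (\<exists>B\<in>sets (borel :: real measure). \<exists>\<phi> \<psi>.
        \<phi> \<in> measurable M (restrict_space borel B) \<and>
        \<psi> \<in> measurable (restrict_space borel B) M \<and>
        (\<forall>z\<in>space M. \<psi> (\<phi> z) = z) \<and> (\<forall>x\<in>B. \<phi> (\<psi> x) = x))"

definition non_atomic :: "'z measure \<Rightarrow> bool" where
  "non_atomic M \<longleftrightarrow>
     \<not> (\<exists>A\<in>sets M. emeasure M A > 0 \<and>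
          (\<forall>B\<in>sets M. B \<subseteq> A \<longrightarrow> emeasure M B = 0 \<or> emeasure M (A - B) = 0))"


section \<open>Compensated Poisson measures and multiple integrals\<close>

text \<open>\<open>\<eta> B\<close> is only meaningful for measurable \<open>B\<close> of finite measure. Null sets are treated
  separately because \<^const>\<open>poisson_pmf\<close> is specified for positive parameters only. Being a random
  measure is expressed by almost sure countable additivity.\<close>

definition compensated_poisson_measure ::
  "'w measure \<Rightarrow> 'z measure \<Rightarrow> ('z set \<Rightarrow> 'w \<Rightarrow> real) \<Rightarrow> bool" where
  "compensated_poisson_measure M \<mu> \<eta> \<longleftrightarrow>
     (\<forall>B\<in>sets \<mu>. emeasure \<mu> B < \<infinity> \<longrightarrow> \<eta> B \<in> borel_measurable M) \<and>
     (\<forall>B\<in>sets \<mu>. emeasure \<mu> B = 0 \<longrightarrow> (AE \<omega> in M. \<eta> B \<omega> = 0)) \<and>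
     (\<forall>B\<in>sets \<mu>. 0 < emeasure \<mu> B \<and> emeasure \<mu> B < \<infinity> \<longrightarrow>
        distr M borel (\<eta> B) =
        distr (measure_pmf (poisson_pmf (measure \<mu> B))) borel (\<lambda>k. real k - measure \<mu> B)) \<and>
     (\<forall>B :: nat \<Rightarrow> 'z set. disjoint_family B \<and> range B \<subseteq> sets \<mu> \<and>
          (\<forall>i. emeasure \<mu> (B i) < \<infinity>) \<longrightarrow>
        prob_space.indep_vars M (\<lambda>_. borel) (\<lambda>i. \<eta> (B i)) UNIV) \<and>
     (\<forall>B :: nat \<Rightarrow> 'z set. disjoint_family B \<and> range B \<subseteq> sets \<mu> \<and>
          emeasure \<mu> (\<Union>i. B i) < \<infinity> \<longrightarrow>
        (AE \<omega> in M. (\<lambda>i. \<eta> (B i) \<omega>) sums \<eta> (\<Union>i. B i) \<omega>))"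

definition converges_L2 :: "'a measure \<Rightarrow> (nat \<Rightarrow> 'a \<Rightarrow> real) \<Rightarrow> ('a \<Rightarrow> real) \<Rightarrow> bool" where
  "converges_L2 M h g \<longleftrightarrow>
     (\<forall>n. h n \<in> borel_measurable M) \<and> g \<in> borel_measurable M \<and>
     (\<lambda>n. \<integral>\<^sup>+x. ennreal ((h n x - g x)\<^sup>2) \<partial>M) \<longlonglongrightarrow> 0"

text \<open>The multiple Wiener-Ito integral is built as usual: an elementary function, constant on
  products of disjoint sets of finite measure and zero on diagonal blocks,
  $\sum_i c(i)\, 1_{B_{i_1}} \otimes\cdots\otimes 1_{B_{i_q}}$, has the integral
  $\sum_i c(i)\, \hat\eta(B_{i_1})\cdots\hat\eta(B_{i_q})$,
  and the general case is the $L^2$-closure. Both steps are relations, in the style of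
  \<^const>\<open>has_integral\<close>, since the value is determined only almost surely.\<close>

definition has_elementary_integral ::
  "'z measure \<Rightarrow> ('z set \<Rightarrow> 'w \<Rightarrow> real) \<Rightarrow> nat \<Rightarrow> ((nat \<Rightarrow> 'z) \<Rightarrow> real) \<Rightarrow> ('w \<Rightarrow> real) \<Rightarrow> bool" where
  "has_elementary_integral \<mu> \<eta> q h J \<longleftrightarrow>
     (\<exists>m c B. vanishes_on_diagonals q m c \<and> disjoint_family_on B {1..m} \<and>
        (\<forall>i\<in>{1..m}. B i \<in> sets \<mu> \<and> emeasure \<mu> (B i) < \<infinity>) \<and>
        h = tensor_sum q m c (\<lambda>i. indicator (B i)) \<and>
        J = hom_sum q m c (\<lambda>i. \<eta> (B i)))"

definition has_multiple_integral ::
  "'w measure \<Rightarrow> 'z measure \<Rightarrow> ('z set \<Rightarrow> 'w \<Rightarrow> real) \<Rightarrow> nat \<Rightarrow>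
     ((nat \<Rightarrow> 'z) \<Rightarrow> real) \<Rightarrow> ('w \<Rightarrow> real) \<Rightarrow> bool" where
  "has_multiple_integral M \<mu> \<eta> q g F \<longleftrightarrow>
     (\<exists>h J. (\<forall>n. has_elementary_integral \<mu> \<eta> q (h n) (J n)) \<and>
        converges_L2 (power_measure \<mu> q) h g \<and> converges_L2 M J F)"


section \<open>Gaussian limits\<close>

definition positive_definite :: "real ^ 'd ^ 'd \<Rightarrow> bool" where
  "positive_definite C \<longleftrightarrow> transpose C = C \<and> (\<forall>x. x \<noteq> 0 \<longrightarrow> x \<bullet> (C *v x) > 0)"

text \<open>Centred Gaussian law with positive definite covariance matrix.\<close>

definition multivariate_normal :: "real ^ 'd ^ 'd \<Rightarrow> (real ^ 'd) measure" where
  "multivariate_normal C = density lborel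
     (\<lambda>x. ennreal (exp (- (x \<bullet> (matrix_inv C *v x)) / 2) / sqrt ((2 * pi) ^ CARD('d) * det C)))"

text \<open>Weak convergence in arbitrary dimension; the library's \<^const>\<open>weak_conv_m\<close> covers the
  real line only.\<close>

definition weak_conv_vec ::
  "(nat \<Rightarrow> (real ^ 'd) measure) \<Rightarrow> (real ^ 'd) measure \<Rightarrow> bool" where
  "weak_conv_vec L K \<longleftrightarrow>
     (\<forall>\<phi> :: real ^ 'd \<Rightarrow> real. continuous_on UNIV \<phi> \<and> bounded (range \<phi>) \<longrightarrow>
        (\<lambda>n. \<integral>x. \<phi> x \<partial>L n) \<longlonglongrightarrow> (\<integral>x. \<phi> x \<partial>K))"

end

theory Submission
  imports Defs
begin

text \<open>A homogeneous sum vanishing on diagonals is a multilinear form \<open>\<Sum>A. a A * (\<Prod>c\<in>A. P c)\<close> indexed by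
  finite sets, and the norms of the contractions of its kernel are, up to constants, the quantities
  \<open>contr\<close> of its coefficients. The equivalence is the cycle (1), (4), (2), (3), (1).

  (1) to (4) is projection on a coordinate. (4) to (2) follows from hypercontractivity, which bounds the
  sixth moments and makes the fourth powers uniformly integrable.

  (2) to (3): the square of a form is tested against the Wick-type products of Charlier polynomials of the \<open>P i\<close>,
  an orthogonal family whose norms do not depend on \<open>\<lambda>\<close>. Bessel's inequality
  bounds the fourth cumulant below by each \<open>contr\<close>, and for \<open>q = 1\<close> the fourth cumulant is
  exactly \<open>\<Sum>i. f i ^ 4 / \<lambda> i\<close>.

  (3) to (1): integration by parts for the Poisson law, applied to \<open>x \<mapsto> iexp (s x)\<close>, shows that the
  characteristic function of a linear combination of the forms almost satisfies the differential
  equation of the Gaussian one. The error consists of the variance of products of derivatives,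
  controlled by \<open>contr\<close>, and a remainder with the fourth moments of the derivatives, controlled by
  \<open>contr\<close> with \<open>r = 1\<close>, or by the sum in (3) if \<open>q = 1\<close>. Convergence in law then follows from the
  continuity theorem in several dimensions, proved by approximating
  continuous functions on a cube by trigonometric polynomials.\<close>

subsection \<open>Contractions of coefficients indexed by finite sets\<close>

text \<open>On the Poisson space a square brings in a linear term,
  \<open>x^2 = 1 + t x + (x^2 - 1 - t x)\<close>, and the fourth moment of a form of degree at least
  two is not computed exactly. A lower bound is enough: projecting the square of the form on the
  constants and on its top-degree component already gives \<open>3 s^2 + contr\<close>, where
  \<open>s\<close> is the second moment. Upper bounds work with \<open>1, x, x^2 - 1\<close>
  instead, which avoids the linear term, loses orthogonality and pays with a constant. The number
  \<alpha> enters upper bounds through \<open>1 / lam i \<le> 1 / \<alpha>\<close>: the jumps of the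
  coordinates stay bounded.

  Once the covariances converge, conditions on single components give joint convergence, because a
  mixed contraction is an inner product of two Gram matrices and Cauchy-Schwarz bounds it by the
  pure ones. The exception, the contraction of full order between forms of equal degree, is the
  square of their covariance and belongs to the mean. Forms of different degrees meet in one linear
  combination; each is divided by its degree, so that Euler's identity writes it as a sum of
  \<open>X i\<close> times derivatives.\<close>

definition djoin :: "('i set \<Rightarrow> real) \<Rightarrow> 'i set \<Rightarrow> 'i set \<Rightarrow> real" where
  "djoin a K A = (if K \<inter> A = {} then a (K \<union> A) else 0)"

text \<open>\<open>djoin a K\<close> lists the coefficients of the derivative of the form in the
  variables of \<open>K\<close>. The inner sum is thus an entry of the contraction of order
  \<open>r\<close>, with blocks of variables in place of tuples, and the whole is its squared norm.
  \<open>A\<close> and \<open>B\<close> may overlap: the contraction is not symmetrized.\<close>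

definition contr :: "'i set \<Rightarrow> nat \<Rightarrow> ('i set \<Rightarrow> real) \<Rightarrow> ('i set \<Rightarrow> real) \<Rightarrow> real" where
  "contr V r a b = (\<Sum>A\<in>Pow V. \<Sum>B\<in>Pow V. (\<Sum>K | K \<subseteq> V \<and> card K = r. djoin a K A * djoin b K B)\<^sup>2)"

text \<open>In matrix terms, the squared Hilbert-Schmidt norm of the product of \<open>m\<close>
  transposed with \<open>n\<close> is the inner product of the Gram matrices of the rows of
  \<open>m\<close> and of the rows of \<open>n\<close>.\<close>

lemma sum_square_matrix_product:
  fixes m :: "'a \<Rightarrow> 'b \<Rightarrow> real" and n :: "'a \<Rightarrow> 'c \<Rightarrow> real"
  shows "(\<Sum>j\<in>J. \<Sum>l\<in>L. (\<Sum>i\<in>I. m i j * n i l)\<^sup>2)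
    = (\<Sum>i\<in>I. \<Sum>k\<in>I. (\<Sum>j\<in>J. m i j * m k j) * (\<Sum>l\<in>L. n i l * n k l))"
proof -
  define t where "t i k j l = m i j * n i l * (m k j * n k l)" for i k j l
  have "(\<Sum>j\<in>J. \<Sum>l\<in>L. (\<Sum>i\<in>I. m i j * n i l)\<^sup>2) = (\<Sum>j\<in>J. \<Sum>l\<in>L. \<Sum>i\<in>I. \<Sum>k\<in>I. t i k j l)"
    by (simp add: power2_eq_square sum_product t_def)
  also have "\<dots> = (\<Sum>j\<in>J. \<Sum>i\<in>I. \<Sum>l\<in>L. \<Sum>k\<in>I. t i k j l)" by (intro sum.cong refl sum.swap)
  also have "\<dots> = (\<Sum>i\<in>I. \<Sum>j\<in>J. \<Sum>l\<in>L. \<Sum>k\<in>I. t i k j l)" by (rule sum.swap)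
  also have "\<dots> = (\<Sum>i\<in>I. \<Sum>j\<in>J. \<Sum>k\<in>I. \<Sum>l\<in>L. t i k j l)" by (intro sum.cong refl sum.swap)
  also have "\<dots> = (\<Sum>i\<in>I. \<Sum>k\<in>I. \<Sum>j\<in>J. \<Sum>l\<in>L. t i k j l)" by (intro sum.cong refl sum.swap)
  also have "\<dots> = (\<Sum>i\<in>I. \<Sum>k\<in>I. (\<Sum>j\<in>J. m i j * m k j) * (\<Sum>l\<in>L. n i l * n k l))"
    by (simp add: t_def sum_product mult_ac)
  finally show ?thesis .
qed

text \<open>This form separates \<open>a\<close> from \<open>b\<close>: it is the inner product of
  two Gram matrices indexed by blocks of size \<open>r\<close>, one for each kernel.\<close>

lemma contr_gram:
  "contr V r a b = (\<Sum>K | K \<subseteq> V \<and> card K = r. \<Sum>K' | K' \<subseteq> V \<and> card K' = r.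
     (\<Sum>A\<in>Pow V. djoin a K A * djoin a K' A) * (\<Sum>B\<in>Pow V. djoin b K B * djoin b K' B))"
  unfolding contr_def by (rule sum_square_matrix_product)

lemma contr_nonneg: "0 \<le> contr V r a b"
  unfolding contr_def by (intro sum_nonneg) auto

text \<open>Cauchy-Schwarz for the two Gram matrices. Mixed contractions are thereby controlled by
  those of the single kernels.\<close>

lemma contr_le: "contr V r a b \<le> sqrt (contr V r a a) * sqrt (contr V r b b)"
proof -
  let ?S = "{K. K \<subseteq> V \<and> card K = r} \<times> {K. K \<subseteq> V \<and> card K = r}"
  let ?g = "\<lambda>c (K, K'). \<Sum>A\<in>Pow V. djoin c K A * djoin c K' A"
  have e: "contr V r c d = (\<Sum>p\<in>?S. ?g c p * ?g d p)" for c d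
    unfolding contr_gram by (simp add: sum.cartesian_product case_prod_unfold)
  have "contr V r a b \<le> L2_set (?g a) ?S * L2_set (?g b) ?S"
    unfolding e by (rule order_trans[OF _ L2_set_mult_ineq]) (intro sum_mono, simp add: abs_mult[symmetric])
  then show ?thesis by (simp add: L2_set_def e power2_eq_square)
qed

lemma contr_eq_0_of_card:
  assumes "\<And>A. a A \<noteq> 0 \<Longrightarrow> card A = p" "finite V" "p < r"
  shows "contr V r a a = 0"
proof -
  have "djoin a K A = 0" if "K \<subseteq> V" "card K = r" "A \<subseteq> V" for K A
  proof -
    have "finite (K \<union> A)" using that assms(2) by (auto intro: finite_subset)
    then have "card (K \<union> A) \<noteq> p" using card_mono[of "K \<union> A" K] that assms(3) by auto
    then show ?thesis using assms(1)[of "K \<union> A"] by (auto simp: djoin_def)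
  qed
  then show ?thesis unfolding contr_def by (intro sum.neutral ballI) auto
qed

text \<open>A block of size \<open>p\<close> exhausts the support of a coefficient, so only
  \<open>A = {}\<close> survives and the Gram matrix has the rank-one entries
  \<open>a K * a K'\<close>.\<close>

lemma contr_card:
  assumes V: "finite V" and a: "\<And>A. a A \<noteq> 0 \<Longrightarrow> card A = p"
  shows "contr V p a a = (\<Sum>A\<in>Pow V. (a A)\<^sup>2)\<^sup>2"
proof -
  have j: "djoin a K A = (if A = {} then a K else 0)" if "K \<subseteq> V" "card K = p" "A \<in> Pow V" for K A
  proof -
    have f: "finite K" "finite A" using that V by (auto intro: finite_subset)
    show ?thesis
    proof (cases "K \<inter> A = {} \<and> A \<noteq> {}")
      case True
      then have "card (K \<union> A) = card K + card A" "card A > 0"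
        using f by (auto simp: card_Un_disjoint card_gt_0_iff)
      then show ?thesis using a[of "K \<union> A"] that True by (auto simp: djoin_def)
    qed (auto simp: djoin_def)
  qed
  have h: "(\<Sum>A\<in>Pow V. djoin a K A * djoin a K' A) = a K * a K'"
    if "K \<subseteq> V" "card K = p" "K' \<subseteq> V" "card K' = p" for K K'
  proof -
    have "(\<Sum>A\<in>Pow V. djoin a K A * djoin a K' A) = (\<Sum>A\<in>Pow V. if A = {} then a K * a K' else 0)"
      using that by (intro sum.cong) (auto simp: j)
    then show ?thesis using V by simp
  qed
  have "contr V p a a = (\<Sum>K | K \<subseteq> V \<and> card K = p. \<Sum>K' | K' \<subseteq> V \<and> card K' = p. (a K)\<^sup>2 * (a K')\<^sup>2)"
    unfolding contr_gram by (intro sum.cong refl) (simp add: h power2_eq_square mult_ac)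
  also have "\<dots> = (\<Sum>K | K \<subseteq> V \<and> card K = p. (a K)\<^sup>2)\<^sup>2"
    by (simp add: power2_eq_square sum_product)
  also have "(\<Sum>K | K \<subseteq> V \<and> card K = p. (a K)\<^sup>2) = (\<Sum>A\<in>Pow V. (a A)\<^sup>2)"
    using V a by (intro sum.mono_neutral_left) auto
  finally show ?thesis .
qed

text \<open>In a decomposition of two pairs with the same union and intersection \<open>L\<close> into blocks
  \<open>K, K', A, B\<close>, only the distribution of the elements of \<open>L\<close> is free: each of them lies either
  in \<open>K \<inter> K'\<close> or in \<open>A \<inter> B\<close>. This accounts for the factor \<open>2 ^ card L\<close>.\<close>

lemma sum_pairs_same_union_inter:
  assumes V: "finite V"
  shows "(\<Sum>A\<in>Pow V. \<Sum>B\<in>Pow V. \<Sum>A'\<in>Pow V. \<Sum>B'\<in>Pow V.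
       if A \<inter> B = A' \<inter> B' \<and> A \<union> B = A' \<union> B' then 2 ^ card (A \<inter> B) * (a A * a B * a A' * a B') else 0)
     = (\<Sum>K\<in>Pow V. \<Sum>K'\<in>Pow V. (\<Sum>A\<in>Pow V. djoin a K A * djoin a K' A)\<^sup>2)"
proof -
  let ?P = "Pow V"
  let ?S = "{(S1, S4, S3, S2, M). S1 \<subseteq> V \<and> S4 \<subseteq> V \<and> S3 \<subseteq> V \<and> S2 \<subseteq> V \<and> S1 \<inter> S4 = S3 \<inter> S2
      \<and> S1 \<union> S4 = S3 \<union> S2 \<and> M \<subseteq> S1 \<inter> S4}"
  let ?R = "{(K, K', A, B). K \<subseteq> V \<and> K' \<subseteq> V \<and> A \<subseteq> V \<and> B \<subseteq> V \<and> K \<inter> A = {} \<and> K' \<inter> B = {}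
      \<and> K' \<inter> A = {} \<and> K \<inter> B = {}}"
  \<comment> \<open>The factor \<open>2 ^ card (A \<inter> B)\<close> becomes a sum over the subsets
    \<open>M\<close> of the intersection, which leaves a sum over configurations without
    weights.\<close>
  have "(\<Sum>A\<in>?P. \<Sum>B\<in>?P. \<Sum>A'\<in>?P. \<Sum>B'\<in>?P.
       if A \<inter> B = A' \<inter> B' \<and> A \<union> B = A' \<union> B' then 2 ^ card (A \<inter> B) * (a A * a B * a A' * a B') else 0)
    = (\<Sum>A\<in>?P. \<Sum>B\<in>?P. \<Sum>A'\<in>?P. \<Sum>B'\<in>?P. \<Sum>M\<in>?P.
        if A \<inter> B = A' \<inter> B' \<and> A \<union> B = A' \<union> B' \<and> M \<subseteq> A \<inter> B then a A * a B * a A' * a B' else 0)"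
  proof (intro sum.cong refl)
    fix A B A' B' assume *: "A \<in> ?P" "B \<in> ?P" "A' \<in> ?P" "B' \<in> ?P"
    have "(\<Sum>M\<in>?P. if A \<inter> B = A' \<inter> B' \<and> A \<union> B = A' \<union> B' \<and> M \<subseteq> A \<inter> B then a A * a B * a A' * a B' else 0)
      = (\<Sum>M\<in>?P. if M \<subseteq> A \<inter> B then (if A \<inter> B = A' \<inter> B' \<and> A \<union> B = A' \<union> B' then a A * a B * a A' * a B' else 0) else 0)"
      by (rule sum.cong) simp_all
    also have "\<dots> = (\<Sum>M\<in>{M\<in>?P. M \<subseteq> A \<inter> B}. if A \<inter> B = A' \<inter> B' \<and> A \<union> B = A' \<union> B' then a A * a B * a A' * a B' else 0)"
      using V by (simp only: sum.inter_filter finite_Pow_iff)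
    also have "{M\<in>?P. M \<subseteq> A \<inter> B} = Pow (A \<inter> B)" using * by auto
    finally have "(\<Sum>M\<in>?P. if A \<inter> B = A' \<inter> B' \<and> A \<union> B = A' \<union> B' \<and> M \<subseteq> A \<inter> B then a A * a B * a A' * a B' else 0)
      = (\<Sum>M\<in>Pow (A \<inter> B). if A \<inter> B = A' \<inter> B' \<and> A \<union> B = A' \<union> B' then a A * a B * a A' * a B' else 0)" .
    moreover have "real (card (Pow (A \<inter> B))) = 2 ^ card (A \<inter> B)"
      using * V by (subst card_Pow) (auto intro: finite_subset)
    ultimately show "(if A \<inter> B = A' \<inter> B' \<and> A \<union> B = A' \<union> B' then 2 ^ card (A \<inter> B) * (a A * a B * a A' * a B') else 0)
      = (\<Sum>M\<in>?P. if A \<inter> B = A' \<inter> B' \<and> A \<union> B = A' \<union> B' \<and> M \<subseteq> A \<inter> B then a A * a B * a A' * a B' else 0)"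
      by (simp del: Pow_Int_eq)
  qed
  also have "\<dots> = (\<Sum>(A, B, A', B', M)\<in>?P \<times> ?P \<times> ?P \<times> ?P \<times> ?P.
        if A \<inter> B = A' \<inter> B' \<and> A \<union> B = A' \<union> B' \<and> M \<subseteq> A \<inter> B then a A * a B * a A' * a B' else 0)"
    by (simp add: sum.cartesian_product)
  also have "\<dots> = (\<Sum>(A, B, A', B', M)\<in>?S. a A * a B * a A' * a B')"
    using V by (intro sum.mono_neutral_cong_right) (auto split: if_splits)
  \<comment> \<open>A point of the union outside the intersection lies in exactly one of
    \<open>S1\<close>, \<open>S4\<close> and exactly one of \<open>S3\<close>, \<open>S2\<close>;
    the four combinations are the four blocks. A point of the intersection goes to \<open>K\<close>
    and \<open>K'\<close> if it is in \<open>M\<close>, and to \<open>A\<close> and \<open>B\<close>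
    otherwise. In the other direction \<open>M\<close> is \<open>K \<inter> K'\<close>.\<close>
  also have "\<dots> = (\<Sum>(K, K', A, B)\<in>?R. a (K \<union> A) * a (K' \<union> B) * a (K' \<union> A) * a (K \<union> B))"
  proof (rule sum.reindex_bij_witness[where
      j = "\<lambda>(S1, S4, S3, S2, M). (((S1 \<inter> S2) - (S1 \<inter> S4)) \<union> M, ((S4 \<inter> S3) - (S1 \<inter> S4)) \<union> M,
             ((S1 \<inter> S3) - (S1 \<inter> S4)) \<union> ((S1 \<inter> S4) - M), ((S4 \<inter> S2) - (S1 \<inter> S4)) \<union> ((S1 \<inter> S4) - M))"
      and i = "\<lambda>(K, K', A, B). (K \<union> A, K' \<union> B, K' \<union> A, K \<union> B, K \<inter> K')"], goal_cases)
    case (1 x) then show ?case by (auto; blast)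
  next
    case (2 x) then show ?case by (auto; blast)
  next
    case (3 x) then show ?case by (auto; blast)
  next
    case (4 x) then show ?case by (auto; blast)
  next
    case (5 x)
    obtain S1 S4 S3 S2 M where x: "x = (S1, S4, S3, S2, M)" by (cases x)
    have h: "S1 \<inter> S4 = S3 \<inter> S2" "S1 \<union> S4 = S3 \<union> S2" "M \<subseteq> S1 \<inter> S4" using 5 by (auto simp: x)
    have "S1 \<inter> S2 - S1 \<inter> S4 \<union> M \<union> (S1 \<inter> S3 - S1 \<inter> S4 \<union> (S1 \<inter> S4 - M)) = S1"
      "S4 \<inter> S3 - S1 \<inter> S4 \<union> M \<union> (S4 \<inter> S2 - S1 \<inter> S4 \<union> (S1 \<inter> S4 - M)) = S4"
      "S4 \<inter> S3 - S1 \<inter> S4 \<union> M \<union> (S1 \<inter> S3 - S1 \<inter> S4 \<union> (S1 \<inter> S4 - M)) = S3"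
      "S1 \<inter> S2 - S1 \<inter> S4 \<union> M \<union> (S4 \<inter> S2 - S1 \<inter> S4 \<union> (S1 \<inter> S4 - M)) = S2"
      using h by blast+
    then show ?case by (simp add: x)
  qed
  also have "\<dots> = (\<Sum>(K, K', A, B)\<in>?P \<times> ?P \<times> ?P \<times> ?P. djoin a K A * djoin a K' A * (djoin a K B * djoin a K' B))"
    using V by (intro sum.mono_neutral_cong_left) (auto simp: djoin_def split: if_splits)
  also have "\<dots> = (\<Sum>K\<in>?P. \<Sum>K'\<in>?P. (\<Sum>A\<in>?P. djoin a K A * djoin a K' A)\<^sup>2)"
    by (simp add: sum.cartesian_product[symmetric] power2_eq_square sum_product)
  finally show ?thesis .
qed

text \<open>Only pairs \<open>K, K'\<close> of equal size contribute to the right-hand side of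
  \<open>sum_pairs_same_union_inter\<close>; sizes \<open>0\<close> and \<open>p\<close> each give the squared norm of \<open>a\<close>.\<close>

lemma sum_pairs_same_union_inter_ge:
  assumes V: "finite V" and a: "\<And>A. a A \<noteq> 0 \<Longrightarrow> card A = p" and r: "1 \<le> r" "r < p"
  shows "2 * (\<Sum>A\<in>Pow V. (a A)\<^sup>2)\<^sup>2 + contr V r a a
    \<le> (\<Sum>K\<in>Pow V. \<Sum>K'\<in>Pow V. (\<Sum>A\<in>Pow V. djoin a K A * djoin a K' A)\<^sup>2)"
proof -
  define h where "h K K' = (\<Sum>A\<in>Pow V. djoin a K A * djoin a K' A)\<^sup>2" for K K'
  define C where "C s = {K. K \<subseteq> V \<and> card K = s} \<times> {K. K \<subseteq> V \<and> card K = s}" for s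
  define g where "g s = (\<Sum>(K, K')\<in>C s. h K K')" for s
  have fin: "finite (C s)" for s using V by (auto simp: C_def intro!: finite_cartesian_product)
  have gr: "contr V s a a = g s" for s
    unfolding contr_gram g_def h_def C_def by (simp add: sum.cartesian_product power2_eq_square)
  have g0: "g 0 = (\<Sum>A\<in>Pow V. (a A)\<^sup>2)\<^sup>2"
  proof -
    have "{K. K \<subseteq> V \<and> card K = 0} = {{}}" using V by (auto dest: finite_subset)
    then show ?thesis by (simp add: g_def C_def h_def djoin_def power2_eq_square)
  qed
  have gp: "g p = (\<Sum>A\<in>Pow V. (a A)\<^sup>2)\<^sup>2"
    unfolding gr[symmetric] by (rule contr_card[OF V]) (rule a)
  \<comment> \<open>The bounds on \<open>r\<close> keep the size classes \<open>0\<close>,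
    \<open>r\<close> and \<open>p\<close> apart.\<close>
  have "g 0 + g p + g r = (\<Sum>(K, K')\<in>C 0 \<union> C p \<union> C r. h K K')"
    unfolding g_def using r fin by (subst sum.union_disjoint; (subst sum.union_disjoint)?) (auto simp: C_def)
  also have "\<dots> \<le> (\<Sum>(K, K')\<in>Pow V \<times> Pow V. h K K')"
    using V by (intro sum_mono2) (auto simp: C_def h_def)
  also have "\<dots> = (\<Sum>K\<in>Pow V. \<Sum>K'\<in>Pow V. h K K')" by (simp add: sum.cartesian_product)
  finally show ?thesis by (simp add: g0 gp gr h_def)
qed

text \<open>The influences of the single variables are the diagonal entries of the Gram matrix for
  \<open>r = 1\<close>, so their squares are part of its squared norm.\<close>

lemma sum_influences_le_contr:
  assumes V: "finite V"
  shows "(\<Sum>i\<in>V. (\<Sum>A\<in>Pow V. (djoin a {i} A)\<^sup>2)\<^sup>2) \<le> contr V 1 a a"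
proof -
  define h where "h K K' = (\<Sum>A\<in>Pow V. djoin a K A * djoin a K' A)\<^sup>2" for K K'
  have "(\<Sum>i\<in>V. (\<Sum>A\<in>Pow V. (djoin a {i} A)\<^sup>2)\<^sup>2) = (\<Sum>i\<in>V. h {i} {i})"
    by (simp add: h_def power2_eq_square)
  also have "\<dots> = (\<Sum>(K, K')\<in>(\<lambda>i. ({i}, {i})) ` V. h K K')"
    by (subst sum.reindex) (auto simp: inj_on_def)
  also have "\<dots> \<le> (\<Sum>(K, K')\<in>{K. K \<subseteq> V \<and> card K = 1} \<times> {K. K \<subseteq> V \<and> card K = 1}. h K K')"
    using V by (intro sum_mono2) (auto simp: h_def)
  also have "\<dots> = contr V 1 a a"
    unfolding contr_gram h_def by (simp add: sum.cartesian_product power2_eq_square)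
  finally show ?thesis .
qed

subsection \<open>Functions with moments of all orders\<close>

text \<open>The functions with this property form an algebra. Integrability of every polynomial
  expression in the variables then follows from introduction rules alone.\<close>

definition all_moments :: "'a measure \<Rightarrow> ('a \<Rightarrow> real) \<Rightarrow> bool" where
  "all_moments M f \<longleftrightarrow> f \<in> borel_measurable M \<and> (\<forall>k::nat. integrable M (\<lambda>x. \<bar>f x\<bar> ^ k))"

named_theorems all_moments_intros

lemma all_moments_measurable: "all_moments M f \<Longrightarrow> f \<in> borel_measurable M"
  by (simp add: all_moments_def)

lemma all_moments_integrable: "all_moments M f \<Longrightarrow> integrable M f"
  using integrable_abs_cancel[of M f] by (auto simp: all_moments_def dest: spec[of _ 1])

lemma (in prob_space) all_moments_const [all_moments_intros]: "all_moments M (\<lambda>x. c)"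
  by (simp add: all_moments_def)

lemma abs_power_add_le:
  fixes a b :: real shows "\<bar>a + b\<bar> ^ k \<le> 2 ^ k * (\<bar>a\<bar> ^ k + \<bar>b\<bar> ^ k)"
proof -
  have "\<bar>a + b\<bar> ^ k \<le> (2 * max \<bar>a\<bar> \<bar>b\<bar>) ^ k" by (intro power_mono) auto
  also have "\<dots> \<le> 2 ^ k * (\<bar>a\<bar> ^ k + \<bar>b\<bar> ^ k)"
    by (auto simp: power_mult_distrib max_def)
  finally show ?thesis .
qed

lemma all_moments_add [all_moments_intros]:
  assumes "all_moments M f" "all_moments M g" shows "all_moments M (\<lambda>x. f x + g x)"
  unfolding all_moments_def
proof (intro conjI allI)
  show [measurable]: "(\<lambda>x. f x + g x) \<in> borel_measurable M"
    using assms by (auto simp: all_moments_def)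
  show "integrable M (\<lambda>x. \<bar>f x + g x\<bar> ^ k)" for k
  proof (rule Bochner_Integration.integrable_bound)
    show "integrable M (\<lambda>x. 2 ^ k * (\<bar>f x\<bar> ^ k + \<bar>g x\<bar> ^ k))"
      using assms by (auto simp: all_moments_def)
  qed (use abs_power_add_le in \<open>auto intro!: AE_I2\<close>)
qed

lemma abs_power_mult_le:
  fixes a b :: real shows "\<bar>a * b\<bar> ^ k \<le> \<bar>a\<bar> ^ (2 * k) + \<bar>b\<bar> ^ (2 * k)"
proof -
  have "2 * (\<bar>a\<bar> ^ k * \<bar>b\<bar> ^ k) \<le> (\<bar>a\<bar> ^ k)\<^sup>2 + (\<bar>b\<bar> ^ k)\<^sup>2"
    using sum_squares_bound[of "\<bar>a\<bar> ^ k" "\<bar>b\<bar> ^ k"] by simp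
  moreover have "0 \<le> \<bar>a\<bar> ^ k * \<bar>b\<bar> ^ k" by simp
  ultimately have "\<bar>a\<bar> ^ k * \<bar>b\<bar> ^ k \<le> (\<bar>a\<bar> ^ k)\<^sup>2 + (\<bar>b\<bar> ^ k)\<^sup>2" by linarith
  then show ?thesis by (simp add: abs_mult power_mult_distrib power_mult[symmetric] mult.commute)
qed

lemma all_moments_mult [all_moments_intros]:
  assumes "all_moments M f" "all_moments M g" shows "all_moments M (\<lambda>x. f x * g x)"
  unfolding all_moments_def
proof (intro conjI allI)
  show [measurable]: "(\<lambda>x. f x * g x) \<in> borel_measurable M"
    using assms by (auto simp: all_moments_def)
  show "integrable M (\<lambda>x. \<bar>f x * g x\<bar> ^ k)" for k
  proof (rule Bochner_Integration.integrable_bound)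
    show "integrable M (\<lambda>x. \<bar>f x\<bar> ^ (2 * k) + \<bar>g x\<bar> ^ (2 * k))"
      using assms by (auto simp: all_moments_def)
  qed (use abs_power_mult_le in \<open>auto intro!: AE_I2\<close>)
qed

lemma (in prob_space) all_moments_uminus [all_moments_intros]:
  "all_moments M f \<Longrightarrow> all_moments M (\<lambda>x. - f x)"
  by (simp add: all_moments_def)

lemma (in prob_space) all_moments_diff [all_moments_intros]:
  "all_moments M f \<Longrightarrow> all_moments M g \<Longrightarrow> all_moments M (\<lambda>x. f x - g x)"
  using all_moments_add[of M f "\<lambda>x. - g x"] all_moments_uminus[of g] by simp

lemma (in prob_space) all_moments_divide [all_moments_intros]:
  "all_moments M f \<Longrightarrow> all_moments M (\<lambda>x. f x / c)"
  using all_moments_mult[of M f "\<lambda>x. inverse c"] all_moments_const by (simp add: divide_inverse)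

lemma (in prob_space) all_moments_power [all_moments_intros]:
  "all_moments M f \<Longrightarrow> all_moments M (\<lambda>x. f x ^ k)"
  by (induction k) (auto intro: all_moments_intros)

lemma all_moments_abs [all_moments_intros]: "all_moments M f \<Longrightarrow> all_moments M (\<lambda>x. \<bar>f x\<bar>)"
  by (auto simp: all_moments_def intro: borel_measurable_abs)

lemma (in prob_space) all_moments_sum [all_moments_intros]:
  "(\<And>i. i \<in> I \<Longrightarrow> all_moments M (f i)) \<Longrightarrow> all_moments M (\<lambda>x. \<Sum>i\<in>I. f i x)"
  by (induction I rule: infinite_finite_induct) (auto intro: all_moments_intros)

lemma (in prob_space) all_moments_prod [all_moments_intros]:
  "(\<And>i. i \<in> I \<Longrightarrow> all_moments M (f i)) \<Longrightarrow> all_moments M (\<lambda>x. \<Prod>i\<in>I. f i x)"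
  by (induction I rule: infinite_finite_induct) (auto intro: all_moments_intros)

lemma all_moments_distr:
  assumes [measurable]: "X \<in> borel_measurable M"
  shows "all_moments (distr M borel X) (\<lambda>x. x) \<longleftrightarrow> all_moments M X"
  by (auto simp: all_moments_def integrable_distr_eq)

subsection \<open>The Poisson distribution\<close>

lemma power_le_fact_exp:
  fixes x :: real assumes "0 \<le> x" shows "x ^ m \<le> fact m * exp x"
proof -
  have "x ^ m /\<^sub>R fact m \<le> (\<Sum>n. x ^ n /\<^sub>R fact n)"
    using sum_le_suminf[OF summable_exp_generic[of x], of "{m}"] assms by simp
  then show ?thesis by (simp add: exp_def field_simps)
qed

lemma integrable_poisson_iff:
  fixes h :: "nat \<Rightarrow> 'b::{banach, second_countable_topology}" assumes "0 < l"
  shows "integrable (measure_pmf (poisson_pmf l)) h \<longleftrightarrow> summable (\<lambda>k. l ^ k / fact k * exp (- l) * norm (h k))"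
  using assms unfolding measure_pmf_eq_density
  by (subst integrable_density) (auto simp: integrable_count_space_nat_iff abs_mult)

lemma integral_poisson:
  fixes h :: "nat \<Rightarrow> 'b::{banach, second_countable_topology}" assumes "0 < l"
  shows "integral\<^sup>L (measure_pmf (poisson_pmf l)) h = (\<integral>k. (l ^ k / fact k * exp (- l)) *\<^sub>R h k \<partial>count_space UNIV)"
  using assms unfolding measure_pmf_eq_density by (subst integral_density) auto

lemma all_moments_poisson:
  assumes l: "0 < l" shows "all_moments (measure_pmf (poisson_pmf l)) real"
  unfolding all_moments_def
proof (intro conjI allI)
  fix m :: nat
  \<comment> \<open>From \<open>k ^ m \<le> fact m * exp k\<close> the polynomial weight is absorbed
    by passing from the intensity \<open>l\<close> to \<open>l * exp 1\<close>.\<close>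
  have "summable (\<lambda>k. exp (- l) * fact m * ((l * exp 1) ^ k / fact k))"
    using summable_exp[of "l * exp 1"] by (intro summable_mult) (simp add: divide_inverse mult.commute)
  then have "summable (\<lambda>k. l ^ k / fact k * exp (- l) * norm (real k ^ m))"
  proof (rule summable_comparison_test_ev[rotated], intro always_eventually allI)
    fix k
    have "real k ^ m \<le> fact m * exp 1 ^ k"
      using power_le_fact_exp[of "real k" m] by (simp add: exp_of_nat_mult[symmetric])
    then have "l ^ k / fact k * exp (- l) * real k ^ m \<le> l ^ k / fact k * exp (- l) * (fact m * exp 1 ^ k)"
      using l by (intro mult_left_mono) auto
    then show "norm (l ^ k / fact k * exp (- l) * norm (real k ^ m)) \<le> exp (- l) * fact m * ((l * exp 1) ^ k / fact k)"
      using l by (simp add: abs_mult power_mult_distrib mult_ac)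
  qed
  then show "integrable (measure_pmf (poisson_pmf l)) (\<lambda>k. \<bar>real k\<bar> ^ m)"
    using l by (simp add: integrable_poisson_iff)
qed simp

text \<open>The Poisson weights satisfy \<open>k * l ^ k / k! = l * l ^ (k - 1) / (k - 1)!\<close>,
  and the term \<open>k = 0\<close> vanishes, so the series shifts by one. Values in a Banach space
  cover the complex exponentials to which this is applied.\<close>

lemma poisson_size_bias:
  fixes h :: "nat \<Rightarrow> 'b::{banach, second_countable_topology}"
  assumes l: "0 < l" and h: "integrable (measure_pmf (poisson_pmf l)) (\<lambda>k. real k *\<^sub>R h k)"
  shows "(\<integral>k. real k *\<^sub>R h k \<partial>measure_pmf (poisson_pmf l)) = l *\<^sub>R (\<integral>k. h (Suc k) \<partial>measure_pmf (poisson_pmf l))"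
proof -
  define w where "w k = (l ^ k / fact k * exp (- l)) *\<^sub>R (real k *\<^sub>R h k)" for k
  define v where "v k = (l ^ k / fact k * exp (- l)) *\<^sub>R h (Suc k)" for k
  have wv: "w (Suc k) = l *\<^sub>R v k" for k
  proof -
    have "l ^ Suc k / fact (Suc k) * exp (- l) * real (Suc k) = l * (l ^ k / fact k * exp (- l))"
      by (simp add: field_simps del: of_nat_Suc)
    then show ?thesis by (simp add: w_def v_def del: of_nat_Suc power_Suc fact_Suc)
  qed
  have w: "summable (\<lambda>k. norm (w k))"
    using h l by (simp add: integrable_poisson_iff w_def abs_mult mult_ac)
  then have "summable (\<lambda>k. norm (w (Suc k)))" by (subst summable_Suc_iff)
  then have v: "summable (\<lambda>k. norm (v k))"
    using l summable_cmult_iff[of l "\<lambda>k. norm (v k)"] by (simp add: wv)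
  have "(\<integral>k. real k *\<^sub>R h k \<partial>measure_pmf (poisson_pmf l)) = (\<integral>k. w k \<partial>count_space UNIV)"
    using l by (subst integral_poisson) (simp_all add: w_def[abs_def])
  also have "\<dots> = (\<Sum>k. w k)"
    using w by (intro integral_count_space_nat) (simp add: integrable_count_space_nat_iff)
  also have "\<dots> = (\<Sum>k. w (Suc k))"
    using suminf_split_head[OF summable_norm_cancel[OF w]] by (simp add: w_def)
  also have "\<dots> = l *\<^sub>R (\<Sum>k. v k)"
    using summable_norm_cancel[OF v] by (simp add: wv suminf_scaleR_right)
  also have "(\<Sum>k. v k) = (\<integral>k. v k \<partial>count_space UNIV)"
    using v by (intro integral_count_space_nat[symmetric]) (simp add: integrable_count_space_nat_iff)
  also have "\<dots> = (\<integral>k. h (Suc k) \<partial>measure_pmf (poisson_pmf l))"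
    using l by (subst integral_poisson) (simp_all add: v_def[abs_def])
  finally show ?thesis .
qed

definition std_poisson :: "real \<Rightarrow> real measure" where
  "std_poisson l = distr (measure_pmf (poisson_pmf l)) borel (\<lambda>k. (real k - l) / sqrt l)"

lemma sets_std_poisson [simp, measurable_cong]: "sets (std_poisson l) = sets borel"
  and space_std_poisson [simp]: "space (std_poisson l) = UNIV"
  by (simp_all add: std_poisson_def)

lemma prob_space_std_poisson: "prob_space (std_poisson l)"
  unfolding std_poisson_def by (rule prob_space.prob_space_distr) (auto intro: prob_space_measure_pmf)

lemma all_moments_std_poisson: "0 < l \<Longrightarrow> all_moments (std_poisson l) (\<lambda>x. x)"
  unfolding std_poisson_def
  by (subst all_moments_distr)
    (auto intro!: prob_space.all_moments_divide prob_space.all_moments_diff prob_space.all_moments_const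
      prob_space_measure_pmf all_moments_poisson)

text \<open>Integration by parts on the Poisson space, reduced to a single coordinate.\<close>

lemma std_poisson_stein:
  fixes h :: "real \<Rightarrow> 'b::{banach, second_countable_topology}"
  assumes l: "0 < l" and [measurable]: "h \<in> borel_measurable borel"
    and i1: "integrable (std_poisson l) (\<lambda>x. x *\<^sub>R h x)" and i2: "integrable (std_poisson l) h"
  shows "(\<integral>x. x *\<^sub>R h x \<partial>std_poisson l)
    = sqrt l *\<^sub>R ((\<integral>x. h (x + 1 / sqrt l) \<partial>std_poisson l) - (\<integral>x. h x \<partial>std_poisson l))"
proof -
  let ?P = "measure_pmf (poisson_pmf l)"
  define g where "g k = h ((real k - l) / sqrt l)" for k :: nat
  have i2': "integrable ?P g"
    using i2 unfolding std_poisson_def g_def by (subst (asm) integrable_distr_eq) auto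
  have i1': "integrable ?P (\<lambda>k. ((real k - l) / sqrt l) *\<^sub>R g k)"
    using i1 unfolding std_poisson_def g_def by (subst (asm) integrable_distr_eq) auto
  have e: "real k *\<^sub>R g k = sqrt l *\<^sub>R (((real k - l) / sqrt l) *\<^sub>R g k) + l *\<^sub>R g k" for k
    using l by (simp add: scaleR_add_left[symmetric])
  have i3: "integrable ?P (\<lambda>k. real k *\<^sub>R g k)"
    unfolding e using i1' i2' by (intro Bochner_Integration.integrable_add integrable_scaleR_right) auto
  have gS: "g (Suc k) = h ((real k - l) / sqrt l + 1 / sqrt l)" for k
    by (simp add: g_def add_divide_distrib[symmetric] algebra_simps)
  have "(\<integral>x. x *\<^sub>R h x \<partial>std_poisson l) = (\<integral>k. ((real k - l) / sqrt l) *\<^sub>R g k \<partial>?P)"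
    unfolding std_poisson_def g_def by (subst integral_distr) auto
  also have "\<dots> = (\<integral>k. (1 / sqrt l) *\<^sub>R (real k *\<^sub>R g k - l *\<^sub>R g k) \<partial>?P)"
    by (intro Bochner_Integration.integral_cong refl) (simp add: scaleR_diff_left[symmetric])
  also have "\<dots> = (1 / sqrt l) *\<^sub>R (l *\<^sub>R (\<integral>k. g (Suc k) \<partial>?P) - l *\<^sub>R (\<integral>k. g k \<partial>?P))"
    using i2' i3 l poisson_size_bias[OF l i3] by simp
  also have "\<dots> = sqrt l *\<^sub>R ((\<integral>k. g (Suc k) \<partial>?P) - (\<integral>k. g k \<partial>?P))"
    using l by (simp add: scaleR_diff_right[symmetric] real_div_sqrt)
  also have "(\<integral>k. g (Suc k) \<partial>?P) = (\<integral>x. h (x + 1 / sqrt l) \<partial>std_poisson l)"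
    unfolding std_poisson_def gS by (subst integral_distr) auto
  also have "(\<integral>k. g k \<partial>?P) = (\<integral>x. h x \<partial>std_poisson l)"
    unfolding std_poisson_def g_def by (subst integral_distr) auto
  finally show ?thesis .
qed

text \<open>Integration by parts with \<open>h x = x ^ k\<close> expresses the moment of order
  \<open>k + 1\<close> by lower ones. Order six is what the hypercontractive inequality
  requires.\<close>

lemma std_poisson_moments:
  fixes l :: real assumes l: "0 < l" defines "t \<equiv> 1 / sqrt l"
  shows "(\<integral>x. x \<partial>std_poisson l) = 0"
    and "(\<integral>x. x ^ 2 \<partial>std_poisson l) = 1"
    and "(\<integral>x. x ^ 3 \<partial>std_poisson l) = t"
    and "(\<integral>x. x ^ 4 \<partial>std_poisson l) = 3 + t ^ 2"
    and "(\<integral>x. x ^ 5 \<partial>std_poisson l) = 10 * t + t ^ 3"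
    and "(\<integral>x. x ^ 6 \<partial>std_poisson l) = 15 + 25 * t ^ 2 + t ^ 4"
proof -
  interpret P: prob_space "std_poisson l" by (rule prob_space_std_poisson)
  note am = P.all_moments_power[OF all_moments_std_poisson[OF l]]
  have int [simp]: "integrable (std_poisson l) (\<lambda>x. x ^ k)" for k
    using all_moments_integrable[OF am] .
  have int1 [simp]: "integrable (std_poisson l) (\<lambda>x. x)" using int[of 1] by simp
  have st: "sqrt l * t = 1" using l by (simp add: t_def)
  have rec: "(\<integral>x. x ^ Suc k \<partial>std_poisson l) = sqrt l * ((\<integral>x. (x + t) ^ k \<partial>std_poisson l) - (\<integral>x. x ^ k \<partial>std_poisson l))" for k
    using std_poisson_stein[OF l, of "\<lambda>x. x ^ k"] int[of "Suc k"] by (simp add: t_def)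
  have u: "measure (std_poisson l) UNIV = 1" using P.prob_space by simp
  show m1: "(\<integral>x. x \<partial>std_poisson l) = 0" using rec[of 0] by simp
  have "(\<integral>x. x ^ 2 \<partial>std_poisson l) = sqrt l * t"
    using rec[of 1] by (simp add: m1 u numeral_2_eq_2)
  then show m2: "(\<integral>x. x ^ 2 \<partial>std_poisson l) = 1" by (simp add: st)
  have "(x + t) ^ 2 = x ^ 2 + 2 * t * x + t ^ 2" for x by (simp add: power2_eq_square algebra_simps)
  then have "(\<integral>x. x ^ 3 \<partial>std_poisson l) = sqrt l * t * t"
    using rec[of 2] by (simp add: m1 m2 u power2_eq_square[of t])
  then show m3: "(\<integral>x. x ^ 3 \<partial>std_poisson l) = t" by (simp add: st)
  have "(x + t) ^ 3 = x ^ 3 + 3 * t * x ^ 2 + 3 * t ^ 2 * x + t ^ 3" for x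
    by (simp add: power2_eq_square power3_eq_cube algebra_simps)
  then have "(\<integral>x. x ^ 4 \<partial>std_poisson l) = sqrt l * (3 * t + t ^ 3)"
    using rec[of 3] by (simp add: m1 m2 m3 u)
  also have "\<dots> = (sqrt l * t) * (3 + t ^ 2)" by (simp add: algebra_simps power2_eq_square power3_eq_cube)
  finally show m4: "(\<integral>x. x ^ 4 \<partial>std_poisson l) = 3 + t ^ 2" by (simp add: st)
  have "(x + t) ^ 4 = x ^ 4 + 4 * t * x ^ 3 + 6 * t ^ 2 * x ^ 2 + 4 * t ^ 3 * x + t ^ 4" for x
    by (simp add: eval_nat_numeral algebra_simps)
  then have "(\<integral>x. x ^ 5 \<partial>std_poisson l) = sqrt l * (4 * t * t + 6 * t ^ 2 + t ^ 4)"
    using rec[of 4] by (simp add: m1 m2 m3 m4 u)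
  also have "\<dots> = (sqrt l * t) * (10 * t + t ^ 3)" by (simp add: algebra_simps eval_nat_numeral)
  finally show m5: "(\<integral>x. x ^ 5 \<partial>std_poisson l) = 10 * t + t ^ 3" by (simp add: st)
  have "(x + t) ^ 5 = x ^ 5 + 5 * t * x ^ 4 + 10 * t ^ 2 * x ^ 3 + 10 * t ^ 3 * x ^ 2 + 5 * t ^ 4 * x + t ^ 5" for x
    by (simp add: eval_nat_numeral algebra_simps)
  then have "(\<integral>x. x ^ 6 \<partial>std_poisson l) = sqrt l * (5 * t * (3 + t ^ 2) + 10 * t ^ 2 * t + 10 * t ^ 3 + t ^ 5)"
    using rec[of 5] by (simp add: m1 m2 m3 m4 m5 u)
  also have "\<dots> = (sqrt l * t) * (15 + 25 * t ^ 2 + t ^ 4)" by (simp add: algebra_simps eval_nat_numeral)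
  finally show "(\<integral>x. x ^ 6 \<partial>std_poisson l) = 15 + 25 * t ^ 2 + t ^ 4" by (simp add: st)
qed

subsection \<open>Multilinear forms in independent standardized Poisson variables\<close>

definition mform :: "'i set \<Rightarrow> ('i set \<Rightarrow> real) \<Rightarrow> ('i \<Rightarrow> real) \<Rightarrow> real" where
  "mform V a y = (\<Sum>A\<in>Pow V. a A * (\<Prod>c\<in>A. y c))"

lemma sum_Pow_insert:
  fixes h :: "'i set \<Rightarrow> 'b::comm_monoid_add"
  assumes "finite V" "i \<notin> V"
  shows "(\<Sum>A\<in>Pow (insert i V). h A) = (\<Sum>A\<in>Pow V. h A) + (\<Sum>A\<in>Pow V. h (insert i A))"
proof -
  have "inj_on (insert i) (Pow V)" using assms(2) by (auto simp: inj_on_def)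
  then show ?thesis
    using assms by (subst Pow_insert, subst sum.union_disjoint) (auto simp: sum.reindex)
qed

text \<open>A form is affine in each of its variables; this is the basis of the arguments that treat
  one variable at a time.\<close>

lemma mform_insert:
  assumes "finite V" "i \<notin> V"
  shows "mform (insert i V) a y = mform V a y + y i * mform V (\<lambda>A. a (insert i A)) y"
proof -
  have "(\<Prod>c\<in>insert i A. y c) = y i * (\<Prod>c\<in>A. y c)" if "A \<in> Pow V" for A
    using that assms by (subst prod.insert) (auto intro: finite_subset)
  then show ?thesis
    using assms by (simp add: mform_def sum_Pow_insert sum_distrib_left mult_ac)
qed

lemma mform_cong:
  assumes "\<And>A. A \<subseteq> V \<Longrightarrow> a A = b A" "\<And>c. c \<in> V \<Longrightarrow> y c = z c"
  shows "mform V a y = mform V b z"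
  unfolding mform_def using assms by (intro sum.cong arg_cong2[where f = "(*)"] prod.cong) auto

text \<open>The derivative in the variable \<open>i\<close> does not involve that variable, so it
  stays fixed when the variable is shifted.\<close>

lemma mform_djoin_Diff:
  assumes "finite V" "i \<in> V"
  shows "mform V (djoin a {i}) y = mform (V - {i}) (\<lambda>A. a (insert i A)) y"
proof -
  have "mform V (djoin a {i}) y = mform (insert i (V - {i})) (djoin a {i}) y"
    using assms by (simp add: insert_absorb)
  also have "\<dots> = mform (V - {i}) (djoin a {i}) y + y i * mform (V - {i}) (\<lambda>A. 0) y"
    using assms by (subst mform_insert) (auto simp: djoin_def)
  also have "\<dots> = mform (V - {i}) (\<lambda>A. a (insert i A)) y"
    by (simp add: mform_def djoin_def) (intro sum.cong, auto)
  finally show ?thesis .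
qed

lemma mform_split:
  assumes "finite V" "i \<in> V"
  shows "mform V a y = mform (V - {i}) a y + y i * mform V (djoin a {i}) y"
  using mform_insert[of "V - {i}" i a y] assms by (simp add: mform_djoin_Diff insert_absorb)

text \<open>Euler's identity for homogeneous polynomials: a monomial of degree \<open>p\<close> is
  recovered once for each of its \<open>p\<close> variables.\<close>

lemma sum_mult_mform_djoin:
  assumes V: "finite V" and a: "\<And>A. a A \<noteq> 0 \<Longrightarrow> card A = p"
  shows "(\<Sum>i\<in>V. y i * mform V (djoin a {i}) y) = p * mform V a y"
proof -
  have "(\<Sum>i\<in>V. y i * mform V (djoin a {i}) y) = (\<Sum>i\<in>V. mform V a y - mform (V - {i}) a y)"
    using mform_split[OF V, of _ a y] by (intro sum.cong refl) (auto simp: algebra_simps)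
  also have "\<dots> = (\<Sum>i\<in>V. \<Sum>A\<in>Pow V. if i \<in> A then a A * (\<Prod>c\<in>A. y c) else 0)"
  proof (intro sum.cong refl)
    fix i assume "i \<in> V"
    have "mform (V - {i}) a y = (\<Sum>A\<in>Pow V. if i \<notin> A then a A * (\<Prod>c\<in>A. y c) else 0)"
      unfolding mform_def using V by (intro sum.mono_neutral_cong_left) auto
    then show "mform V a y - mform (V - {i}) a y = (\<Sum>A\<in>Pow V. if i \<in> A then a A * (\<Prod>c\<in>A. y c) else 0)"
      by (simp add: mform_def sum_subtractf[symmetric] if_distrib cong: if_cong) (intro sum.cong, auto)
  qed
  also have "\<dots> = (\<Sum>A\<in>Pow V. \<Sum>i\<in>V. if i \<in> A then a A * (\<Prod>c\<in>A. y c) else 0)" by (rule sum.swap)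
  also have "\<dots> = (\<Sum>A\<in>Pow V. p * (a A * (\<Prod>c\<in>A. y c)))"
  proof (intro sum.cong refl)
    fix A assume "A \<in> Pow V"
    then have "(\<Sum>i\<in>V. if i \<in> A then a A * (\<Prod>c\<in>A. y c) else 0) = real (card A) * (a A * (\<Prod>c\<in>A. y c))"
      using V by (simp add: sum.If_cases Int_absorb1)
    then show "(\<Sum>i\<in>V. if i \<in> A then a A * (\<Prod>c\<in>A. y c) else 0) = p * (a A * (\<Prod>c\<in>A. y c))"
      using a[of A] by (cases "a A = 0") auto
  qed
  also have "\<dots> = p * mform V a y" unfolding mform_def by (rule sum_distrib_left[symmetric])
  finally show ?thesis .
qed

lemma borel_measurable_mform [measurable]:
  assumes "\<And>c. c \<in> V \<Longrightarrow> (\<lambda>x. f x c) \<in> borel_measurable M"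
  shows "(\<lambda>x. mform V a (f x)) \<in> borel_measurable M"
  unfolding mform_def using assms by (intro borel_measurable_sum borel_measurable_times borel_measurable_const borel_measurable_prod) auto

text \<open>The exponent of the variable \<open>c\<close> in the product of the monomials of
  \<open>A\<close> and \<open>B\<close>. As a function of \<open>c\<close> it records exactly the
  union and the intersection of the pair, which is why sums over pairs with equal union and
  intersection appear in moments.\<close>

definition pair_deg :: "'i set \<Rightarrow> 'i set \<Rightarrow> 'i \<Rightarrow> nat" where
  "pair_deg A B c = of_bool (c \<in> A) + of_bool (c \<in> B)"

lemma prod_eq_prod_power_of_bool:
  fixes y :: "'i \<Rightarrow> real"
  assumes "finite V" "A \<subseteq> V" shows "(\<Prod>c\<in>A. y c) = (\<Prod>c\<in>V. y c ^ of_bool (c \<in> A))"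
  using assms by (intro prod.mono_neutral_cong_left) auto

lemma prod_mult_prod_eq:
  fixes y :: "'i \<Rightarrow> real"
  assumes "finite V" "A \<subseteq> V" "B \<subseteq> V"
  shows "(\<Prod>c\<in>A. y c) * (\<Prod>c\<in>B. y c) = (\<Prod>c\<in>V. y c ^ pair_deg A B c)"
  unfolding prod_eq_prod_power_of_bool[OF assms(1,2), of y] prod_eq_prod_power_of_bool[OF assms(1,3), of y]
  by (simp add: prod.distrib power_add pair_deg_def)

lemma mform_mult:
  assumes "finite V"
  shows "mform V a y * mform V b y = (\<Sum>A\<in>Pow V. \<Sum>B\<in>Pow V. a A * b B * (\<Prod>c\<in>V. y c ^ pair_deg A B c))"
  unfolding mform_def sum_product
proof (intro sum.cong refl)
  fix A B assume "A \<in> Pow V" "B \<in> Pow V"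
  then show "a A * (\<Prod>c\<in>A. y c) * (b B * (\<Prod>c\<in>B. y c)) = a A * b B * (\<Prod>c\<in>V. y c ^ pair_deg A B c)"
    using prod_mult_prod_eq[OF assms, of A B y] by (simp add: mult_ac)
qed

lemma pair_deg_eq_iff:
  assumes "A \<subseteq> V" "B \<subseteq> V" "A' \<subseteq> V" "B' \<subseteq> V"
  shows "(\<forall>c\<in>V. pair_deg A B c = pair_deg A' B' c) \<longleftrightarrow> A \<inter> B = A' \<inter> B' \<and> A \<union> B = A' \<union> B'"
proof
  assume *: "\<forall>c\<in>V. pair_deg A B c = pair_deg A' B' c"
  have "(c \<in> A \<and> c \<in> B \<longleftrightarrow> c \<in> A' \<and> c \<in> B') \<and> (c \<in> A \<or> c \<in> B \<longleftrightarrow> c \<in> A' \<or> c \<in> B')" if "c \<in> V" for c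
    using bspec[OF * that]
    by (cases "c \<in> A"; cases "c \<in> B"; cases "c \<in> A'"; cases "c \<in> B'") (simp_all add: pair_deg_def)
  then show "A \<inter> B = A' \<inter> B' \<and> A \<union> B = A' \<union> B'" using assms by blast
next
  assume *: "A \<inter> B = A' \<inter> B' \<and> A \<union> B = A' \<union> B'"
  have "(c \<in> A \<and> c \<in> B \<longleftrightarrow> c \<in> A' \<and> c \<in> B') \<and> (c \<in> A \<or> c \<in> B \<longleftrightarrow> c \<in> A' \<or> c \<in> B')" for c
    using * by blast
  then show "\<forall>c\<in>V. pair_deg A B c = pair_deg A' B' c" by (auto simp: pair_deg_def)
qed

lemma sum_pair_deg:
  assumes "finite V" "A \<subseteq> V" "B \<subseteq> V"
  shows "(\<Sum>c\<in>V. pair_deg A B c) = card A + card B"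
  using assms by (simp add: pair_deg_def sum.distrib of_bool_def sum.If_cases Int_absorb1)

lemma prod_fact_pair_deg:
  assumes "finite V" "A \<subseteq> V" "B \<subseteq> V"
  shows "(\<Prod>c\<in>V. fact (pair_deg A B c)) = (2 ^ card (A \<inter> B) :: real)"
proof -
  have "(\<Prod>c\<in>V. fact (pair_deg A B c)) = (\<Prod>c\<in>A \<inter> B. 2 :: real)"
    using assms by (intro prod.mono_neutral_cong_right) (auto simp: pair_deg_def)
  then show ?thesis by simp
qed

text \<open>The quadratic polynomial in \<open>t\<close> given by the expectation of
  \<open>(f - t g)^2\<close> is nonnegative; its minimum yields Cauchy-Schwarz.\<close>

lemma (in prob_space) expectation_square_mult_le:
  assumes f: "all_moments M f" and g: "all_moments M g"
  shows "(expectation (\<lambda>x. f x * g x))\<^sup>2 \<le> expectation (\<lambda>x. (f x)\<^sup>2) * expectation (\<lambda>x. (g x)\<^sup>2)"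
proof -
  let ?a = "expectation (\<lambda>x. (f x)\<^sup>2)" and ?b = "expectation (\<lambda>x. (g x)\<^sup>2)" and ?c = "expectation (\<lambda>x. f x * g x)"
  have [simp]: "integrable M (\<lambda>x. (f x)\<^sup>2)" "integrable M (\<lambda>x. (g x)\<^sup>2)" "integrable M (\<lambda>x. f x * g x)"
    using f g by (auto intro!: all_moments_integrable all_moments_intros)
  have q: "0 \<le> ?a - 2 * t * ?c + t\<^sup>2 * ?b" for t
  proof -
    have "0 \<le> expectation (\<lambda>x. (f x - t * g x)\<^sup>2)" by simp
    also have "(\<lambda>x. (f x - t * g x)\<^sup>2) = (\<lambda>x. (f x)\<^sup>2 - 2 * t * (f x * g x) + t\<^sup>2 * (g x)\<^sup>2)"
      by (simp add: power2_eq_square algebra_simps)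
    also have "expectation \<dots> = ?a - 2 * t * ?c + t\<^sup>2 * ?b" by simp
    finally show ?thesis .
  qed
  show ?thesis
  proof (cases "?b = 0")
    case True
    have "?c = 0"
    proof (rule ccontr)
      assume "?c \<noteq> 0"
      \<comment> \<open>With \<open>?b = 0\<close> the polynomial is affine, and at this
        \<open>t\<close> its value is -1.\<close>
      then show False using q[of "(?a + 1) / (2 * ?c)"] True by simp
    qed
    then show ?thesis using True by simp
  next
    case False
    then have b: "0 < ?b" by (simp add: less_le)
    have "?a - 2 * (?c / ?b) * ?c + (?c / ?b)\<^sup>2 * ?b = ?a - ?c\<^sup>2 / ?b"
      using b by (simp add: power2_eq_square field_simps)
    then have "?c\<^sup>2 / ?b \<le> ?a" using q[of "?c / ?b"] by simp
    then show ?thesis using b by (simp add: field_simps)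
  qed
qed

text \<open>Jensen's inequality for the cube with weights \<open>u\<close> and \<open>v\<close> at
  the points \<open>x / u\<close> and \<open>y / v\<close>. If \<open>u\<close> and \<open>v\<close>
  bound the \<open>L^3\<close> norms of two functions \<open>x\<close> and \<open>y\<close>,
  integration gives Minkowski's bound \<open>(u + v)^3\<close>.\<close>

lemma cube_add_le:
  fixes x y u v :: real
  assumes "0 \<le> x" "0 \<le> y" "0 < u" "0 < v"
  shows "(x + y) ^ 3 \<le> (u + v)\<^sup>2 * (x ^ 3 / u\<^sup>2 + y ^ 3 / v\<^sup>2)"
proof -
  define p r where "p = x / u" and "r = y / v"
  have xy: "x = u * p" "y = v * r" using assms by (auto simp: p_def r_def)
  have pr: "0 \<le> p" "0 \<le> r" using assms by (auto simp: p_def r_def)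
  \<comment> \<open>The gap in Jensen's inequality factorizes explicitly, with every factor
    nonnegative.\<close>
  have "(u + v)\<^sup>2 * (u * p ^ 3 + v * r ^ 3) - (u * p + v * r) ^ 3
      = u * v * (p - r)\<^sup>2 * ((2 * u + v) * p + (u + 2 * v) * r)"
    by algebra
  also have "\<dots> \<ge> 0" using assms pr by simp
  finally have "(u * p + v * r) ^ 3 \<le> (u + v)\<^sup>2 * (u * p ^ 3 + v * r ^ 3)" by simp
  also have "u * p ^ 3 = x ^ 3 / u\<^sup>2" using assms by (simp add: xy power2_eq_square power3_eq_cube)
  also have "v * r ^ 3 = y ^ 3 / v\<^sup>2" using assms by (simp add: xy power2_eq_square power3_eq_cube)
  finally show ?thesis by (simp add: xy)
qed

section \<open>Independent standardized Poisson variables with intensities bounded below\<close>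

locale poisson_family = prob_space M for M :: "'w measure" +
  fixes X :: "'i \<Rightarrow> 'w \<Rightarrow> real" and lam :: "'i \<Rightarrow> real" and I :: "'i set" and \<alpha> :: real
  assumes indep: "indep_vars (\<lambda>_. borel) X I"
    and law: "\<And>i. i \<in> I \<Longrightarrow> distr M borel (X i) = std_poisson (lam i)"
    and \<alpha>_pos: "0 < \<alpha>" and lam_ge: "\<And>i. i \<in> I \<Longrightarrow> \<alpha> \<le> lam i"
begin

text \<open>The amount by which \<open>X i\<close> moves when the underlying Poisson variable
  increases by one.\<close>

definition \<theta> :: "'i \<Rightarrow> real" where "\<theta> i = 1 / sqrt (lam i)"

lemma lam_pos: "i \<in> I \<Longrightarrow> 0 < lam i"
  using lam_ge[of i] \<alpha>_pos by simp

lemma \<theta>_pos: "i \<in> I \<Longrightarrow> 0 < \<theta> i"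
  using lam_pos by (simp add: \<theta>_def)

lemma \<theta>_square: "i \<in> I \<Longrightarrow> (\<theta> i)\<^sup>2 = 1 / lam i"
  using lam_pos[of i] by (simp add: \<theta>_def power_divide)

lemma \<theta>_square_le: "i \<in> I \<Longrightarrow> (\<theta> i)\<^sup>2 \<le> 1 / \<alpha>"
  using lam_ge[of i] \<alpha>_pos by (simp add: \<theta>_square frac_le)

lemma X_measurable [measurable]: "i \<in> I \<Longrightarrow> X i \<in> borel_measurable M"
  using indep by (auto simp: indep_vars_def)

lemma integral_law:
  fixes h :: "real \<Rightarrow> 'b::{banach, second_countable_topology}"
  assumes "i \<in> I" "h \<in> borel_measurable borel"
  shows "expectation (\<lambda>\<omega>. h (X i \<omega>)) = (\<integral>x. h x \<partial>std_poisson (lam i))"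
  unfolding law[OF assms(1), symmetric] using assms by (subst integral_distr) auto

lemma all_moments_X [all_moments_intros]: "i \<in> I \<Longrightarrow> all_moments M (X i)"
  using all_moments_std_poisson[OF lam_pos, of i] all_moments_distr[of "X i" M] X_measurable[of i]
  by (simp add: law)

lemma all_moments_mform [all_moments_intros]:
  "V \<subseteq> I \<Longrightarrow> all_moments M (\<lambda>\<omega>. mform V a (\<lambda>c. X c \<omega>))"
  unfolding mform_def by (intro all_moments_intros) auto

lemma expectation_prod:
  assumes "finite V" "V \<subseteq> I" and "\<And>i. i \<in> V \<Longrightarrow> h i \<in> borel_measurable borel"
    and "\<And>i. i \<in> V \<Longrightarrow> integrable M (\<lambda>\<omega>. h i (X i \<omega>))"
  shows "expectation (\<lambda>\<omega>. \<Prod>i\<in>V. h i (X i \<omega>)) = (\<Prod>i\<in>V. \<integral>x. h i x \<partial>std_poisson (lam i) :: real)"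
proof -
  have "indep_vars (\<lambda>_. borel) (\<lambda>i x. h i (X i x)) V"
    using assms by (intro indep_vars_compose2[OF indep_vars_subset[OF indep]]) auto
  then have "expectation (\<lambda>\<omega>. \<Prod>i\<in>V. h i (X i \<omega>)) = (\<Prod>i\<in>V. expectation (\<lambda>\<omega>. h i (X i \<omega>)))"
    using assms by (intro indep_vars_lebesgue_integral) auto
  also have "\<dots> = (\<Prod>i\<in>V. \<integral>x. h i x \<partial>std_poisson (lam i))"
    using assms by (intro prod.cong refl integral_law) auto
  finally show ?thesis .
qed

text \<open>Fubini for the joint law of \<open>X i\<close> and the variables in \<open>V\<close>.
  The almost sure integrability of the sections is part of the conclusion, since the one-dimensional
  integration by parts is applied to each section.\<close>

lemma expectation_disintegrate:
  fixes \<Phi> :: "real \<Rightarrow> ('i \<Rightarrow> real) \<Rightarrow> 'b::{banach, second_countable_topology}"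
  assumes i: "i \<in> I" and V: "V \<subseteq> I" "i \<notin> V"
    and \<Phi>: "(\<lambda>(x, y). \<Phi> x y) \<in> borel_measurable (borel \<Otimes>\<^sub>M PiM V (\<lambda>_. borel))"
    and int: "integrable M (\<lambda>\<omega>. \<Phi> (X i \<omega>) (\<lambda>c\<in>V. X c \<omega>))"
  shows "expectation (\<lambda>\<omega>. \<Phi> (X i \<omega>) (\<lambda>c\<in>V. X c \<omega>))
      = expectation (\<lambda>\<omega>. \<integral>x. \<Phi> x (\<lambda>c\<in>V. X c \<omega>) \<partial>std_poisson (lam i))"
    and "integrable M (\<lambda>\<omega>. \<integral>x. \<Phi> x (\<lambda>c\<in>V. X c \<omega>) \<partial>std_poisson (lam i))"
    and "AE \<omega> in M. integrable (std_poisson (lam i)) (\<lambda>x. \<Phi> x (\<lambda>c\<in>V. X c \<omega>))"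
proof -
  let ?Y = "\<lambda>\<omega>. \<lambda>c\<in>V. X c \<omega>" and ?Z = "\<lambda>\<omega>. \<lambda>c\<in>{i}. X c \<omega>"
  let ?N = "PiM V (\<lambda>_. borel :: real measure)" and ?K = "PiM {i} (\<lambda>_. borel :: real measure)"
  let ?P = "std_poisson (lam i)" and ?R = "distr M ?K ?Z" and ?Q = "distr M ?N ?Y"
  have Y [measurable]: "?Y \<in> measurable M ?N"
    using V by (intro measurable_restrict) auto
  have Z [measurable]: "?Z \<in> measurable M ?K"
    using i by (intro measurable_restrict) auto
  note \<Phi> [measurable]
  have comp [measurable]: "(\<lambda>u. u i) \<in> measurable ?K borel" by (rule measurable_component_singleton) simp
  \<comment> \<open>Independence is available for disjoint blocks of coordinates, so
    \<open>X i\<close> enters as a block with one element and is read off as the component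
    \<open>u i\<close>.\<close>
  have pair: "?R \<Otimes>\<^sub>M ?Q = distr M (?K \<Otimes>\<^sub>M ?N) (\<lambda>\<omega>. (?Z \<omega>, ?Y \<omega>))"
    using indep_var_restrict[OF indep, of "{i}" V] i V by (simp add: indep_var_distribution_eq)
  interpret R: prob_space ?R by (rule prob_space_distr) simp
  interpret Q: prob_space ?Q by (rule prob_space_distr) simp
  interpret RQ: pair_prob_space ?R ?Q ..
  have \<Phi>y: "(\<lambda>x. \<Phi> x y) \<in> borel_measurable borel" if "y \<in> space ?N" for y
    using measurable_compose[OF measurable_Pair2'[OF that] \<Phi>] by simp
  have P: "?P = distr ?R borel (\<lambda>u. u i)"
    unfolding law[OF i, symmetric] by (subst distr_distr) (auto simp: comp_def)
  have inner: "(\<integral>x. \<Phi> x y \<partial>?P) = (\<integral>u. \<Phi> (u i) y \<partial>?R)"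
    "integrable ?P (\<lambda>x. \<Phi> x y) \<longleftrightarrow> integrable ?R (\<lambda>u. \<Phi> (u i) y)" if "y \<in> space ?N" for y
    unfolding P using \<Phi>y[OF that] by (subst integral_distr integrable_distr_eq; simp)+
  have Ysp: "?Y \<omega> \<in> space ?N" for \<omega> by (simp add: space_PiM)
  have meas\<Phi> [measurable]: "(\<lambda>(u, y). \<Phi> (u i) y) \<in> borel_measurable (?K \<Otimes>\<^sub>M ?N)"
    by measurable
  have int': "integrable (?R \<Otimes>\<^sub>M ?Q) (\<lambda>(u, y). \<Phi> (u i) y)"
    unfolding pair using int by (subst integrable_distr_eq) auto
  have meas: "(\<lambda>y. \<integral>u. \<Phi> (u i) y \<partial>?R) \<in> borel_measurable ?N"
  proof (rule R.borel_measurable_lebesgue_integral)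
    show "(\<lambda>(y, u). \<Phi> (u i) y) \<in> borel_measurable (?N \<Otimes>\<^sub>M ?R)"
      by (subst measurable_cong_sets[OF sets_pair_measure_cong[OF refl sets_distr] refl]) measurable
  qed
  have "expectation (\<lambda>\<omega>. \<Phi> (X i \<omega>) (?Y \<omega>)) = (\<integral>p. (\<lambda>(u, y). \<Phi> (u i) y) p \<partial>(?R \<Otimes>\<^sub>M ?Q))"
    unfolding pair by (subst integral_distr) auto
  also have "\<dots> = (\<integral>y. \<integral>u. \<Phi> (u i) y \<partial>?R \<partial>?Q)"
    using RQ.integral_snd[OF int'] by simp
  also have "\<dots> = expectation (\<lambda>\<omega>. \<integral>u. \<Phi> (u i) (?Y \<omega>) \<partial>?R)"
    using meas by (subst integral_distr) auto
  finally show "expectation (\<lambda>\<omega>. \<Phi> (X i \<omega>) (?Y \<omega>)) = expectation (\<lambda>\<omega>. \<integral>x. \<Phi> x (?Y \<omega>) \<partial>?P)"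
    by (simp only: inner[OF Ysp])
  have "integrable M (\<lambda>\<omega>. \<integral>u. \<Phi> (u i) (?Y \<omega>) \<partial>?R)"
    using RQ.integrable_snd[OF int'] meas by (subst (asm) integrable_distr_eq) auto
  then show "integrable M (\<lambda>\<omega>. \<integral>x. \<Phi> x (?Y \<omega>) \<partial>?P)"
    by (simp only: inner[OF Ysp])
  have "AE \<omega> in M. integrable ?R (\<lambda>u. \<Phi> (u i) (?Y \<omega>))"
    using AE_distrD[OF Y RQ.AE_integrable_snd[OF int']] .
  then show "AE \<omega> in M. integrable ?P (\<lambda>x. \<Phi> x (?Y \<omega>))"
    by (simp only: inner[OF Ysp])
qed

text \<open>Integration by parts in one coordinate while the others are frozen. Sections need be
  integrable only almost surely, hence the comparison of the two sides almost everywhere.\<close>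

lemma stein_identity:
  fixes \<Phi> :: "real \<Rightarrow> ('i \<Rightarrow> real) \<Rightarrow> 'b::{banach, second_countable_topology}"
  assumes i: "i \<in> I" and V: "V \<subseteq> I" "i \<notin> V"
    and \<Phi> [measurable]: "(\<lambda>(x, y). \<Phi> x y) \<in> borel_measurable (borel \<Otimes>\<^sub>M PiM V (\<lambda>_. borel))"
    and int1: "integrable M (\<lambda>\<omega>. X i \<omega> *\<^sub>R \<Phi> (X i \<omega>) (\<lambda>c\<in>V. X c \<omega>))"
    and int2: "integrable M (\<lambda>\<omega>. \<Phi> (X i \<omega>) (\<lambda>c\<in>V. X c \<omega>))"
    and int3: "integrable M (\<lambda>\<omega>. \<Phi> (X i \<omega> + \<theta> i) (\<lambda>c\<in>V. X c \<omega>))"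
  shows "expectation (\<lambda>\<omega>. X i \<omega> *\<^sub>R \<Phi> (X i \<omega>) (\<lambda>c\<in>V. X c \<omega>)) =
    sqrt (lam i) *\<^sub>R (expectation (\<lambda>\<omega>. \<Phi> (X i \<omega> + \<theta> i) (\<lambda>c\<in>V. X c \<omega>)) - expectation (\<lambda>\<omega>. \<Phi> (X i \<omega>) (\<lambda>c\<in>V. X c \<omega>)))"
proof -
  let ?Y = "\<lambda>\<omega>. \<lambda>c\<in>V. X c \<omega>" and ?P = "std_poisson (lam i)"
  have [measurable]: "(\<lambda>x. \<Phi> x y) \<in> borel_measurable borel" if "y \<in> space (PiM V (\<lambda>_. borel))" for y
    using measurable_compose[OF measurable_Pair2'[OF that] \<Phi>] by simp
  have m1: "(\<lambda>(x, y). x *\<^sub>R \<Phi> x y) \<in> borel_measurable (borel \<Otimes>\<^sub>M PiM V (\<lambda>_. borel))"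
    by measurable
  have m3: "(\<lambda>(x, y). \<Phi> (x + \<theta> i) y) \<in> borel_measurable (borel \<Otimes>\<^sub>M PiM V (\<lambda>_. borel))"
    by measurable
  note d1 = expectation_disintegrate[OF i V m1 int1]
  note d2 = expectation_disintegrate[OF i V \<Phi> int2]
  note d3 = expectation_disintegrate[OF i V m3 int3]
  have m1': "(\<lambda>\<omega>. \<integral>x. x *\<^sub>R \<Phi> x (?Y \<omega>) \<partial>?P) \<in> borel_measurable M"
    and m2': "(\<lambda>\<omega>. sqrt (lam i) *\<^sub>R ((\<integral>x. \<Phi> (x + \<theta> i) (?Y \<omega>) \<partial>?P) - (\<integral>x. \<Phi> x (?Y \<omega>) \<partial>?P))) \<in> borel_measurable M"
    by (intro borel_measurable_integrable d1(2) integrable_scaleR_right Bochner_Integration.integrable_diff d2(2) d3(2))+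
  have "expectation (\<lambda>\<omega>. X i \<omega> *\<^sub>R \<Phi> (X i \<omega>) (?Y \<omega>)) = expectation (\<lambda>\<omega>. \<integral>x. x *\<^sub>R \<Phi> x (?Y \<omega>) \<partial>?P)"
    by (rule d1(1))
  also have "\<dots> = expectation (\<lambda>\<omega>. sqrt (lam i) *\<^sub>R ((\<integral>x. \<Phi> (x + \<theta> i) (?Y \<omega>) \<partial>?P) - (\<integral>x. \<Phi> x (?Y \<omega>) \<partial>?P)))"
  proof (rule integral_cong_AE[OF m1' m2'])
    show "AE \<omega> in M. (\<integral>x. x *\<^sub>R \<Phi> x (?Y \<omega>) \<partial>?P) = sqrt (lam i) *\<^sub>R ((\<integral>x. \<Phi> (x + \<theta> i) (?Y \<omega>) \<partial>?P) - (\<integral>x. \<Phi> x (?Y \<omega>) \<partial>?P))"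
      using d1(3) d2(3)
    proof eventually_elim
      case (elim \<omega>)
      have "(\<lambda>x. \<Phi> x (?Y \<omega>)) \<in> borel_measurable borel"
        by measurable (simp add: space_PiM)
      then show ?case
        using std_poisson_stein[OF lam_pos[OF i] _ elim] unfolding \<theta>_def by blast
    qed
  qed
  also have "\<dots> = sqrt (lam i) *\<^sub>R (expectation (\<lambda>\<omega>. \<integral>x. \<Phi> (x + \<theta> i) (?Y \<omega>) \<partial>?P) - expectation (\<lambda>\<omega>. \<integral>x. \<Phi> x (?Y \<omega>) \<partial>?P))"
    by (simp only: integral_scaleR_right Bochner_Integration.integral_diff[OF d3(2) d2(2)])
  finally show ?thesis unfolding d2(1) d3(1) .
qed

text \<open>Monomials over different sets are orthonormal: a variable contained in only one of the
  two sets contributes its mean zero, a common one its variance one.\<close>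

lemma expectation_mform_mult:
  assumes V: "finite V" "V \<subseteq> I"
  shows "expectation (\<lambda>\<omega>. mform V a (\<lambda>c. X c \<omega>) * mform V b (\<lambda>c. X c \<omega>)) = (\<Sum>A\<in>Pow V. a A * b A)"
proof -
  have am: "all_moments M (\<lambda>\<omega>. \<Prod>c\<in>V. X c \<omega> ^ pair_deg A B c)" for A B
    using V by (intro all_moments_intros) auto
  have E: "expectation (\<lambda>\<omega>. \<Prod>c\<in>V. X c \<omega> ^ pair_deg A B c) = of_bool (A = B)" if "A \<subseteq> V" "B \<subseteq> V" for A B
  proof -
    have "expectation (\<lambda>\<omega>. \<Prod>c\<in>V. X c \<omega> ^ pair_deg A B c) = (\<Prod>c\<in>V. \<integral>x. x ^ pair_deg A B c \<partial>std_poisson (lam c))"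
      using V by (intro expectation_prod all_moments_integrable all_moments_intros) auto
    also have "\<dots> = (\<Prod>c\<in>V. of_bool (c \<in> A \<longleftrightarrow> c \<in> B))"
    proof (intro prod.cong refl)
      fix c assume "c \<in> V"
      then have l: "0 < lam c" using V lam_pos by auto
      interpret P: prob_space "std_poisson (lam c)" by (rule prob_space_std_poisson)
      show "(\<integral>x. x ^ pair_deg A B c \<partial>std_poisson (lam c)) = of_bool (c \<in> A \<longleftrightarrow> c \<in> B)"
        using std_poisson_moments(1,2)[OF l] P.prob_space
        by (cases "c \<in> A"; cases "c \<in> B") (simp_all add: pair_deg_def numeral_2_eq_2)
    qed
    also have "\<dots> = of_bool (A = B)"
    proof (cases "A = B")
      case False
      then obtain c where "c \<in> V" "(c \<in> A) \<noteq> (c \<in> B)"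
        using \<open>A \<subseteq> V\<close> \<open>B \<subseteq> V\<close> by blast
      then show ?thesis using V False by (intro trans[OF prod_zero]) auto
    qed simp
    finally show ?thesis .
  qed
  have "expectation (\<lambda>\<omega>. mform V a (\<lambda>c. X c \<omega>) * mform V b (\<lambda>c. X c \<omega>))
    = (\<Sum>A\<in>Pow V. \<Sum>B\<in>Pow V. a A * b B * of_bool (A = B))"
    unfolding mform_mult[OF V(1)] using all_moments_integrable[OF am] E by simp
  also have "\<dots> = (\<Sum>A\<in>Pow V. a A * b A)"
    using V by (intro sum.cong refl) (simp add: of_bool_def if_distrib cong: if_cong)
  finally show ?thesis .
qed

lemma expectation_mform_square:
  assumes "finite V" "V \<subseteq> I"
  shows "expectation (\<lambda>\<omega>. (mform V a (\<lambda>c. X c \<omega>))\<^sup>2) = (\<Sum>A\<in>Pow V. (a A)\<^sup>2)"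
  using expectation_mform_mult[OF assms, of a a] by (simp add: power2_eq_square)

end

subsection \<open>Hypercontractivity\<close>

context poisson_family
begin

text \<open>The constant \<kappa> in the one-variable inequality that bounds the sixth moment of
  \<open>h + x g\<close> by \<open>(h^2 + \<kappa> g^2)^3\<close>. For jump size \<open>t\<close>
  the choice \<open>9 + 3 t^2\<close> works, and \<open>t^2 \<le> 1 / \<alpha>\<close> makes it
  uniform.\<close>

definition hyp :: real where "hyp = 9 + 3 / \<alpha>"

lemma hyp_ge_1: "1 \<le> hyp"
  using \<alpha>_pos by (simp add: hyp_def)

lemma std_poisson_sixth_moment_le:
  assumes i: "i \<in> I"
  shows "(\<integral>x. (h + x * g) ^ 6 \<partial>std_poisson (lam i)) \<le> (h\<^sup>2 + hyp * g\<^sup>2) ^ 3"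
proof -
  define t where "t = \<theta> i"
  note l = lam_pos[OF i]
  interpret P: prob_space "std_poisson (lam i)" by (rule prob_space_std_poisson)
  have int [simp]: "integrable (std_poisson (lam i)) (\<lambda>x. x ^ k)" for k
    by (rule all_moments_integrable[OF P.all_moments_power[OF all_moments_std_poisson[OF l]]])
  have int1 [simp]: "integrable (std_poisson (lam i)) (\<lambda>x. x)" using int[of 1] by simp
  note m = std_poisson_moments[OF l, folded \<theta>_def, folded t_def]
  have u: "measure (std_poisson (lam i)) UNIV = 1" using P.prob_space by simp
  have e: "(h + x * g) ^ 6 = h ^ 6 + 6 * h ^ 5 * g * x + 15 * h ^ 4 * g ^ 2 * x ^ 2 + 20 * h ^ 3 * g ^ 3 * x ^ 3
     + 15 * h ^ 2 * g ^ 4 * x ^ 4 + 6 * h * g ^ 5 * x ^ 5 + g ^ 6 * x ^ 6" for x by algebra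
  have "(\<integral>x. (h + x * g) ^ 6 \<partial>std_poisson (lam i)) = h ^ 6 + 15 * h ^ 4 * g ^ 2 + 20 * h ^ 3 * g ^ 3 * t
     + 15 * h ^ 2 * g ^ 4 * (3 + t\<^sup>2) + 6 * h * g ^ 5 * (10 * t + t ^ 3) + g ^ 6 * (15 + 25 * t\<^sup>2 + t ^ 4)"
    unfolding e by (simp add: m u)
  also have "\<dots> \<le> (h\<^sup>2 + (9 + 3 * t\<^sup>2) * g\<^sup>2) ^ 3"
  proof -
    \<comment> \<open>The terms \<open>h^3 g^3\<close> and \<open>h g^5\<close>, whose sign is not
      determined, are completed to multiples of \<open>(h - g t)^2\<close>; the remaining
      coefficients are nonnegative.\<close>
    have "(h\<^sup>2 + (9 + 3 * t\<^sup>2) * g\<^sup>2) ^ 3 - (h ^ 6 + 15 * h ^ 4 * g ^ 2 + 20 * h ^ 3 * g ^ 3 * t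
     + 15 * h ^ 2 * g ^ 4 * (3 + t\<^sup>2) + 6 * h * g ^ 5 * (10 * t + t ^ 3) + g ^ 6 * (15 + 25 * t\<^sup>2 + t ^ 4))
     = 10 * (h * g)\<^sup>2 * (h - g * t)\<^sup>2 + (30 + 3 * t\<^sup>2) * g ^ 4 * (h - g * t)\<^sup>2
      + (2 + 9 * t\<^sup>2) * h ^ 4 * g\<^sup>2 + (168 + 134 * t\<^sup>2 + 27 * t ^ 4) * h\<^sup>2 * g ^ 4
      + (714 + 674 * t\<^sup>2 + 239 * t ^ 4 + 27 * t ^ 6) * g ^ 6"
      by algebra
    also have "\<dots> \<ge> 0" by (intro add_nonneg_nonneg mult_nonneg_nonneg) auto
    finally show ?thesis by simp
  qed
  also have "\<dots> \<le> (h\<^sup>2 + hyp * g\<^sup>2) ^ 3"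
  proof (intro power_mono add_left_mono mult_right_mono)
    show "9 + 3 * t\<^sup>2 \<le> hyp" using \<theta>_square_le[OF i] by (simp add: hyp_def t_def)
  qed auto
  finally show ?thesis .
qed

text \<open>Tensorization: one variable is integrated out by the one-variable inequality, and
  Minkowski's inequality in \<open>L^3\<close> for the squares \<open>H^2\<close> and
  \<open>hyp * G^2\<close> combines the two induction hypotheses. Each variable of a monomial costs
  one factor \<open>hyp\<close>.\<close>

lemma sixth_moment_le:
  assumes "finite V" "V \<subseteq> I"
  shows "expectation (\<lambda>\<omega>. mform V a (\<lambda>c. X c \<omega>) ^ 6) \<le> (\<Sum>A\<in>Pow V. hyp ^ card A * (a A)\<^sup>2) ^ 3"
  using assms
proof (induction V arbitrary: a rule: finite_induct)
  case empty
  then show ?case by (simp add: mform_def prob_space)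
next
  case (insert i V)
  define S where "S b = (\<Sum>A\<in>Pow V. hyp ^ card A * (b A)\<^sup>2)" for b
  define b where "b A = a (insert i A)" for A
  define H where "H \<omega> = mform V a (\<lambda>c. X c \<omega>)" for \<omega>
  define G where "G \<omega> = mform V b (\<lambda>c. X c \<omega>)" for \<omega>
  have V: "V \<subseteq> I" "i \<in> I" using insert by auto
  have am [all_moments_intros]: "all_moments M H" "all_moments M G" "all_moments M (X i)"
    unfolding H_def G_def using V by (intro all_moments_intros; simp)+
  have hyp0: "0 \<le> hyp" using hyp_ge_1 by simp
  have S0: "0 \<le> S c" for c unfolding S_def using hyp0 by (intro sum_nonneg) auto
  have SZ: "mform V c y = 0" if "S c = 0" for c y
  proof -
    have "c A = 0" if "A \<in> Pow V" for A
    proof -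
      have "hyp ^ card A * (c A)\<^sup>2 = 0"
        using \<open>S c = 0\<close> that insert(1) hyp0 unfolding S_def by (subst (asm) sum_nonneg_eq_0_iff) auto
      then show ?thesis using hyp_ge_1 by auto
    qed
    then show ?thesis by (simp add: mform_def)
  qed
  have S_insert: "(\<Sum>A\<in>Pow (insert i V). hyp ^ card A * (a A)\<^sup>2) = S a + hyp * S b"
  proof -
    have "(\<Sum>A\<in>Pow V. hyp ^ card (insert i A) * (b A)\<^sup>2) = hyp * S b"
      unfolding S_def sum_distrib_left
      using insert(1,2) by (intro sum.cong refl, subst card_insert_disjoint) (auto intro: finite_subset)
    then show ?thesis using insert(1,2) by (simp add: sum_Pow_insert S_def b_def)
  qed
  have IH: "expectation (\<lambda>\<omega>. H \<omega> ^ 6) \<le> S a ^ 3" "expectation (\<lambda>\<omega>. G \<omega> ^ 6) \<le> S b ^ 3"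
    unfolding H_def G_def S_def using insert(3) V by auto
  let ?\<Phi> = "\<lambda>x y. (mform V a y + x * mform V b y) ^ 6"
  have res: "mform V c (\<lambda>c\<in>V. X c \<omega>) = mform V c (\<lambda>c. X c \<omega>)" for c \<omega>
    by (intro mform_cong) auto
  have meas: "(\<lambda>(x, y). ?\<Phi> x y) \<in> borel_measurable (borel \<Otimes>\<^sub>M PiM V (\<lambda>_. borel))"
    unfolding case_prod_unfold by (intro borel_measurable_power borel_measurable_add borel_measurable_times borel_measurable_mform) auto
  have int: "integrable M (\<lambda>\<omega>. ?\<Phi> (X i \<omega>) (\<lambda>c\<in>V. X c \<omega>))"
    unfolding res H_def[symmetric] G_def[symmetric] by (intro all_moments_integrable all_moments_intros)
  have "expectation (\<lambda>\<omega>. mform (insert i V) a (\<lambda>c. X c \<omega>) ^ 6) = expectation (\<lambda>\<omega>. ?\<Phi> (X i \<omega>) (\<lambda>c\<in>V. X c \<omega>))"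
    using insert(1,2) by (simp add: mform_insert res b_def[abs_def])
  also have "\<dots> = expectation (\<lambda>\<omega>. \<integral>x. (H \<omega> + x * G \<omega>) ^ 6 \<partial>std_poisson (lam i))"
    by (subst expectation_disintegrate(1)[OF V(2,1) insert(2) meas int]) (simp add: res H_def G_def)
  also have "\<dots> \<le> expectation (\<lambda>\<omega>. ((H \<omega>)\<^sup>2 + hyp * (G \<omega>)\<^sup>2) ^ 3)"
  proof (rule integral_mono)
    show "integrable M (\<lambda>\<omega>. \<integral>x. (H \<omega> + x * G \<omega>) ^ 6 \<partial>std_poisson (lam i))"
      using expectation_disintegrate(2)[OF V(2,1) insert(2) meas int] unfolding res H_def G_def .
    show "integrable M (\<lambda>\<omega>. ((H \<omega>)\<^sup>2 + hyp * (G \<omega>)\<^sup>2) ^ 3)"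
      by (intro all_moments_integrable all_moments_intros)
  qed (rule std_poisson_sixth_moment_le[OF V(2)])
  also have "\<dots> \<le> (S a + hyp * S b) ^ 3"
  proof -
    \<comment> \<open>The weights of the Jensen inequality must be positive; a zero weight means
      that the corresponding form vanishes identically.\<close>
    consider "S a = 0" | "S b = 0" | "0 < S a" "0 < S b" using S0[of a] S0[of b] by linarith
    then show ?thesis
    proof cases
      case 1
      then have "H \<omega> = 0" for \<omega> by (simp add: H_def SZ)
      then show ?thesis
        using IH(2) hyp0 1 by (simp add: power_mult_distrib power_mult[symmetric] mult_left_mono)
    next
      case 2
      then have "G \<omega> = 0" for \<omega> by (simp add: G_def SZ)
      then show ?thesis using IH(1) 2 by (simp add: power_mult[symmetric])
    next
      case 3
      \<comment> \<open>The weights are the bounds that the induction hypothesis gives for the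
        \<open>L^3\<close> norms of the two squares.\<close>
      let ?u = "S a" and ?v = "hyp * S b"
      have uv: "0 < ?u" "0 < ?v" using 3 hyp_ge_1 by auto
      have "expectation (\<lambda>\<omega>. ((H \<omega>)\<^sup>2 + hyp * (G \<omega>)\<^sup>2) ^ 3)
        \<le> expectation (\<lambda>\<omega>. (?u + ?v)\<^sup>2 * (H \<omega> ^ 6 / ?u\<^sup>2 + hyp ^ 3 * G \<omega> ^ 6 / ?v\<^sup>2))"
      proof (rule integral_mono)
        show "((H \<omega>)\<^sup>2 + hyp * (G \<omega>)\<^sup>2) ^ 3 \<le> (?u + ?v)\<^sup>2 * (H \<omega> ^ 6 / ?u\<^sup>2 + hyp ^ 3 * G \<omega> ^ 6 / ?v\<^sup>2)" for \<omega>
          using cube_add_le[of "(H \<omega>)\<^sup>2" "hyp * (G \<omega>)\<^sup>2", OF _ _ uv] hyp0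
          by (simp add: power_mult_distrib power_mult[symmetric])
      qed (intro all_moments_integrable all_moments_intros)+
      also have "\<dots> = (?u + ?v)\<^sup>2 * (expectation (\<lambda>\<omega>. H \<omega> ^ 6) / ?u\<^sup>2 + hyp ^ 3 * expectation (\<lambda>\<omega>. G \<omega> ^ 6) / ?v\<^sup>2)"
      proof -
        have "integrable M (\<lambda>\<omega>. H \<omega> ^ 6)" "integrable M (\<lambda>\<omega>. G \<omega> ^ 6)"
          by (intro all_moments_integrable all_moments_intros)+
        then show ?thesis by simp
      qed
      also have "\<dots> \<le> (?u + ?v)\<^sup>2 * (?u ^ 3 / ?u\<^sup>2 + hyp ^ 3 * S b ^ 3 / ?v\<^sup>2)"
        using IH hyp0 by (intro mult_left_mono add_mono divide_right_mono) auto
      also have "\<dots> = (?u + ?v) ^ 3"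
        using uv by (simp add: power2_eq_square power3_eq_cube power_mult_distrib field_simps)
      finally show ?thesis .
    qed
  qed
  finally show ?case unfolding S_insert .
qed

lemma sixth_moment_le_homogeneous:
  assumes "finite V" "V \<subseteq> I" and a: "\<And>A. a A \<noteq> 0 \<Longrightarrow> card A \<le> p"
  shows "expectation (\<lambda>\<omega>. mform V a (\<lambda>c. X c \<omega>) ^ 6) \<le> (hyp ^ p * (\<Sum>A\<in>Pow V. (a A)\<^sup>2)) ^ 3"
proof -
  have "(\<Sum>A\<in>Pow V. hyp ^ card A * (a A)\<^sup>2) \<le> hyp ^ p * (\<Sum>A\<in>Pow V. (a A)\<^sup>2)"
    unfolding sum_distrib_left
  proof (rule sum_mono)
    fix A
    show "hyp ^ card A * (a A)\<^sup>2 \<le> hyp ^ p * (a A)\<^sup>2"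
      using a[of A] hyp_ge_1 by (cases "a A = 0") (auto intro!: mult_right_mono power_increasing)
  qed
  moreover have "0 \<le> (\<Sum>A\<in>Pow V. hyp ^ card A * (a A)\<^sup>2)"
    using hyp_ge_1 by (intro sum_nonneg) auto
  ultimately show ?thesis
    using sixth_moment_le[OF assms(1,2), of a] by (meson order_trans power_mono)
qed

text \<open>Interpolation between second and sixth moment, by Cauchy-Schwarz applied to
  \<open>F ^ 4 = F ^ 3 * F\<close>.\<close>

lemma fourth_moment_le:
  assumes V: "finite V" "V \<subseteq> I" and a: "\<And>A. a A \<noteq> 0 \<Longrightarrow> card A \<le> p"
  shows "expectation (\<lambda>\<omega>. mform V a (\<lambda>c. X c \<omega>) ^ 4) \<le> sqrt (hyp ^ (3 * p)) * (\<Sum>A\<in>Pow V. (a A)\<^sup>2)\<^sup>2"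
proof -
  define F where "F \<omega> = mform V a (\<lambda>c. X c \<omega>)" for \<omega>
  let ?s = "\<Sum>A\<in>Pow V. (a A)\<^sup>2"
  have am: "all_moments M F" unfolding F_def using V by (intro all_moments_intros)
  have s: "0 \<le> ?s" by (intro sum_nonneg) auto
  have "(expectation (\<lambda>\<omega>. F \<omega> ^ 4))\<^sup>2 = (expectation (\<lambda>\<omega>. F \<omega> ^ 3 * F \<omega>))\<^sup>2"
    by (simp add: power3_eq_cube power4_eq_xxxx)
  also have "\<dots> \<le> expectation (\<lambda>\<omega>. (F \<omega> ^ 3)\<^sup>2) * expectation (\<lambda>\<omega>. (F \<omega>)\<^sup>2)"
    using am by (intro expectation_square_mult_le all_moments_intros)
  also have "\<dots> \<le> (hyp ^ p * ?s) ^ 3 * ?s"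
    using sixth_moment_le_homogeneous[OF assms] expectation_mform_square[OF V, of a] s
    by (simp add: F_def power_mult[symmetric] mult_right_mono)
  also have "\<dots> = (sqrt (hyp ^ (3 * p)) * ?s\<^sup>2)\<^sup>2"
  proof -
    have "hyp ^ (3 * p) = (hyp ^ p) ^ 3" by (simp add: power_mult[symmetric] mult.commute)
    moreover have "(sqrt (hyp ^ (3 * p)) * ?s\<^sup>2)\<^sup>2 = hyp ^ (3 * p) * (?s\<^sup>2)\<^sup>2"
      using hyp_ge_1 by (simp add: power_mult_distrib)
    moreover have "(x * ?s) ^ 3 * ?s = x ^ 3 * (?s\<^sup>2)\<^sup>2" for x by algebra
    ultimately show ?thesis by simp
  qed
  finally have "expectation (\<lambda>\<omega>. F \<omega> ^ 4) \<le> sqrt (hyp ^ (3 * p)) * ?s\<^sup>2"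
    by (rule power2_le_imp_le) (use hyp_ge_1 in auto)
  then show ?thesis by (simp add: F_def)
qed

end

subsection \<open>Lower bound for the fourth cumulant\<close>

text \<open>The first three orthogonal polynomials of the standardized Poisson law with
  \<open>t = 1 / sqrt l\<close>; their squared norms are \<open>1, 1, 2\<close>, independently of \<open>l\<close>.\<close>

definition charlier :: "real \<Rightarrow> nat \<Rightarrow> real \<Rightarrow> real" where
  "charlier t n x = (if n = 0 then 1 else if n = 1 then x else x\<^sup>2 - 1 - t * x)"

text \<open>Here \<open>x^2\<close> equals 1 plus the polynomial of index two, without the linear
  term of the Charlier expansion. The price is that the polynomials of index one and two are
  correlated; they are still centred.\<close>

definition centred_power :: "nat \<Rightarrow> real \<Rightarrow> real" where
  "centred_power n x = (if n = 0 then 1 else if n = 1 then x else x\<^sup>2 - 1)"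

lemma charlier_measurable [measurable]: "charlier t n \<in> borel_measurable borel"
  unfolding charlier_def[abs_def] by measurable

lemma centred_power_measurable [measurable]: "centred_power n \<in> borel_measurable borel"
  unfolding centred_power_def[abs_def] by measurable

lemma (in prob_space) all_moments_charlier [all_moments_intros]:
  "all_moments M f \<Longrightarrow> all_moments M (\<lambda>\<omega>. charlier t n (f \<omega>))"
  unfolding charlier_def by (cases "n = 0"; cases "n = 1") (auto intro!: all_moments_intros)

lemma (in prob_space) all_moments_centred_power [all_moments_intros]:
  "all_moments M f \<Longrightarrow> all_moments M (\<lambda>\<omega>. centred_power n (f \<omega>))"
  unfolding centred_power_def by (cases "n = 0"; cases "n = 1") (auto intro!: all_moments_intros)

lemma pair_deg_le: "pair_deg A B c \<le> 2"
  by (simp add: pair_deg_def)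

lemma (in prob_space) expectation_sum_mult_sum:
  assumes "\<And>i. all_moments M (S i)" "\<And>i. all_moments M (T i)"
  shows "expectation (\<lambda>\<omega>. (\<Sum>i\<in>J. c i * S i \<omega>) * (\<Sum>k\<in>L. d k * T k \<omega>))
    = (\<Sum>i\<in>J. \<Sum>k\<in>L. c i * d k * expectation (\<lambda>\<omega>. S i \<omega> * T k \<omega>))"
proof -
  have int: "integrable M (\<lambda>\<omega>. S i \<omega> * T k \<omega>)" for i k
    using assms by (intro all_moments_integrable all_moments_intros)
  have "(\<lambda>\<omega>. (\<Sum>i\<in>J. c i * S i \<omega>) * (\<Sum>k\<in>L. d k * T k \<omega>))
    = (\<lambda>\<omega>. \<Sum>i\<in>J. \<Sum>k\<in>L. c i * d k * (S i \<omega> * T k \<omega>))"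
    by (simp add: sum_product mult_ac)
  then show ?thesis using int by simp
qed

section \<open>Orthogonality relations and covariances in a single coordinate\<close>

context
  fixes l :: real assumes l: "0 < l"
begin

interpretation P: prob_space "std_poisson l" by (rule prob_space_std_poisson)

lemma std_poisson_integrable_power [simp]:
  "integrable (std_poisson l) (\<lambda>x. x ^ k)" "integrable (std_poisson l) (\<lambda>x. x)"
  using all_moments_integrable[OF P.all_moments_power[OF all_moments_std_poisson[OF l]]]
    all_moments_integrable[OF all_moments_std_poisson[OF l]] by auto

lemma std_poisson_measure_UNIV [simp]: "measure (std_poisson l) UNIV = 1"
  using P.prob_space by simp

lemma power_charlier_expand:
  fixes x t :: real
  shows "x * (x\<^sup>2 - 1 - t * x) = x ^ 3 - x - t * x\<^sup>2"
    "x\<^sup>2 * (x\<^sup>2 - 1 - t * x) = x ^ 4 - x\<^sup>2 - t * x ^ 3"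
    "(x\<^sup>2 - 1 - t * x)\<^sup>2 = x ^ 4 + (t\<^sup>2 - 2) * x\<^sup>2 + 1 - 2 * t * x ^ 3 + 2 * t * x"
    "x * (x\<^sup>2 - 1) = x ^ 3 - x"
    "(x\<^sup>2 - 1)\<^sup>2 = x ^ 4 - 2 * x\<^sup>2 + 1"
    "x * x = x\<^sup>2"
  by algebra+

text \<open>The polynomials are monic and orthogonal to all lower degrees. The restriction
  \<open>u \<le> v\<close> is essential: \<open>x^2\<close> against \<open>x\<close> has the
  integral \<open>1 / sqrt l\<close>.\<close>

lemma integral_power_mult_charlier:
  assumes "u \<le> v" "v \<le> 2"
  shows "(\<integral>x. x ^ u * charlier (1 / sqrt l) v x \<partial>std_poisson l) = (if u = v then fact v else 0)"
proof -
  define t where "t = 1 / sqrt l"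
  have "(u = 0 \<or> u = 1 \<or> u = 2) \<and> (v = 0 \<or> v = 1 \<or> v = 2)" using assms by auto
  then show ?thesis
    using assms std_poisson_moments[OF l] unfolding t_def[symmetric]
    by (elim conjE disjE) (simp_all add: charlier_def power_charlier_expand)
qed

lemma integral_charlier_mult:
  assumes "u \<le> 2" "v \<le> 2"
  shows "(\<integral>x. charlier (1 / sqrt l) u x * charlier (1 / sqrt l) v x \<partial>std_poisson l) = (if u = v then fact v else 0)"
proof -
  define t where "t = 1 / sqrt l"
  have "(u = 0 \<or> u = 1 \<or> u = 2) \<and> (v = 0 \<or> v = 1 \<or> v = 2)" using assms by auto
  then show ?thesis
    using std_poisson_moments[OF l] unfolding t_def[symmetric]
    by (elim conjE disjE) (simp_all add: charlier_def power_charlier_expand mult.commute[of "_ - _" "_ :: real"])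
qed

lemma integral_centred_power:
  assumes "u \<le> 2" shows "(\<integral>x. centred_power u x \<partial>std_poisson l) = of_bool (u = 0)"
proof -
  have "u = 0 \<or> u = 1 \<or> u = 2" using assms by auto
  then show ?thesis using std_poisson_moments[OF l] by (elim disjE) (simp_all add: centred_power_def)
qed

text \<open>The nontrivial values are \<open>2 + t^2\<close> for \<open>(x^2 - 1)^2\<close> and
  \<open>t\<close> for \<open>x (x^2 - 1)\<close>; both are at most \<open>3 + t^2\<close>.\<close>

lemma integral_centred_power_mult_le:
  assumes "u \<le> 2" "v \<le> 2" and b: "1 / l \<le> b"
  shows "\<bar>\<integral>x. centred_power u x * centred_power v x \<partial>std_poisson l\<bar> \<le> 3 + b"
proof -
  define t where "t = 1 / sqrt l"
  have t2: "t\<^sup>2 = 1 / l" using l by (simp add: t_def power_divide)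
  have t: "0 < t" "t\<^sup>2 \<le> b" using l b by (simp_all add: t2) (simp add: t_def)
  have "2 * t \<le> 1 + t\<^sup>2" using sum_squares_bound[of 1 t] by simp
  then have t': "t \<le> 2 + t\<^sup>2" using t by linarith
  have "(u = 0 \<or> u = 1 \<or> u = 2) \<and> (v = 0 \<or> v = 1 \<or> v = 2)" using assms by auto
  then show ?thesis
    using std_poisson_moments[OF l] t t' zero_le_power2[of t] unfolding t_def[symmetric]
    by (elim conjE disjE)
      (simp_all add: centred_power_def power_charlier_expand mult.commute[of "_ - _" "_ :: real"])
qed

end

context poisson_family
begin

text \<open>\<open>Q\<close> is the square of the form with each power replaced by the Charlier
  polynomial of the same degree. It is centred, and its inner product with \<open>F^2\<close> equals
  its own squared norm \<tau>, so \<open>s + Q\<close> is an orthogonal projection of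
  \<open>F^2\<close> and its squared norm \<open>s^2 + \<tau>\<close> is a lower bound.\<close>

lemma fourth_moment_ge:
  assumes V: "finite V" "V \<subseteq> I" and a: "\<And>A. a A \<noteq> 0 \<Longrightarrow> card A = p" and p: "1 \<le> p"
  shows "(\<Sum>A\<in>Pow V. (a A)\<^sup>2)\<^sup>2 + (\<Sum>K\<in>Pow V. \<Sum>K'\<in>Pow V. (\<Sum>A\<in>Pow V. djoin a K A * djoin a K' A)\<^sup>2)
    \<le> expectation (\<lambda>\<omega>. mform V a (\<lambda>c. X c \<omega>) ^ 4)"
proof -
  define T where "T A B \<omega> = (\<Prod>c\<in>V. charlier (\<theta> c) (pair_deg A B c) (X c \<omega>))" for A B \<omega>
  define Y where "Y A B \<omega> = (\<Prod>c\<in>V. X c \<omega> ^ pair_deg A B c)" for A B \<omega>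
  define Q where "Q \<omega> = (\<Sum>A\<in>Pow V. \<Sum>B\<in>Pow V. a A * a B * T A B \<omega>)" for \<omega>
  define F where "F \<omega> = mform V a (\<lambda>c. X c \<omega>)" for \<omega>
  define s where "s = (\<Sum>A\<in>Pow V. (a A)\<^sup>2)"
  define \<tau> where "\<tau> = (\<Sum>K\<in>Pow V. \<Sum>K'\<in>Pow V. (\<Sum>A\<in>Pow V. djoin a K A * djoin a K' A)\<^sup>2)"
  have am [all_moments_intros]: "all_moments M F" "all_moments M (T A B)" "all_moments M (Y A B)" "all_moments M Q" for A B
    unfolding F_def T_def Y_def Q_def using V by (intro all_moments_intros; auto)+
  have l: "0 < lam c" if "c \<in> V" for c using that V lam_pos by auto
  have FF: "(F \<omega>)\<^sup>2 = (\<Sum>A\<in>Pow V. \<Sum>B\<in>Pow V. a A * a B * Y A B \<omega>)" for \<omega>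
    unfolding F_def Y_def power2_eq_square by (rule mform_mult[OF V(1)])
  \<comment> \<open>The Gram matrix of the products \<open>T A B\<close>. Each variable of degree
    two contributes the squared norm 2, hence the power of two.\<close>
  define \<delta> where "\<delta> A B A' B' = (if A \<inter> B = A' \<inter> B' \<and> A \<union> B = A' \<union> B' then 2 ^ card (A \<inter> B) else (0::real))" for A B A' B' :: "'i set"
  have delta: "(\<Prod>c\<in>V. if pair_deg A B c = pair_deg A' B' c then fact (pair_deg A' B' c) else 0) = \<delta> A B A' B'"
    if "A \<subseteq> V" "B \<subseteq> V" "A' \<subseteq> V" "B' \<subseteq> V" for A B A' B'
  proof (cases "\<forall>c\<in>V. pair_deg A B c = pair_deg A' B' c")
    case True
    then have "(\<Prod>c\<in>V. if pair_deg A B c = pair_deg A' B' c then fact (pair_deg A' B' c) else 0) = (\<Prod>c\<in>V. fact (pair_deg A' B' c) :: real)"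
      by (intro prod.cong) auto
    then show ?thesis
      using True pair_deg_eq_iff[OF that] prod_fact_pair_deg[OF V(1) that(3,4)] by (simp add: \<delta>_def)
  next
    case False
    then have "(\<Prod>c\<in>V. if pair_deg A B c = pair_deg A' B' c then fact (pair_deg A' B' c) else (0::real)) = 0"
      using V(1) by (intro prod_zero) auto
    then show ?thesis using False pair_deg_eq_iff[OF that] by (auto simp: \<delta>_def)
  qed
  have TT: "expectation (\<lambda>\<omega>. T A B \<omega> * T A' B' \<omega>) = \<delta> A B A' B'"
    if "A \<subseteq> V" "B \<subseteq> V" "A' \<subseteq> V" "B' \<subseteq> V" for A B A' B'
  proof -
    have "expectation (\<lambda>\<omega>. T A B \<omega> * T A' B' \<omega>)
      = expectation (\<lambda>\<omega>. \<Prod>c\<in>V. (\<lambda>x. charlier (\<theta> c) (pair_deg A B c) x * charlier (\<theta> c) (pair_deg A' B' c) x) (X c \<omega>))"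
      by (simp add: T_def prod.distrib)
    also have "\<dots> = (\<Prod>c\<in>V. \<integral>x. charlier (\<theta> c) (pair_deg A B c) x * charlier (\<theta> c) (pair_deg A' B' c) x \<partial>std_poisson (lam c))"
      using V by (intro expectation_prod all_moments_integrable all_moments_intros) auto
    also have "\<dots> = (\<Prod>c\<in>V. if pair_deg A B c = pair_deg A' B' c then fact (pair_deg A' B' c) else 0)"
      unfolding \<theta>_def using l by (intro prod.cong refl integral_charlier_mult pair_deg_le)
    finally show ?thesis using delta[OF that] by simp
  qed
  have YT: "expectation (\<lambda>\<omega>. Y A B \<omega> * T A' B' \<omega>) = \<delta> A B A' B'"
    if sub: "A \<subseteq> V" "B \<subseteq> V" "A' \<subseteq> V" "B' \<subseteq> V" and c: "card A + card B = card A' + card B'" for A B A' B'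
  proof -
    have "expectation (\<lambda>\<omega>. Y A B \<omega> * T A' B' \<omega>)
      = expectation (\<lambda>\<omega>. \<Prod>c\<in>V. (\<lambda>x. x ^ pair_deg A B c * charlier (\<theta> c) (pair_deg A' B' c) x) (X c \<omega>))"
      by (simp add: T_def Y_def prod.distrib)
    also have "\<dots> = (\<Prod>c\<in>V. \<integral>x. x ^ pair_deg A B c * charlier (\<theta> c) (pair_deg A' B' c) x \<partial>std_poisson (lam c))"
      using V by (intro expectation_prod all_moments_integrable all_moments_intros) auto
    also have "\<dots> = (\<Prod>c\<in>V. if pair_deg A B c = pair_deg A' B' c then fact (pair_deg A' B' c) else 0)"
    proof (cases "\<forall>c\<in>V. pair_deg A B c = pair_deg A' B' c")
      case True
      then show ?thesis
        unfolding \<theta>_def using l by (intro prod.cong refl) (subst integral_power_mult_charlier, auto simp: pair_deg_le)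
    next
      case False
      \<comment> \<open>With equal total degrees, two different degree functions must cross. Where
        the power is lower than the Charlier degree, orthogonality makes the factor vanish.\<close>
      have "\<exists>c\<in>V. pair_deg A B c < pair_deg A' B' c"
      proof (rule ccontr)
        assume "\<not> ?thesis"
        then have le: "\<forall>c\<in>V. pair_deg A' B' c \<le> pair_deg A B c" by (auto simp: not_less)
        with False have "\<exists>c\<in>V. pair_deg A' B' c < pair_deg A B c" by force
        with le have "(\<Sum>c\<in>V. pair_deg A' B' c) < (\<Sum>c\<in>V. pair_deg A B c)"
          using V(1) by (intro sum_strict_mono_ex1) auto
        then show False using c sub by (simp add: sum_pair_deg[OF V(1)])
      qed
      then obtain c where c: "c \<in> V" "pair_deg A B c < pair_deg A' B' c" by auto
      then have "(\<integral>x. x ^ pair_deg A B c * charlier (\<theta> c) (pair_deg A' B' c) x \<partial>std_poisson (lam c)) = 0"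
        unfolding \<theta>_def using integral_power_mult_charlier[OF l[OF c(1)] less_imp_le[OF c(2)] pair_deg_le] by simp
      then show ?thesis using c V(1) False
        by (intro trans[OF prod_zero prod_zero[symmetric]]) auto
    qed
    finally show ?thesis using delta[OF sub] by simp
  qed
  have tau: "(\<Sum>A\<in>Pow V. \<Sum>B\<in>Pow V. \<Sum>A'\<in>Pow V. \<Sum>B'\<in>Pow V. a A * a B * (a A' * a B') * \<delta> A B A' B') = \<tau>"
    unfolding \<tau>_def sum_pairs_same_union_inter[OF V(1), symmetric] \<delta>_def by (intro sum.cong refl) simp
  let ?J = "Pow V \<times> Pow V"
  have Q_pair: "Q \<omega> = (\<Sum>p\<in>?J. (case p of (A, B) \<Rightarrow> a A * a B) * (case p of (A, B) \<Rightarrow> T A B) \<omega>)" for \<omega>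
    unfolding Q_def by (simp add: sum.cartesian_product case_prod_unfold)
  have F_pair: "(F \<omega>)\<^sup>2 = (\<Sum>p\<in>?J. (case p of (A, B) \<Rightarrow> a A * a B) * (case p of (A, B) \<Rightarrow> Y A B) \<omega>)" for \<omega>
    unfolding FF by (simp add: sum.cartesian_product case_prod_unfold)
  have am_pair: "all_moments M (case p of (A, B) \<Rightarrow> T A B)" "all_moments M (case p of (A, B) \<Rightarrow> Y A B)" for p
    by (auto simp: am split: prod.split)
  have EQQ: "expectation (\<lambda>\<omega>. Q \<omega> * Q \<omega>) = \<tau>"
    unfolding Q_pair expectation_sum_mult_sum[OF am_pair(1) am_pair(1)] tau[symmetric]
    by (simp add: sum.cartesian_product' TT)
  \<comment> \<open>Terms with nonzero coefficients have total degree \<open>2 p\<close> on both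
    sides, so \<open>YT\<close> applies to them.\<close>
  have EFQ: "expectation (\<lambda>\<omega>. (F \<omega>)\<^sup>2 * Q \<omega>) = \<tau>"
    unfolding Q_pair F_pair expectation_sum_mult_sum[OF am_pair(2) am_pair(1)] tau[symmetric]
    unfolding sum.cartesian_product' prod.case
  proof (intro sum.cong refl)
    fix A B A' B' assume "A \<in> Pow V" "B \<in> Pow V" "A' \<in> Pow V" "B' \<in> Pow V"
    then show "a A * a B * (a A' * a B') * expectation (\<lambda>\<omega>. Y A B \<omega> * T A' B' \<omega>) = a A * a B * (a A' * a B') * \<delta> A B A' B'"
      using YT[of A B A' B'] a[of A] a[of B] a[of A'] a[of B']
      by (cases "a A = 0 \<or> a B = 0 \<or> a A' = 0 \<or> a B' = 0") auto
  qed
  \<comment> \<open>Since \<open>p\<close> is positive, every product in \<open>Q\<close> with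
    nonzero coefficient has positive degree and is orthogonal to \<open>T {} {}\<close>, the
    constant 1.\<close>
  have EQ: "expectation Q = 0"
  proof -
    have "a A * a B * expectation (T A B) = 0" if sub: "A \<subseteq> V" "B \<subseteq> V" for A B
    proof (cases "a A = 0")
      case False
      then have "A \<noteq> {}" using a[of A] p by auto
      moreover have "expectation (\<lambda>\<omega>. T {} {} \<omega> * T A B \<omega>) = 0"
        using TT[of "{}" "{}" A B] sub \<open>A \<noteq> {}\<close> by (auto simp: \<delta>_def)
      moreover have "T {} {} \<omega> = 1" for \<omega> by (simp add: T_def pair_deg_def charlier_def)
      ultimately show ?thesis by simp
    qed simp
    then show ?thesis
      unfolding Q_def by (simp add: all_moments_integrable am) (intro sum.neutral ballI; auto)
  qed
  have EF: "expectation (\<lambda>\<omega>. (F \<omega>)\<^sup>2) = s"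
    unfolding F_def s_def by (rule expectation_mform_square[OF V])
  have "0 \<le> expectation (\<lambda>\<omega>. ((F \<omega>)\<^sup>2 - s - Q \<omega>)\<^sup>2)" by simp
  also have "(\<lambda>\<omega>. ((F \<omega>)\<^sup>2 - s - Q \<omega>)\<^sup>2)
      = (\<lambda>\<omega>. F \<omega> ^ 4 + s\<^sup>2 + Q \<omega> * Q \<omega> - 2 * s * (F \<omega>)\<^sup>2 - 2 * ((F \<omega>)\<^sup>2 * Q \<omega>) + 2 * s * Q \<omega>)"
    by (rule ext) algebra
  also have "expectation \<dots> = expectation (\<lambda>\<omega>. F \<omega> ^ 4) + s\<^sup>2 + \<tau> - 2 * s * s - 2 * \<tau> + 2 * s * 0"
  proof -
    have "integrable M (\<lambda>\<omega>. F \<omega> ^ 4)" "integrable M (\<lambda>\<omega>. Q \<omega> * Q \<omega>)" "integrable M (\<lambda>\<omega>. (F \<omega>)\<^sup>2)"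
      "integrable M (\<lambda>\<omega>. (F \<omega>)\<^sup>2 * Q \<omega>)" "integrable M Q"
      by (intro all_moments_integrable all_moments_intros)+
    then show ?thesis by (simp add: EQQ EFQ EF EQ prob_space)
  qed
  finally show ?thesis by (simp add: F_def s_def \<tau>_def power2_eq_square)
qed

end

subsection \<open>Variance of products of derivatives\<close>

definition centred_monomial :: "'i set \<Rightarrow> 'i set \<Rightarrow> 'i set \<Rightarrow> ('i \<Rightarrow> real) \<Rightarrow> real" where
  "centred_monomial V A B y = (\<Prod>c\<in>V. centred_power (pair_deg A B c) (y c))"

text \<open>The coefficient of \<open>centred_monomial V A B\<close> in the sum over
  \<open>i\<close> of the products of the derivatives of the two forms. \<open>K\<close> is the
  block of variables that have been paired off; the weight \<open>card K\<close> counts which of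
  them was the variable of differentiation.\<close>

definition gamma_coeff :: "'i set \<Rightarrow> ('i set \<Rightarrow> real) \<Rightarrow> ('i set \<Rightarrow> real) \<Rightarrow> 'i set \<Rightarrow> 'i set \<Rightarrow> real" where
  "gamma_coeff V a b A B = (\<Sum>K\<in>Pow V. real (card K) * (djoin a K A * djoin b K B))"

text \<open>Each common variable is expanded by \<open>x^2 = 1 + (x^2 - 1)\<close>, and
  \<open>L\<close> is the set of those for which the summand 1 is chosen.\<close>

lemma prod_power_pair_deg_expand:
  assumes V: "finite V" and AB: "A \<subseteq> V" "B \<subseteq> V"
  shows "(\<Prod>c\<in>V. y c ^ pair_deg A B c) = (\<Sum>L\<in>Pow (A \<inter> B). centred_monomial V (A - L) (B - L) y)"
proof -
  have "(\<Prod>c\<in>V. y c ^ pair_deg A B c) = (\<Prod>c\<in>V. of_bool (c \<in> A \<inter> B) + centred_power (pair_deg A B c) (y c))"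
    by (intro prod.cong refl) (auto simp: pair_deg_def centred_power_def numeral_2_eq_2)
  also have "\<dots> = (\<Sum>L\<in>Pow V. (\<Prod>c\<in>L. of_bool (c \<in> A \<inter> B)) * (\<Prod>c\<in>V - L. centred_power (pair_deg A B c) (y c)))"
    by (rule prod_add[OF V])
  also have "\<dots> = (\<Sum>L\<in>Pow (A \<inter> B). centred_monomial V (A - L) (B - L) y)"
  proof (rule sum.mono_neutral_cong_right)
    show "finite (Pow V)" "Pow (A \<inter> B) \<subseteq> Pow V" using V AB by auto
    show "\<forall>L\<in>Pow V - Pow (A \<inter> B). (\<Prod>c\<in>L. of_bool (c \<in> A \<inter> B)) * (\<Prod>c\<in>V - L. centred_power (pair_deg A B c) (y c)) = 0"
    proof
      fix L assume L: "L \<in> Pow V - Pow (A \<inter> B)"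
      then obtain c where "c \<in> L" "c \<notin> A \<inter> B" by auto
      moreover have "finite L" using L V by (auto intro: finite_subset)
      ultimately have "(\<Prod>c\<in>L. of_bool (c \<in> A \<inter> B) :: real) = 0" by (intro prod_zero) auto
      then show "(\<Prod>c\<in>L. of_bool (c \<in> A \<inter> B)) * (\<Prod>c\<in>V - L. centred_power (pair_deg A B c) (y c)) = 0" by simp
    qed
    fix L assume L: "L \<in> Pow (A \<inter> B)"
    then have "(\<Prod>c\<in>L. of_bool (c \<in> A \<inter> B) :: real) = 1" by (intro prod.neutral) auto
    moreover have "(\<Prod>c\<in>V - L. centred_power (pair_deg A B c) (y c)) = centred_monomial V (A - L) (B - L) y"
      unfolding centred_monomial_def using V L
      by (intro prod.mono_neutral_cong_left) (auto simp: pair_deg_def centred_power_def)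
    ultimately show "(\<Prod>c\<in>L. of_bool (c \<in> A \<inter> B)) * (\<Prod>c\<in>V - L. centred_power (pair_deg A B c) (y c))
      = centred_monomial V (A - L) (B - L) y" by simp
  qed
  finally show ?thesis .
qed

lemma sum_derivative_products_expand:
  assumes V: "finite V"
  shows "(\<Sum>i\<in>V. mform V (djoin a {i}) y * mform V (djoin b {i}) y)
    = (\<Sum>A\<in>Pow V. \<Sum>B\<in>Pow V. gamma_coeff V a b A B * centred_monomial V A B y)"
proof -
  let ?S = "{(i, A, B, L). i \<in> V \<and> A \<subseteq> V \<and> B \<subseteq> V \<and> i \<notin> A \<and> i \<notin> B \<and> L \<subseteq> A \<inter> B}"
  let ?R = "{(i, A, B, K). i \<in> K \<and> A \<subseteq> V \<and> B \<subseteq> V \<and> K \<subseteq> V \<and> K \<inter> A = {} \<and> K \<inter> B = {}}"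
  let ?C = "centred_monomial V"
  have "(\<Sum>i\<in>V. mform V (djoin a {i}) y * mform V (djoin b {i}) y)
    = (\<Sum>i\<in>V. \<Sum>A\<in>Pow V. \<Sum>B\<in>Pow V. \<Sum>L\<in>Pow (A \<inter> B). djoin a {i} A * djoin b {i} B * ?C (A - L) (B - L) y)"
    unfolding mform_mult[OF V]
    by (intro sum.cong refl) (simp add: prod_power_pair_deg_expand[OF V] sum_distrib_left)
  also have "\<dots> = (\<Sum>i\<in>V. \<Sum>A\<in>Pow V. \<Sum>B\<in>Pow V. \<Sum>L\<in>Pow V. if i \<notin> A \<and> i \<notin> B \<and> L \<subseteq> A \<inter> B then
      a (insert i A) * b (insert i B) * ?C (A - L) (B - L) y else 0)"
  proof (rule sum.cong[OF refl], rule sum.cong[OF refl], rule sum.cong[OF refl])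
    fix i A B assume "A \<in> Pow V" "B \<in> Pow V"
    then have sub: "Pow (A \<inter> B) \<subseteq> Pow V" by auto
    show "(\<Sum>L\<in>Pow (A \<inter> B). djoin a {i} A * djoin b {i} B * ?C (A - L) (B - L) y)
      = (\<Sum>L\<in>Pow V. if i \<notin> A \<and> i \<notin> B \<and> L \<subseteq> A \<inter> B then a (insert i A) * b (insert i B) * ?C (A - L) (B - L) y else 0)"
      using V sub by (intro sum.mono_neutral_cong_left) (auto simp: djoin_def)
  qed
  also have "\<dots> = (\<Sum>(i, A, B, L)\<in>V \<times> Pow V \<times> Pow V \<times> Pow V. if i \<notin> A \<and> i \<notin> B \<and> L \<subseteq> A \<inter> B then
      a (insert i A) * b (insert i B) * ?C (A - L) (B - L) y else 0)"
    by (simp add: sum.cartesian_product)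
  also have "\<dots> = (\<Sum>(i, A, B, L)\<in>?S. a (insert i A) * b (insert i B) * ?C (A - L) (B - L) y)"
    using V by (intro sum.mono_neutral_cong_right) (auto split: if_splits)
  \<comment> \<open>The differentiation variable \<open>i\<close> and the set \<open>L\<close> of
    variables replaced by 1 merge into the block \<open>K = insert i L\<close>.\<close>
  also have "\<dots> = (\<Sum>(i, A, B, K)\<in>?R. a (K \<union> A) * b (K \<union> B) * ?C A B y)"
  proof (rule sum.reindex_bij_witness[where
      j = "\<lambda>(i, A, B, L). (i, A - L, B - L, insert i L)"
      and i = "\<lambda>(i, A, B, K). (i, A \<union> (K - {i}), B \<union> (K - {i}), K - {i})"], goal_cases)
    case (1 x) then show ?case by auto
  next
    case (2 x) then show ?case by auto
  next
    case (3 x) then show ?case by auto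
  next
    case (4 x) then show ?case by auto
  next
    case (5 x)
    obtain i A B L where x: "x = (i, A, B, L)" by (cases x)
    have "insert i L \<union> (A - L) = insert i A" "insert i L \<union> (B - L) = insert i B" using 5 by (auto simp: x)
    then show ?case by (simp add: x)
  qed
  also have "\<dots> = (\<Sum>(i, A, B, K)\<in>V \<times> Pow V \<times> Pow V \<times> Pow V. if i \<in> K then djoin a K A * djoin b K B * ?C A B y else 0)"
    using V by (intro sum.mono_neutral_cong_left) (auto simp: djoin_def split: if_splits)
  also have "\<dots> = (\<Sum>i\<in>V. \<Sum>A\<in>Pow V. \<Sum>B\<in>Pow V. \<Sum>K\<in>Pow V. if i \<in> K then djoin a K A * djoin b K B * ?C A B y else 0)"
    by (simp add: sum.cartesian_product)
  also have "\<dots> = (\<Sum>A\<in>Pow V. \<Sum>B\<in>Pow V. \<Sum>K\<in>Pow V. \<Sum>i\<in>V. if i \<in> K then djoin a K A * djoin b K B * ?C A B y else 0)"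
    by (subst sum.swap, intro sum.cong refl, subst sum.swap, intro sum.cong refl, rule sum.swap)
  also have "\<dots> = (\<Sum>A\<in>Pow V. \<Sum>B\<in>Pow V. gamma_coeff V a b A B * ?C A B y)"
  proof (intro sum.cong refl)
    fix A B
    show "(\<Sum>K\<in>Pow V. \<Sum>i\<in>V. if i \<in> K then djoin a K A * djoin b K B * ?C A B y else 0) = gamma_coeff V a b A B * ?C A B y"
      unfolding gamma_coeff_def sum_distrib_right
      using V by (intro sum.cong refl) (auto simp: sum.If_cases Int_absorb1)
  qed
  finally show ?thesis .
qed

text \<open>Homogeneity forces \<open>card K = p - card A\<close>, so up to this number the
  coefficient is a single entry of one contraction.\<close>

lemma gamma_coeff_eq:
  assumes V: "finite V" and a: "\<And>A. a A \<noteq> 0 \<Longrightarrow> card A = p" and A: "A \<subseteq> V"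
  shows "gamma_coeff V a b A B = real (p - card A) * (\<Sum>K | K \<subseteq> V \<and> card K = p - card A. djoin a K A * djoin b K B)"
proof -
  have *: "card K = p - card A" if "K \<subseteq> V" "djoin a K A \<noteq> 0" for K
  proof -
    have "K \<inter> A = {}" "card (K \<union> A) = p" using that a[of "K \<union> A"] by (auto simp: djoin_def split: if_splits)
    moreover have "finite K" "finite A" using that A V by (auto intro: finite_subset)
    ultimately show ?thesis using card_Un_disjoint[of K A] by simp
  qed
  have "gamma_coeff V a b A B = (\<Sum>K | K \<subseteq> V \<and> card K = p - card A. real (card K) * (djoin a K A * djoin b K B))"
    unfolding gamma_coeff_def using V * by (intro sum.mono_neutral_right) auto
  also have "\<dots> = real (p - card A) * (\<Sum>K | K \<subseteq> V \<and> card K = p - card A. djoin a K A * djoin b K B)"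
    unfolding sum_distrib_left by (intro sum.cong) auto
  finally show ?thesis .
qed

lemma gamma_coeff_empty:
  assumes V: "finite V" and a: "\<And>A. a A \<noteq> 0 \<Longrightarrow> card A = p"
  shows "gamma_coeff V a b {} {} = p * (\<Sum>A\<in>Pow V. a A * b A)"
  unfolding gamma_coeff_def sum_distrib_left
proof (intro sum.cong refl)
  fix K show "real (card K) * (djoin a K {} * djoin b K {}) = real p * (a K * b K)"
    using a[of K] by (cases "a K = 0") (auto simp: djoin_def)
qed

text \<open>The bound limits both the number of pairs with a given union and the number of factors
  in a covariance of centred monomials.\<close>

lemma gamma_coeff_card:
  assumes V: "finite V" and a: "\<And>A. a A \<noteq> 0 \<Longrightarrow> card A = p" and b: "\<And>A. b A \<noteq> 0 \<Longrightarrow> card A = q"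
    and nz: "gamma_coeff V a b A B \<noteq> 0" and AB: "A \<subseteq> V" "B \<subseteq> V"
  shows "card (A \<union> B) \<le> p + q"
proof -
  from nz obtain K where K: "K \<subseteq> V" "djoin a K A \<noteq> 0" "djoin b K B \<noteq> 0"
    unfolding gamma_coeff_def by (metis (no_types, lifting) PowD mult_eq_0_iff sum.neutral)
  then have "card (K \<union> A) = p" "card (K \<union> B) = q" using a b by (auto simp: djoin_def split: if_splits)
  moreover have fin: "finite K" "finite A" "finite B" using K AB V by (auto intro: finite_subset)
  ultimately have "card A \<le> p" "card B \<le> q"
    using card_mono[of "K \<union> A" A] card_mono[of "K \<union> B" B] by auto
  then show ?thesis using card_Un_le[of A B] by linarith
qed

text \<open>Removing the pair of empty sets subtracts the mean. If \<open>r = p = q\<close>, that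
  pair is the only one that contributes to the contraction, so precisely the full contraction of
  forms of equal degree disappears from the bound.\<close>

lemma sum_gamma_coeff_square_le:
  assumes V: "finite V" and a: "\<And>A. a A \<noteq> 0 \<Longrightarrow> card A = p" and b: "\<And>A. b A \<noteq> 0 \<Longrightarrow> card A = q"
  shows "(\<Sum>(A, B)\<in>Pow V \<times> Pow V - {({}, {})}. (gamma_coeff V a b A B)\<^sup>2)
    \<le> (real p)\<^sup>2 * (\<Sum>r = 1..p. if r = p \<and> r = q then 0 else contr V r a b)"
proof -
  let ?D = "Pow V \<times> Pow V - {({}, {})}"
  define c where "c r A B = (\<Sum>K | K \<subseteq> V \<and> card K = r. djoin a K A * djoin b K B)" for r A B
  have fin: "finite ?D" using V by auto
  have "(\<Sum>(A, B)\<in>?D. (gamma_coeff V a b A B)\<^sup>2) \<le> (\<Sum>(A, B)\<in>?D. (real p)\<^sup>2 * (\<Sum>r = 1..p. (c r A B)\<^sup>2))"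
  proof (rule sum_mono)
    fix x assume x: "x \<in> ?D"
    obtain A B where xAB: "x = (A, B)" by (cases x)
    have "A \<subseteq> V" using x by (auto simp: xAB)
    then have e: "gamma_coeff V a b A B = real (p - card A) * c (p - card A) A B"
      unfolding c_def by (intro gamma_coeff_eq V a)
    have "(gamma_coeff V a b A B)\<^sup>2 \<le> (real p)\<^sup>2 * (\<Sum>r = 1..p. (c r A B)\<^sup>2)"
    proof (cases "p - card A = 0")
      case True
      then show ?thesis by (simp add: e sum_nonneg)
    next
      case False
      then have "(c (p - card A) A B)\<^sup>2 \<le> (\<Sum>r = 1..p. (c r A B)\<^sup>2)"
        by (intro member_le_sum) auto
      then show ?thesis unfolding e power_mult_distrib by (intro mult_mono power_mono) auto
    qed
    then show "(case x of (A, B) \<Rightarrow> (gamma_coeff V a b A B)\<^sup>2)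
        \<le> (case x of (A, B) \<Rightarrow> (real p)\<^sup>2 * (\<Sum>r = 1..p. (c r A B)\<^sup>2))" by (simp add: xAB)
  qed
  also have "\<dots> = (real p)\<^sup>2 * (\<Sum>r = 1..p. \<Sum>(A, B)\<in>?D. (c r A B)\<^sup>2)"
    unfolding case_prod_unfold sum_distrib_left[symmetric] by (subst sum.swap) (rule refl)
  also have "\<dots> \<le> (real p)\<^sup>2 * (\<Sum>r = 1..p. if r = p \<and> r = q then 0 else contr V r a b)"
  proof (intro mult_left_mono sum_mono)
    fix r assume r: "r \<in> {1..p}"
    show "(\<Sum>(A, B)\<in>?D. (c r A B)\<^sup>2) \<le> (if r = p \<and> r = q then 0 else contr V r a b)"
    proof (cases "r = p \<and> r = q")
      case True
      have c0: "c r A B = 0" if "(A, B) \<in> ?D" for A B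
        unfolding c_def
      proof (intro sum.neutral ballI)
        fix K assume K: "K \<in> {K. K \<subseteq> V \<and> card K = r}"
        have f: "finite K" "finite A" "finite B" using K that V by (auto intro: finite_subset)
        show "djoin a K A * djoin b K B = 0"
        proof (rule ccontr)
          assume "\<not> ?thesis"
          then have "K \<inter> A = {}" "K \<inter> B = {}" "card (K \<union> A) = r" "card (K \<union> B) = r"
            using a[of "K \<union> A"] b[of "K \<union> B"] True by (auto simp: djoin_def split: if_splits)
          then have "card A = 0" "card B = 0" using f K by (auto simp: card_Un_disjoint)
          then show False using f that by auto
        qed
      qed
      have "(\<Sum>(A, B)\<in>?D. (c r A B)\<^sup>2) = 0"
      proof (intro sum.neutral ballI)
        fix x assume x: "x \<in> ?D"
        obtain A B where "x = (A, B)" by (cases x)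
        then show "(case x of (A, B) \<Rightarrow> (c r A B)\<^sup>2) = 0" using c0[of A B] x by simp
      qed
      then show ?thesis using True by simp
    next
      case False
      have "(\<Sum>(A, B)\<in>?D. (c r A B)\<^sup>2) \<le> (\<Sum>(A, B)\<in>Pow V \<times> Pow V. (c r A B)\<^sup>2)"
        using V by (intro sum_mono2) auto
      also have "\<dots> = contr V r a b" by (simp add: contr_def c_def sum.cartesian_product)
      finally show ?thesis using False by auto
    qed
  qed simp
  finally show ?thesis .
qed

context poisson_family
begin

text \<open>Centred monomials are correlated only if their unions \<open>A \<union> B\<close> agree,
  and each has at most \<open>4 ^ (p + q)\<close> such partners. A Schur test then bounds the
  variance by the sum of the squared coefficients, as it would be for an orthogonal family, up to a
  constant.\<close>

lemma variance_gamma_le: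
  assumes V: "finite V" "V \<subseteq> I" and a: "\<And>A. a A \<noteq> 0 \<Longrightarrow> card A = p" and b: "\<And>A. b A \<noteq> 0 \<Longrightarrow> card A = q"
  shows "expectation (\<lambda>\<omega>. ((\<Sum>i\<in>V. mform V (djoin a {i}) (\<lambda>c. X c \<omega>) * mform V (djoin b {i}) (\<lambda>c. X c \<omega>))
        - p * (\<Sum>A\<in>Pow V. a A * b A))\<^sup>2)
    \<le> (4 * (3 + 1 / \<alpha>)) ^ (p + q) * ((real p)\<^sup>2 * (\<Sum>r = 1..p. if r = p \<and> r = q then 0 else contr V r a b))"
proof -
  let ?D = "Pow V \<times> Pow V - {({}, {})}"
  let ?\<kappa> = "3 + 1 / \<alpha>"
  define c where "c = (\<lambda>(A, B). gamma_coeff V a b A B)"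
  define Z where "Z = (\<lambda>(A, B) \<omega>. centred_monomial V A B (\<lambda>c. X c \<omega>))"
  define sm where "sm = (\<lambda>(A, B) (A', B'). A \<union> B = A' \<union> (B' :: 'i set))"
  have \<kappa>: "1 \<le> ?\<kappa>" using \<alpha>_pos by simp
  have fin: "finite ?D" using V by auto
  have l: "0 < lam c" "1 / lam c \<le> 1 / \<alpha>" if "c \<in> V" for c
    using that V lam_pos lam_ge[of c] \<alpha>_pos by (auto intro!: divide_left_mono)
  have am [all_moments_intros]: "all_moments M (Z x)" for x
    unfolding Z_def centred_monomial_def case_prod_unfold using V by (intro all_moments_intros) auto
  have ZZ: "expectation (\<lambda>\<omega>. Z (A, B) \<omega> * Z (A', B') \<omega>) = (\<Prod>c\<in>V. \<integral>x. centred_power (pair_deg A B c) x * centred_power (pair_deg A' B' c) x \<partial>std_poisson (lam c))" for A B A' B'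
  proof -
    have "expectation (\<lambda>\<omega>. Z (A, B) \<omega> * Z (A', B') \<omega>)
      = expectation (\<lambda>\<omega>. \<Prod>c\<in>V. (\<lambda>x. centred_power (pair_deg A B c) x * centred_power (pair_deg A' B' c) x) (X c \<omega>))"
      by (simp add: Z_def centred_monomial_def prod.distrib)
    also have "\<dots> = (\<Prod>c\<in>V. \<integral>x. centred_power (pair_deg A B c) x * centred_power (pair_deg A' B' c) x \<partial>std_poisson (lam c))"
      using V by (intro expectation_prod all_moments_integrable all_moments_intros) auto
    finally show ?thesis .
  qed
  have ZZ_le: "\<bar>expectation (\<lambda>\<omega>. Z x \<omega> * Z y \<omega>)\<bar> \<le> (if sm x y then ?\<kappa> ^ (p + q) else 0)"
    if x: "x \<in> ?D" "c x \<noteq> 0" and y: "y \<in> ?D" for x y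
  proof -
    obtain A B A' B' where xy: "x = (A, B)" "y = (A', B')" by (cases x, cases y) auto
    have sub: "A \<subseteq> V" "B \<subseteq> V" "A' \<subseteq> V" "B' \<subseteq> V" using x y by (auto simp: xy)
    let ?e = "\<lambda>c. \<integral>x. centred_power (pair_deg A B c) x * centred_power (pair_deg A' B' c) x \<partial>std_poisson (lam c)"
    show ?thesis
    proof (cases "A \<union> B = A' \<union> B'")
      case True
      have "\<bar>?e c\<bar> \<le> (if c \<in> A \<union> B then ?\<kappa> else 1)" if "c \<in> V" for c
      proof (cases "c \<in> A \<union> B")
        case False
        then have "pair_deg A B c = 0" "pair_deg A' B' c = 0" using True by (auto simp: pair_deg_def)
        then show ?thesis using False std_poisson_measure_UNIV[OF l(1)[OF that]] by (simp add: centred_power_def)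
      qed (use integral_centred_power_mult_le[OF l(1)[OF that] pair_deg_le pair_deg_le l(2)[OF that]] in simp)
      then have "(\<Prod>c\<in>V. \<bar>?e c\<bar>) \<le> (\<Prod>c\<in>V. if c \<in> A \<union> B then ?\<kappa> else 1)"
        by (intro prod_mono) auto
      also have "\<dots> = ?\<kappa> ^ card (A \<union> B)"
      proof -
        have "V \<inter> {c. c \<in> A \<or> c \<in> B} = A \<union> B" using sub by auto
        then show ?thesis using V by (simp add: prod.If_cases)
      qed
      also have "\<dots> \<le> ?\<kappa> ^ (p + q)"
        using gamma_coeff_card[OF V(1) a b _ sub(1,2)] x(2) \<kappa> by (intro power_increasing) (auto simp: c_def xy)
      finally show ?thesis using True by (simp add: xy ZZ sm_def abs_prod)
    next
      case False
      then obtain c where c: "(c \<in> A \<union> B) \<noteq> (c \<in> A' \<union> B')" by blast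
      then have cV: "c \<in> V" using sub by auto
      \<comment> \<open>A variable in only one of the two unions has degree zero on the other side,
        so its factor is the mean of a centred polynomial.\<close>
      have "?e c = 0"
        using c integral_centred_power[OF l(1)[OF cV] pair_deg_le, of A B c] integral_centred_power[OF l(1)[OF cV] pair_deg_le, of A' B' c]
        by (auto simp: pair_deg_def centred_power_def[of 0])
      then have "(\<Prod>c\<in>V. ?e c) = 0" using cV V by (intro prod_zero) auto
      then show ?thesis using False by (simp add: xy ZZ sm_def)
    qed
  qed
  have card_sm: "real (card {y \<in> ?D. sm x y}) \<le> 4 ^ (p + q)" if x: "x \<in> ?D" "c x \<noteq> 0" for x
  proof -
    obtain A B where xy: "x = (A, B)" by (cases x)
    have sub: "A \<subseteq> V" "B \<subseteq> V" using x by (auto simp: xy)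
    have f: "finite (A \<union> B)" using sub V by (auto intro: finite_subset)
    have "card {y \<in> ?D. sm x y} \<le> card (Pow (A \<union> B) \<times> Pow (A \<union> B))"
      using f by (intro card_mono) (auto simp: xy sm_def)
    also have "\<dots> = 4 ^ card (A \<union> B)"
      using f by (simp add: card_cartesian_product card_Pow power_mult_distrib[symmetric])
    also have "\<dots> \<le> 4 ^ (p + q)"
      using gamma_coeff_card[OF V(1) a b _ sub] x(2) by (intro power_increasing) (auto simp: c_def xy)
    finally have "real (card {y \<in> ?D. sm x y}) \<le> real (4 ^ (p + q))" by (simp only: of_nat_le_iff)
    then show ?thesis by simp
  qed
  have U: "(\<Sum>i\<in>V. mform V (djoin a {i}) (\<lambda>c. X c \<omega>) * mform V (djoin b {i}) (\<lambda>c. X c \<omega>)) - p * (\<Sum>A\<in>Pow V. a A * b A)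
    = (\<Sum>x\<in>?D. c x * Z x \<omega>)" for \<omega>
  proof -
    have "(\<Sum>i\<in>V. mform V (djoin a {i}) (\<lambda>c. X c \<omega>) * mform V (djoin b {i}) (\<lambda>c. X c \<omega>)) = (\<Sum>x\<in>Pow V \<times> Pow V. c x * Z x \<omega>)"
      unfolding sum_derivative_products_expand[OF V(1)] by (simp add: sum.cartesian_product' c_def Z_def)
    also have "\<dots> = c ({}, {}) * Z ({}, {}) \<omega> + (\<Sum>x\<in>?D. c x * Z x \<omega>)"
      using V by (intro sum.remove) auto
    also have "c ({}, {}) * Z ({}, {}) \<omega> = p * (\<Sum>A\<in>Pow V. a A * b A)"
      using gamma_coeff_empty[OF V(1), of a p b] a by (simp add: c_def Z_def centred_monomial_def pair_deg_def centred_power_def)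
    finally show ?thesis by simp
  qed
  have "expectation (\<lambda>\<omega>. (\<Sum>x\<in>?D. c x * Z x \<omega>)\<^sup>2) = (\<Sum>x\<in>?D. \<Sum>y\<in>?D. c x * c y * expectation (\<lambda>\<omega>. Z x \<omega> * Z y \<omega>))"
    unfolding power2_eq_square by (rule expectation_sum_mult_sum) (rule am)+
  \<comment> \<open>By \<open>2 |c x c y| \<le> (c x)^2 + (c y)^2\<close> each index is charged with
    its own square once per correlated partner.\<close>
  also have "\<dots> \<le> (\<Sum>x\<in>?D. \<Sum>y\<in>?D. ?\<kappa> ^ (p + q) / 2 * (of_bool (sm x y) * (c x)\<^sup>2 + of_bool (sm y x) * (c y)\<^sup>2))"
  proof (intro sum_mono)
    fix x y assume xy: "x \<in> ?D" "y \<in> ?D"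
    have sym: "sm y x \<longleftrightarrow> sm x y" by (auto simp: sm_def split: prod.splits)
    have "c x * c y * expectation (\<lambda>\<omega>. Z x \<omega> * Z y \<omega>) \<le> \<bar>c x * c y\<bar> * \<bar>expectation (\<lambda>\<omega>. Z x \<omega> * Z y \<omega>)\<bar>"
      by (metis abs_ge_self abs_mult)
    also have "\<dots> \<le> \<bar>c x * c y\<bar> * (if sm x y then ?\<kappa> ^ (p + q) else 0)"
    proof (cases "c x = 0")
      case False
      then show ?thesis using ZZ_le[OF xy(1) _ xy(2)] by (intro mult_left_mono) auto
    qed simp
    also have "\<dots> \<le> (((c x)\<^sup>2 + (c y)\<^sup>2) / 2) * (if sm x y then ?\<kappa> ^ (p + q) else 0)"
    proof (rule mult_right_mono)
      show "\<bar>c x * c y\<bar> \<le> ((c x)\<^sup>2 + (c y)\<^sup>2) / 2"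
        using sum_squares_bound[of "\<bar>c x\<bar>" "\<bar>c y\<bar>"] by (simp add: abs_mult)
    qed (use \<kappa> in auto)
    also have "\<dots> = ?\<kappa> ^ (p + q) / 2 * (of_bool (sm x y) * (c x)\<^sup>2 + of_bool (sm y x) * (c y)\<^sup>2)"
      by (simp add: sym)
    finally show "c x * c y * expectation (\<lambda>\<omega>. Z x \<omega> * Z y \<omega>) \<le> ?\<kappa> ^ (p + q) / 2 * (of_bool (sm x y) * (c x)\<^sup>2 + of_bool (sm y x) * (c y)\<^sup>2)" .
  qed
  also have "\<dots> = ?\<kappa> ^ (p + q) * (\<Sum>x\<in>?D. \<Sum>y\<in>?D. of_bool (sm x y) * (c x)\<^sup>2)"
  proof -
    have "(\<Sum>x\<in>?D. \<Sum>y\<in>?D. of_bool (sm y x) * (c y)\<^sup>2) = (\<Sum>x\<in>?D. \<Sum>y\<in>?D. of_bool (sm x y) * (c x)\<^sup>2)"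
      by (rule sum.swap)
    then show ?thesis by (simp only: sum_distrib_left[symmetric] sum.distrib) simp
  qed
  also have "\<dots> = ?\<kappa> ^ (p + q) * (\<Sum>x\<in>?D. real (card {y \<in> ?D. sm x y}) * (c x)\<^sup>2)"
    using fin by (simp add: sum_distrib_right[symmetric] of_bool_def sum.If_cases Int_def)
  also have "\<dots> \<le> ?\<kappa> ^ (p + q) * (\<Sum>x\<in>?D. 4 ^ (p + q) * (c x)\<^sup>2)"
  proof (intro mult_left_mono sum_mono)
    fix x assume "x \<in> ?D"
    then show "real (card {y \<in> ?D. sm x y}) * (c x)\<^sup>2 \<le> 4 ^ (p + q) * (c x)\<^sup>2"
      using card_sm[of x] by (cases "c x = 0") (auto intro!: mult_right_mono)
  qed (use \<kappa> in simp)
  also have "\<dots> = (4 * ?\<kappa>) ^ (p + q) * (\<Sum>(A, B)\<in>?D. (gamma_coeff V a b A B)\<^sup>2)"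
    unfolding power_mult_distrib c_def case_prod_unfold sum_distrib_left[symmetric] by (simp only: mult_ac)
  also have "\<dots> \<le> (4 * ?\<kappa>) ^ (p + q) * ((real p)\<^sup>2 * (\<Sum>r = 1..p. if r = p \<and> r = q then 0 else contr V r a b))"
    using \<kappa> by (intro mult_left_mono sum_gamma_coeff_square_le[OF V(1) a b]) auto
  finally show ?thesis unfolding U .
qed

end

subsection \<open>Stein's method for characteristic functions\<close>

lemma mform_sum_coeff:
  "(\<Sum>j\<in>J. t j * mform V (a j) y) = mform V (\<lambda>A. \<Sum>j\<in>J. t j * a j A) y"
proof -
  have "(\<Sum>j\<in>J. t j * mform V (a j) y) = (\<Sum>j\<in>J. \<Sum>A\<in>Pow V. t j * a j A * (\<Prod>c\<in>A. y c))"
    by (simp add: mform_def sum_distrib_left mult.assoc)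
  also have "\<dots> = mform V (\<lambda>A. \<Sum>j\<in>J. t j * a j A) y"
    by (subst sum.swap) (simp add: mform_def sum_distrib_right)
  finally show ?thesis .
qed

lemma djoin_sum_coeff: "djoin (\<lambda>A. \<Sum>j\<in>J. t j * a j A) K = (\<lambda>A. \<Sum>j\<in>J. t j * djoin (a j) K A)"
  by (auto simp: djoin_def fun_eq_iff)

lemma iexp_minus_linear_le: "cmod (iexp x - 1 - \<i> * of_real x) \<le> x\<^sup>2 / 2"
  using iexp_approx1[of x 1] by (simp add: power2_eq_square numeral_2_eq_2 diff_diff_eq)

lemma norm_integral_le:
  fixes f :: "'a \<Rightarrow> 'b::{banach, second_countable_topology}"
  assumes "integrable M f" "integrable M g" "\<And>x. norm (f x) \<le> g x"
  shows "norm (integral\<^sup>L M f) \<le> integral\<^sup>L M g"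
  by (rule order_trans[OF integral_norm_bound integral_mono[OF integrable_norm[OF assms(1)] assms(2)]]) (rule assms(3))

lemma norm_iexp [simp]: "cmod (iexp x) = 1"
  by (simp add: norm_exp_i_times)

section \<open>The characteristic function along a ray as a function of a real parameter\<close>

context prob_space
begin

lemma integrable_mult_iexp:
  assumes "integrable M f" "g \<in> borel_measurable M"
  shows "integrable M (\<lambda>\<omega>. complex_of_real (f \<omega>) * iexp (g \<omega>))"
proof (rule Bochner_Integration.integrable_bound[OF assms(1)])
  show "(\<lambda>\<omega>. complex_of_real (f \<omega>) * iexp (g \<omega>)) \<in> borel_measurable M"
    using assms by (intro borel_measurable_times) auto
qed (auto simp: norm_mult)

text \<open>Differentiation under the expectation: the second-order Taylor bound for the exponential
  makes the remainder at most \<open>h^2\<close> times the second moment of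
  \<open>W\<close>.\<close>

lemma expectation_iexp_has_derivative:
  assumes W: "all_moments M W"
  shows "((\<lambda>s. expectation (\<lambda>\<omega>. iexp (s * W \<omega>))) has_vector_derivative
     (\<i> * expectation (\<lambda>\<omega>. of_real (W \<omega>) * iexp (s * W \<omega>)))) (at s within S)"
  unfolding has_vector_derivative_def
proof (rule has_derivative_at_withinI)
  have [measurable]: "W \<in> borel_measurable M" by (rule all_moments_measurable[OF W])
  have int: "integrable M (\<lambda>\<omega>. of_real (W \<omega>) * iexp (u * W \<omega>))" for u
    by (rule integrable_mult_iexp[OF all_moments_integrable[OF W]]) simp
  have int1: "integrable M (\<lambda>\<omega>. iexp (u * W \<omega>))" for u by (rule integrable_iexp) auto
  have int2: "integrable M (\<lambda>\<omega>. (W \<omega>)\<^sup>2)" using W by (intro all_moments_integrable all_moments_intros)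
  let ?\<psi> = "\<lambda>s. expectation (\<lambda>\<omega>. iexp (s * W \<omega>))"
  let ?d = "\<i> * expectation (\<lambda>\<omega>. of_real (W \<omega>) * iexp (s * W \<omega>))"
  let ?C = "expectation (\<lambda>\<omega>. (W \<omega>)\<^sup>2)"
  have bound: "norm (?\<psi> (s + h) - ?\<psi> s - h *\<^sub>R ?d) \<le> h\<^sup>2 * ?C" for h
  proof -
    have "?\<psi> (s + h) - ?\<psi> s - h *\<^sub>R ?d
      = expectation (\<lambda>\<omega>. iexp ((s + h) * W \<omega>) - iexp (s * W \<omega>) - of_real h * \<i> * (of_real (W \<omega>) * iexp (s * W \<omega>)))"
      using int[of s] int1[of s] int1[of "s + h"] by (simp add: scaleR_conv_of_real)
    also have "\<dots> = expectation (\<lambda>\<omega>. iexp (s * W \<omega>) * (iexp (h * W \<omega>) - 1 - \<i> * of_real (h * W \<omega>)))"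
      by (intro Bochner_Integration.integral_cong refl) (simp add: algebra_simps exp_add)
    also have "norm \<dots> \<le> expectation (\<lambda>\<omega>. h\<^sup>2 * (W \<omega>)\<^sup>2)"
    proof (rule norm_integral_le)
      show "integrable M (\<lambda>\<omega>. iexp (s * W \<omega>) * (iexp (h * W \<omega>) - 1 - \<i> * of_real (h * W \<omega>)))"
      proof (rule Bochner_Integration.integrable_bound)
        show "integrable M (\<lambda>\<omega>. h\<^sup>2 * (W \<omega>)\<^sup>2 / 2)" using int2 by simp
        show "AE \<omega> in M. norm (iexp (s * W \<omega>) * (iexp (h * W \<omega>) - 1 - \<i> * of_real (h * W \<omega>))) \<le> norm (h\<^sup>2 * (W \<omega>)\<^sup>2 / 2)"
        proof (intro AE_I2)
          fix \<omega>
          show "norm (iexp (s * W \<omega>) * (iexp (h * W \<omega>) - 1 - \<i> * of_real (h * W \<omega>))) \<le> norm (h\<^sup>2 * (W \<omega>)\<^sup>2 / 2)"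
            unfolding norm_mult norm_iexp using iexp_minus_linear_le[of "h * W \<omega>"] by (simp add: power_mult_distrib)
        qed
      qed simp
      show "norm (iexp (s * W \<omega>) * (iexp (h * W \<omega>) - 1 - \<i> * of_real (h * W \<omega>))) \<le> h\<^sup>2 * (W \<omega>)\<^sup>2" for \<omega>
      proof -
        have "0 \<le> h\<^sup>2 * (W \<omega>)\<^sup>2" by simp
        then show ?thesis
          unfolding norm_mult norm_iexp using iexp_minus_linear_le[of "h * W \<omega>"] by (simp only: power_mult_distrib)
      qed
    qed (use int2 in simp)
    finally show ?thesis by simp
  qed
  have C: "0 \<le> ?C" by simp
  show "(?\<psi> has_derivative (\<lambda>h. h *\<^sub>R ?d)) (at s)"
    unfolding has_derivative_at
  proof (intro conjI bounded_linear_scaleR_left)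
    show "(\<lambda>h. norm (?\<psi> (s + h) - ?\<psi> s - h *\<^sub>R ?d) / norm h) \<midarrow>0\<rightarrow> 0"
    proof (rule tendsto_sandwich[where f = "\<lambda>_. 0" and h = "\<lambda>h. \<bar>h\<bar> * ?C"])
      show "\<forall>\<^sub>F h in at 0. norm (?\<psi> (s + h) - ?\<psi> s - h *\<^sub>R ?d) / norm h \<le> \<bar>h\<bar> * ?C"
        unfolding eventually_at
      proof (intro exI[of _ 1] conjI ballI impI)
        fix h :: real assume "h \<noteq> 0 \<and> dist h 0 < 1"
        then have "0 < \<bar>h\<bar>" by simp
        then show "norm (?\<psi> (s + h) - ?\<psi> s - h *\<^sub>R ?d) / norm h \<le> \<bar>h\<bar> * ?C"
          using bound[of h] by (simp add: divide_le_eq power2_eq_square mult_ac abs_mult_self_eq flip: abs_mult)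
      qed simp
      show "(\<lambda>h. \<bar>h\<bar> * ?C) \<midarrow>0\<rightarrow> 0" by (auto intro!: tendsto_eq_intros)
    qed auto
  qed
qed

text \<open>If \<open>\<psi>' = - s v \<psi>\<close> up to an error \<open>e\<close>, then \<open>\<psi> s * exp (v s\<^sup>2 / 2)\<close> is nearly constant.\<close>

lemma characteristic_function_gaussian_bound:
  assumes W: "all_moments M W" and v: "0 \<le> v"
    and e: "\<And>s. 0 \<le> s \<Longrightarrow> s \<le> 1 \<Longrightarrow> cmod (\<i> * expectation (\<lambda>\<omega>. of_real (W \<omega>) * iexp (s * W \<omega>))
        + of_real (s * v) * expectation (\<lambda>\<omega>. iexp (s * W \<omega>))) \<le> e"
  shows "cmod (expectation (\<lambda>\<omega>. iexp (W \<omega>)) - of_real (exp (- v / 2))) \<le> e"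
proof -
  let ?\<psi> = "\<lambda>s. expectation (\<lambda>\<omega>. iexp (s * W \<omega>))"
  let ?d = "\<lambda>s. \<i> * expectation (\<lambda>\<omega>. of_real (W \<omega>) * iexp (s * W \<omega>))"
  define g where "g s = exp (v * s\<^sup>2 / 2) *\<^sub>R ?\<psi> s" for s
  have der: "(g has_vector_derivative (exp (v * s\<^sup>2 / 2) *\<^sub>R ?d s + (exp (v * s\<^sup>2 / 2) * (s * v)) *\<^sub>R ?\<psi> s)) (at s within {0..1})" for s
    unfolding g_def
    by (rule has_vector_derivative_scaleR expectation_iexp_has_derivative[OF W] | (auto intro!: derivative_eq_intros simp: field_simps)[])+
  \<comment> \<open>The derivative of \<open>g\<close> is the integrating factor, at most
    \<open>exp (v / 2)\<close> on the unit interval, times the quantity bounded by \<open>e\<close>.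
    The factor \<open>exp (v / 2)\<close> cancels at the end.\<close>
  have "norm (g 1 - g 0) \<le> (exp (v / 2) * e) * norm (1 - 0 :: real)"
  proof (rule differentiable_bound[where f' = "\<lambda>s h. h *\<^sub>R (exp (v * s\<^sup>2 / 2) *\<^sub>R ?d s + (exp (v * s\<^sup>2 / 2) * (s * v)) *\<^sub>R ?\<psi> s)"])
    show "(g has_derivative (\<lambda>h. h *\<^sub>R (exp (v * s\<^sup>2 / 2) *\<^sub>R ?d s + (exp (v * s\<^sup>2 / 2) * (s * v)) *\<^sub>R ?\<psi> s))) (at s within {0..1})" for s
      using der[of s] by (simp add: has_vector_derivative_def)
    fix s :: real assume s: "s \<in> {0..1}"
    have "exp (v * s\<^sup>2 / 2) *\<^sub>R ?d s + (exp (v * s\<^sup>2 / 2) * (s * v)) *\<^sub>R ?\<psi> s = exp (v * s\<^sup>2 / 2) *\<^sub>R (?d s + of_real (s * v) * ?\<psi> s)"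
      by (simp add: scaleR_conv_of_real algebra_simps)
    also have "norm \<dots> = exp (v * s\<^sup>2 / 2) * cmod (?d s + of_real (s * v) * ?\<psi> s)" by simp
    also have "\<dots> \<le> exp (v / 2) * e"
    proof (rule mult_mono)
      have "s\<^sup>2 \<le> 1" using s by (simp add: power_le_one)
      then show "exp (v * s\<^sup>2 / 2) \<le> exp (v / 2)" using v by (simp add: mult_left_le)
    qed (use e[of s] s in auto)
    finally have n: "norm (exp (v * s\<^sup>2 / 2) *\<^sub>R ?d s + (exp (v * s\<^sup>2 / 2) * (s * v)) *\<^sub>R ?\<psi> s) \<le> exp (v / 2) * e" .
    show "onorm (\<lambda>h. h *\<^sub>R (exp (v * s\<^sup>2 / 2) *\<^sub>R ?d s + (exp (v * s\<^sup>2 / 2) * (s * v)) *\<^sub>R ?\<psi> s)) \<le> exp (v / 2) * e"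
      by (rule onorm_le) (use mult_left_mono[OF n abs_ge_zero] in \<open>simp add: mult.commute\<close>)
  qed auto
  also have "g 1 - g 0 = exp (v / 2) *\<^sub>R (?\<psi> 1 - of_real (exp (- v / 2)))"
    by (simp add: g_def prob_space scaleR_conv_of_real algebra_simps flip: of_real_mult exp_add)
  finally have "exp (v / 2) * cmod (?\<psi> 1 - of_real (exp (- v / 2))) \<le> exp (v / 2) * e" by simp
  then show ?thesis by simp
qed

end

section \<open>Integration by parts for forms and its remainder\<close>

context poisson_family
begin

text \<open>Neither \<open>G\<close> nor \<open>D\<close> depends on \<open>X i\<close>, so adding a
  point shifts the exponent by \<open>s * \<theta> i * D\<close>. Because
  \<open>sqrt (lam i) * \<theta> i = 1\<close>, the first-order term of the exponential becomes
  \<open>i s G D\<close>, with the imaginary unit in front, while the second-order remainder keeps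
  one factor \<open>\<theta> i\<close>.\<close>

lemma stein_mform:
  fixes w g :: "'i set \<Rightarrow> real"
  assumes V: "finite V" "V \<subseteq> I" and i: "i \<in> V"
  defines "W \<equiv> \<lambda>\<omega>. mform V w (\<lambda>c. X c \<omega>)" and "D \<equiv> \<lambda>\<omega>. mform V (djoin w {i}) (\<lambda>c. X c \<omega>)"
    and "G \<equiv> \<lambda>\<omega>. mform V (djoin g {i}) (\<lambda>c. X c \<omega>)"
  shows "cmod (expectation (\<lambda>\<omega>. of_real (X i \<omega> * G \<omega>) * iexp (s * W \<omega>))
      - \<i> * of_real s * expectation (\<lambda>\<omega>. of_real (G \<omega> * D \<omega>) * iexp (s * W \<omega>)))
    \<le> s\<^sup>2 / 2 * (\<theta> i * expectation (\<lambda>\<omega>. \<bar>G \<omega>\<bar> * (D \<omega>)\<^sup>2))"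
proof -
  let ?V = "V - {i}"
  have iI: "i \<in> I" using i V by auto
  have sub: "?V \<subseteq> I" "i \<notin> ?V" using V by auto
  define h where "h y = mform ?V w y" for y
  define d where "d y = mform ?V (\<lambda>A. w (insert i A)) y" for y
  define k where "k y = mform ?V (\<lambda>A. g (insert i A)) y" for y
  define \<Phi> where "\<Phi> x y = complex_of_real (k y) * iexp (s * (h y + x * d y))" for x y
  let ?Y = "\<lambda>\<omega>. \<lambda>c\<in>?V. X c \<omega>"
  have res: "mform ?V c (?Y \<omega>) = mform ?V c (\<lambda>c. X c \<omega>)" for c \<omega>
    by (intro mform_cong) auto
  have eq: "D \<omega> = d (?Y \<omega>)" "G \<omega> = k (?Y \<omega>)" "W \<omega> = h (?Y \<omega>) + X i \<omega> * d (?Y \<omega>)" for \<omega>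
    using mform_split[OF V(1) i, of w "\<lambda>c. X c \<omega>"]
    by (simp_all add: D_def G_def W_def d_def k_def h_def res mform_djoin_Diff[OF V(1) i])
  have am [all_moments_intros]: "all_moments M D" "all_moments M G" "all_moments M W" "all_moments M (X i)"
    unfolding D_def G_def W_def using V iI by (intro all_moments_intros; simp)+
  note [measurable] = all_moments_measurable[OF am(1)] all_moments_measurable[OF am(2)] all_moments_measurable[OF am(3)]
  have [measurable]: "h \<in> borel_measurable (PiM ?V (\<lambda>_. borel))" "d \<in> borel_measurable (PiM ?V (\<lambda>_. borel))"
    "k \<in> borel_measurable (PiM ?V (\<lambda>_. borel))"
    unfolding h_def[abs_def] d_def[abs_def] k_def[abs_def] by (intro borel_measurable_mform; simp)+
  have \<Phi>meas: "(\<lambda>(x, y). \<Phi> x y) \<in> borel_measurable (borel \<Otimes>\<^sub>M PiM ?V (\<lambda>_. borel))"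
    unfolding \<Phi>_def by measurable
  have \<Phi>X: "\<Phi> (X i \<omega>) (?Y \<omega>) = of_real (G \<omega>) * iexp (s * W \<omega>)" for \<omega>
    by (simp add: \<Phi>_def eq)
  have \<Phi>X': "\<Phi> (X i \<omega> + \<theta> i) (?Y \<omega>) = of_real (G \<omega>) * iexp (s * W \<omega> + s * \<theta> i * D \<omega>)" for \<omega>
    by (simp add: \<Phi>_def eq algebra_simps)
  have \<Phi>X1: "X i \<omega> *\<^sub>R (complex_of_real (G \<omega>) * iexp (s * W \<omega>)) = of_real (X i \<omega> * G \<omega>) * iexp (s * W \<omega>)" for \<omega>
    by (simp add: scaleR_conv_of_real mult.assoc)
  have i1: "integrable M (\<lambda>\<omega>. of_real (X i \<omega> * G \<omega>) * iexp (s * W \<omega>))"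
    and i2: "integrable M (\<lambda>\<omega>. of_real (G \<omega>) * iexp (s * W \<omega>))"
    and i3: "integrable M (\<lambda>\<omega>. of_real (G \<omega>) * iexp (s * W \<omega> + s * \<theta> i * D \<omega>))"
    and i4: "integrable M (\<lambda>\<omega>. of_real (G \<omega> * D \<omega>) * iexp (s * W \<omega>))"
    by (intro integrable_mult_iexp all_moments_integrable all_moments_intros; measurable)+
  have st: "expectation (\<lambda>\<omega>. of_real (X i \<omega> * G \<omega>) * iexp (s * W \<omega>))
    = sqrt (lam i) *\<^sub>R (expectation (\<lambda>\<omega>. of_real (G \<omega>) * iexp (s * W \<omega> + s * \<theta> i * D \<omega>)) - expectation (\<lambda>\<omega>. of_real (G \<omega>) * iexp (s * W \<omega>)))"
    using stein_identity[OF iI sub \<Phi>meas] i1 i2 i3 unfolding \<Phi>X \<Phi>X' \<Phi>X1 by blast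
  have l: "sqrt (lam i) * \<theta> i = 1" "0 < sqrt (lam i)" using lam_pos[OF iI] by (auto simp: \<theta>_def)
  let ?r = "\<lambda>\<omega>. of_real (sqrt (lam i) * G \<omega>) * iexp (s * W \<omega>) * (iexp (s * \<theta> i * D \<omega>) - 1 - \<i> * of_real (s * \<theta> i * D \<omega>))"
  have r: "?r \<omega> = sqrt (lam i) *\<^sub>R (of_real (G \<omega>) * iexp (s * W \<omega> + s * \<theta> i * D \<omega>) - of_real (G \<omega>) * iexp (s * W \<omega>))
     - \<i> * of_real s * (of_real (G \<omega> * D \<omega>) * iexp (s * W \<omega>))" for \<omega>
  proof -
    have "complex_of_real (sqrt (lam i)) * of_real (\<theta> i) = 1" using l(1) by (simp flip: of_real_mult)
    then show ?thesis by (simp add: scaleR_conv_of_real algebra_simps exp_add)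
  qed
  have "expectation (\<lambda>\<omega>. of_real (X i \<omega> * G \<omega>) * iexp (s * W \<omega>)) - \<i> * of_real s * expectation (\<lambda>\<omega>. of_real (G \<omega> * D \<omega>) * iexp (s * W \<omega>))
    = expectation ?r"
    unfolding st r using i2 i3 i4 by simp
  also have "cmod \<dots> \<le> expectation (\<lambda>\<omega>. s\<^sup>2 / 2 * (\<theta> i * (\<bar>G \<omega>\<bar> * (D \<omega>)\<^sup>2)))"
  proof (rule norm_integral_le)
    show "integrable M ?r" unfolding r using i2 i3 i4 by simp
    show "integrable M (\<lambda>\<omega>. s\<^sup>2 / 2 * (\<theta> i * (\<bar>G \<omega>\<bar> * (D \<omega>)\<^sup>2)))"
      by (intro all_moments_integrable all_moments_intros)
    show "cmod (?r \<omega>) \<le> s\<^sup>2 / 2 * (\<theta> i * (\<bar>G \<omega>\<bar> * (D \<omega>)\<^sup>2))" for \<omega>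
    proof -
      have "cmod (?r \<omega>) = (sqrt (lam i) * \<bar>G \<omega>\<bar>) * cmod (iexp (s * \<theta> i * D \<omega>) - 1 - \<i> * of_real (s * \<theta> i * D \<omega>))"
        using l(2) by (simp only: norm_mult norm_iexp mult_1_right norm_of_real abs_mult abs_of_pos)
      also have "\<dots> \<le> (sqrt (lam i) * \<bar>G \<omega>\<bar>) * ((s * \<theta> i * D \<omega>)\<^sup>2 / 2)"
        using l(2) by (intro mult_left_mono iexp_minus_linear_le) auto
      also have "\<dots> = s\<^sup>2 / 2 * ((sqrt (lam i) * \<theta> i) * \<theta> i * (\<bar>G \<omega>\<bar> * (D \<omega>)\<^sup>2))"
        by (simp add: power_mult_distrib power2_eq_square)
      finally show ?thesis by (simp add: l)
    qed
  qed
  finally show ?thesis by simp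
qed

end

text \<open>A set of size \<open>p\<close> is split off one point in \<open>p\<close> ways. The sum
  is the total influence of all variables.\<close>

lemma sum_djoin_singleton_square:
  assumes V: "finite V" and a: "\<And>A. a A \<noteq> 0 \<Longrightarrow> card A = p"
  shows "(\<Sum>i\<in>V. \<Sum>A\<in>Pow V. (djoin a {i} A)\<^sup>2) = p * (\<Sum>A\<in>Pow V. (a A)\<^sup>2)"
proof -
  have "(\<Sum>A\<in>Pow V. (djoin a {i} A)\<^sup>2) = (\<Sum>A\<in>Pow V. of_bool (i \<in> A) * (a A)\<^sup>2)" if "i \<in> V" for i
  proof -
    let ?V = "V - {i}"
    have "(\<Sum>A\<in>Pow ?V. (djoin a {i} A)\<^sup>2) = (\<Sum>A\<in>Pow ?V. (a (insert i A))\<^sup>2)"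
      by (intro sum.cong refl) (auto simp: djoin_def)
    moreover have "(\<Sum>A\<in>Pow ?V. of_bool (i \<in> A) * (a A)\<^sup>2) = 0" by (intro sum.neutral) auto
    moreover have "djoin a {i} (insert i A) = 0" for A by (simp add: djoin_def)
    ultimately have "(\<Sum>A\<in>Pow (insert i ?V). (djoin a {i} A)\<^sup>2) = (\<Sum>A\<in>Pow (insert i ?V). of_bool (i \<in> A) * (a A)\<^sup>2)"
      using V sum_Pow_insert[of ?V i "\<lambda>A. (djoin a {i} A)\<^sup>2"] sum_Pow_insert[of ?V i "\<lambda>A. of_bool (i \<in> A) * (a A)\<^sup>2"]
      by simp
    then show ?thesis using that by (simp add: insert_absorb)
  qed
  then have "(\<Sum>i\<in>V. \<Sum>A\<in>Pow V. (djoin a {i} A)\<^sup>2) = (\<Sum>i\<in>V. \<Sum>A\<in>Pow V. of_bool (i \<in> A) * (a A)\<^sup>2)" by simp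
  also have "\<dots> = (\<Sum>A\<in>Pow V. \<Sum>i\<in>V. of_bool (i \<in> A) * (a A)\<^sup>2)" by (rule sum.swap)
  also have "\<dots> = (\<Sum>A\<in>Pow V. p * (a A)\<^sup>2)"
  proof (intro sum.cong refl)
    fix A assume "A \<in> Pow V"
    then have "(\<Sum>i\<in>V. of_bool (i \<in> A) * (a A)\<^sup>2) = card A * (a A)\<^sup>2"
      using V by (simp add: sum_distrib_right[symmetric] of_bool_def sum.If_cases Int_absorb1)
    then show "(\<Sum>i\<in>V. of_bool (i \<in> A) * (a A)\<^sup>2) = p * (a A)\<^sup>2"
      using a[of A] by (cases "a A = 0") auto
  qed
  finally show ?thesis unfolding sum_distrib_left .
qed

text \<open>Every summand is at most the largest one, whose cube is among the terms on the
  right.\<close>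

lemma cube_sum_le:
  fixes x :: "'a \<Rightarrow> real"
  assumes "finite J" "\<And>j. j \<in> J \<Longrightarrow> 0 \<le> x j"
  shows "(\<Sum>j\<in>J. x j) ^ 3 \<le> real (card J) ^ 3 * (\<Sum>j\<in>J. x j ^ 3)"
proof (cases "J = {}")
  case False
  then have "Max (x ` J) \<in> x ` J" using assms(1) by (intro Max_in) auto
  then obtain m where "m \<in> J" "x m = Max (x ` J)" by (elim imageE) simp
  then have m: "m \<in> J" "\<And>j. j \<in> J \<Longrightarrow> x j \<le> x m" using assms(1) by auto
  have "(\<Sum>j\<in>J. x j) \<le> card J * x m" using sum_bounded_above[of J x "x m"] m by simp
  then have "(\<Sum>j\<in>J. x j) ^ 3 \<le> (card J * x m) ^ 3" using assms by (intro power_mono sum_nonneg) auto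
  also have "\<dots> \<le> real (card J) ^ 3 * (\<Sum>j\<in>J. x j ^ 3)"
    unfolding power_mult_distrib using m assms by (intro mult_left_mono member_le_sum) auto
  finally show ?thesis .
qed simp

text \<open>Young's inequality with a free parameter. It trades a third absolute moment for a small
  multiple of a bounded second moment plus a large multiple of a fourth moment that tends to
  zero.\<close>

lemma cube_le_square_plus_fourth:
  fixes x t \<delta> :: real assumes "0 \<le> x" "0 < \<delta>"
  shows "t * x ^ 3 \<le> \<delta> * x\<^sup>2 + (1 / \<delta>) * (t\<^sup>2 * x ^ 4)"
proof -
  have "\<delta> * (t * x) \<le> \<delta>\<^sup>2 + (t * x)\<^sup>2"
    using sum_squares_bound[of \<delta> "t * x"] sum_squares_bound[of \<delta> "- (t * x)"] zero_le_power2[of \<delta>] zero_le_power2[of "t * x"]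
    by simp
  then have "x\<^sup>2 * (\<delta> * (t * x)) \<le> x\<^sup>2 * (\<delta>\<^sup>2 + (t * x)\<^sup>2)" by (intro mult_left_mono) auto
  then have "\<delta> * (t * x ^ 3) \<le> \<delta> * (\<delta> * x\<^sup>2 + (1 / \<delta>) * (t\<^sup>2 * x ^ 4))"
    using assms(2) by (simp add: algebra_simps power2_eq_square power3_eq_cube power4_eq_xxxx)
  then show ?thesis using assms(2) by simp
qed

lemma (in prob_space) expectation_abs_le_sqrt:
  assumes "all_moments M f" shows "expectation (\<lambda>\<omega>. \<bar>f \<omega>\<bar>) \<le> sqrt (expectation (\<lambda>\<omega>. (f \<omega>)\<^sup>2))"
  using expectation_square_mult_le[OF all_moments_abs[OF assms] all_moments_const[of 1]]
  by (simp add: prob_space real_le_rsqrt)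

context poisson_family
begin

text \<open>Euler's identity with the weights \<open>c j = t j / p j\<close> writes \<open>W\<close>
  as a combination of \<open>X i * G j i\<close>, and integration by parts turns this into the
  combination of the \<open>U j k\<close> with weights \<open>c j * t k\<close>. The first sum of
  the bound measures how far these are from the constants adding up to \<open>v\<close>, the second
  is the remainder. The parameter \<delta> is chosen only when a limit is taken.\<close>

lemma expectation_iexp_linear_combination_le:
  fixes t :: "'d \<Rightarrow> real" and C :: "'d \<Rightarrow> 'd \<Rightarrow> real"
  assumes V: "finite V" "V \<subseteq> I" and J: "finite J"
    and a: "\<And>j A. j \<in> J \<Longrightarrow> a j A \<noteq> 0 \<Longrightarrow> card A = p j" and p: "\<And>j. j \<in> J \<Longrightarrow> 1 \<le> p j"
    and v: "v = (\<Sum>j\<in>J. \<Sum>k\<in>J. t j * t k * C j k)" "0 \<le> v" and \<delta>: "0 < \<delta>"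
  defines "var \<equiv> \<lambda>j k. (4 * (3 + 1 / \<alpha>)) ^ (p j + p k) *
      ((real (p j))\<^sup>2 * (\<Sum>r = 1..p j. if r = p j \<and> r = p k then 0 else contr V r (a j) (a k)))"
  shows "cmod (expectation (\<lambda>\<omega>. iexp (\<Sum>j\<in>J. t j * mform V (a j) (\<lambda>c. X c \<omega>))) - of_real (exp (- v / 2)))
    \<le> (\<Sum>j\<in>J. \<Sum>k\<in>J. \<bar>t j / p j * t k\<bar> * (sqrt (var j k) + p j * \<bar>(\<Sum>A\<in>Pow V. a j A * a k A) - C j k\<bar>))
     + (\<Sum>j\<in>J. \<bar>t j / p j\<bar> * ((1 + (\<Sum>k\<in>J. \<bar>t k\<bar>))\<^sup>2 * real (card J) ^ 3 *
         (\<Sum>k\<in>J. \<delta> * (p k * (\<Sum>A\<in>Pow V. (a k A)\<^sup>2)) +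
           (1 / \<delta>) * (\<Sum>i\<in>V. (\<theta> i)\<^sup>2 * expectation (\<lambda>\<omega>. mform V (djoin (a k) {i}) (\<lambda>c. X c \<omega>) ^ 4)))))"
    (is "_ \<le> ?E1 + ?E2")
proof -
  define w where "w A = (\<Sum>j\<in>J. t j * a j A)" for A
  define W where "W \<omega> = mform V w (\<lambda>c. X c \<omega>)" for \<omega>
  define D where "D i \<omega> = mform V (djoin w {i}) (\<lambda>c. X c \<omega>)" for i \<omega>
  define G where "G j i \<omega> = mform V (djoin (a j) {i}) (\<lambda>c. X c \<omega>)" for j i \<omega>
  define F where "F j \<omega> = mform V (a j) (\<lambda>c. X c \<omega>)" for j \<omega>
  define U where "U j k \<omega> = (\<Sum>i\<in>V. G j i \<omega> * G k i \<omega>)" for j k \<omega>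
  define B where "B = 1 + (\<Sum>k\<in>J. \<bar>t k\<bar>)"
  define c where "c j = t j / p j" for j
  have W: "W \<omega> = (\<Sum>j\<in>J. t j * F j \<omega>)" for \<omega>
    unfolding W_def w_def F_def by (simp add: mform_sum_coeff)
  have D: "D i \<omega> = (\<Sum>j\<in>J. t j * G j i \<omega>)" for i \<omega>
    unfolding D_def w_def G_def djoin_sum_coeff by (simp add: mform_sum_coeff)
  have am [all_moments_intros]: "all_moments M W" "\<And>i. all_moments M (D i)" "\<And>j i. all_moments M (G j i)" "\<And>j. all_moments M (F j)"
    "\<And>i. i \<in> V \<Longrightarrow> all_moments M (X i)" "\<And>j k. all_moments M (U j k)"
    unfolding W_def D_def G_def F_def U_def using V by (intro all_moments_intros; auto)+
  note [measurable] = all_moments_measurable[OF am(1)]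
  have cp: "c j * p j = t j" if "j \<in> J" for j using p[OF that] by (simp add: c_def)
  have F: "F j \<omega> = (1 / p j) * (\<Sum>i\<in>V. X i \<omega> * G j i \<omega>)" if "j \<in> J" for j \<omega>
    using sum_mult_mform_djoin[OF V(1), of "a j" "p j" "\<lambda>c. X c \<omega>"] a[OF that] p[OF that]
    by (simp add: F_def G_def)
  have WX: "W \<omega> = (\<Sum>j\<in>J. c j * (\<Sum>i\<in>V. X i \<omega> * G j i \<omega>))" for \<omega>
    unfolding W using F by (intro sum.cong) (simp_all add: c_def)
  have DU: "(\<Sum>j\<in>J. c j * (\<Sum>i\<in>V. G j i \<omega> * D i \<omega>)) = (\<Sum>j\<in>J. \<Sum>k\<in>J. c j * t k * U j k \<omega>)" for \<omega>
  proof (intro sum.cong refl)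
    fix j
    have "(\<Sum>i\<in>V. G j i \<omega> * D i \<omega>) = (\<Sum>i\<in>V. \<Sum>k\<in>J. t k * (G j i \<omega> * G k i \<omega>))"
      by (simp add: D sum_distrib_left mult_ac)
    also have "\<dots> = (\<Sum>k\<in>J. t k * U j k \<omega>)"
      by (subst sum.swap) (simp add: U_def sum_distrib_left)
    finally show "c j * (\<Sum>i\<in>V. G j i \<omega> * D i \<omega>) = (\<Sum>k\<in>J. c j * t k * U j k \<omega>)"
      by (simp add: sum_distrib_left mult.assoc)
  qed
  have vc: "v = (\<Sum>j\<in>J. \<Sum>k\<in>J. c j * t k * (p j * C j k))"
    unfolding v(1) by (intro sum.cong refl) (simp add: cp[symmetric])
  have U_bound: "expectation (\<lambda>\<omega>. \<bar>U j k \<omega> - p j * C j k\<bar>) \<le> sqrt (var j k) + p j * \<bar>(\<Sum>A\<in>Pow V. a j A * a k A) - C j k\<bar>"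
    if j: "j \<in> J" and k: "k \<in> J" for j k
  proof -
    let ?m = "\<Sum>A\<in>Pow V. a j A * a k A"
    have "expectation (\<lambda>\<omega>. \<bar>U j k \<omega> - p j * C j k\<bar>) \<le> expectation (\<lambda>\<omega>. \<bar>U j k \<omega> - p j * ?m\<bar> + p j * \<bar>?m - C j k\<bar>)"
    proof (rule integral_mono)
      show "\<bar>U j k \<omega> - p j * C j k\<bar> \<le> \<bar>U j k \<omega> - p j * ?m\<bar> + p j * \<bar>?m - C j k\<bar>" for \<omega>
      proof -
        have "\<bar>U j k \<omega> - p j * C j k\<bar> = \<bar>(U j k \<omega> - p j * ?m) + p j * (?m - C j k)\<bar>" by (simp add: algebra_simps)
        also have "\<dots> \<le> \<bar>U j k \<omega> - p j * ?m\<bar> + p j * \<bar>?m - C j k\<bar>" by (rule order_trans[OF abs_triangle_ineq]) (simp add: abs_mult)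
        finally show ?thesis .
      qed
    qed (intro all_moments_integrable all_moments_intros)+
    also have "\<dots> = expectation (\<lambda>\<omega>. \<bar>U j k \<omega> - p j * ?m\<bar>) + p j * \<bar>?m - C j k\<bar>"
    proof -
      have "integrable M (\<lambda>\<omega>. \<bar>U j k \<omega> - p j * ?m\<bar>)" by (intro all_moments_integrable all_moments_intros)
      then show ?thesis by (simp add: prob_space)
    qed
    also have "expectation (\<lambda>\<omega>. \<bar>U j k \<omega> - p j * ?m\<bar>) \<le> sqrt (expectation (\<lambda>\<omega>. (U j k \<omega> - p j * ?m)\<^sup>2))"
      by (intro expectation_abs_le_sqrt all_moments_intros)
    also have "expectation (\<lambda>\<omega>. (U j k \<omega> - p j * ?m)\<^sup>2) \<le> var j k"
      unfolding var_def U_def G_def by (rule variance_gamma_le[OF V]) (use a j k in auto)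
    finally show ?thesis by simp
  qed
  have D_abs: "\<bar>D i \<omega>\<bar> \<le> B * (\<Sum>k\<in>J. \<bar>G k i \<omega>\<bar>)" for i \<omega>
  proof -
    have "\<bar>D i \<omega>\<bar> \<le> (\<Sum>k\<in>J. \<bar>t k\<bar> * \<bar>G k i \<omega>\<bar>)"
      unfolding D by (rule order_trans[OF sum_abs]) (simp add: abs_mult)
    also have "\<dots> \<le> (\<Sum>k\<in>J. B * \<bar>G k i \<omega>\<bar>)"
    proof (intro sum_mono mult_right_mono)
      fix k assume "k \<in> J"
      then have "\<bar>t k\<bar> \<le> (\<Sum>k\<in>J. \<bar>t k\<bar>)" using J by (intro member_le_sum) auto
      then show "\<bar>t k\<bar> \<le> B" by (simp add: B_def)
    qed auto
    finally show ?thesis by (simp add: sum_distrib_left)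
  qed
  have GD: "\<theta> i * (\<bar>G j i \<omega>\<bar> * (D i \<omega>)\<^sup>2) \<le> B\<^sup>2 * real (card J) ^ 3 *
      (\<Sum>k\<in>J. \<delta> * (G k i \<omega>)\<^sup>2 + (1 / \<delta>) * ((\<theta> i)\<^sup>2 * G k i \<omega> ^ 4))" if "j \<in> J" "i \<in> V" for i j \<omega>
  proof -
    let ?S = "\<Sum>k\<in>J. \<bar>G k i \<omega>\<bar>"
    have \<theta>: "0 \<le> \<theta> i" using \<theta>_pos[of i] that V by auto
    have "\<bar>G j i \<omega>\<bar> * (D i \<omega>)\<^sup>2 \<le> ?S * (B * ?S)\<^sup>2"
    proof (rule mult_mono)
      show "\<bar>G j i \<omega>\<bar> \<le> ?S" using that J by (intro member_le_sum) auto
      show "(D i \<omega>)\<^sup>2 \<le> (B * ?S)\<^sup>2" using power_mono[OF D_abs[of i \<omega>] abs_ge_zero, of 2] by simp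
    qed (auto intro: sum_nonneg)
    also have "\<dots> = B\<^sup>2 * ?S ^ 3" by (simp add: power_mult_distrib power2_eq_square power3_eq_cube)
    also have "\<dots> \<le> B\<^sup>2 * (real (card J) ^ 3 * (\<Sum>k\<in>J. \<bar>G k i \<omega>\<bar> ^ 3))"
      using J by (intro mult_left_mono cube_sum_le) auto
    finally have "\<theta> i * (\<bar>G j i \<omega>\<bar> * (D i \<omega>)\<^sup>2) \<le> \<theta> i * (B\<^sup>2 * (real (card J) ^ 3 * (\<Sum>k\<in>J. \<bar>G k i \<omega>\<bar> ^ 3)))"
      using \<theta> by (rule mult_left_mono)
    also have "\<dots> = B\<^sup>2 * real (card J) ^ 3 * (\<Sum>k\<in>J. \<theta> i * \<bar>G k i \<omega>\<bar> ^ 3)"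
      by (simp add: sum_distrib_left mult_ac)
    also have "\<dots> \<le> B\<^sup>2 * real (card J) ^ 3 * (\<Sum>k\<in>J. \<delta> * (G k i \<omega>)\<^sup>2 + (1 / \<delta>) * ((\<theta> i)\<^sup>2 * G k i \<omega> ^ 4))"
    proof (intro mult_left_mono sum_mono)
      fix k
      have "\<bar>G k i \<omega>\<bar> ^ 4 = G k i \<omega> ^ 4" by (simp add: power_even_abs)
      then show "\<theta> i * \<bar>G k i \<omega>\<bar> ^ 3 \<le> \<delta> * (G k i \<omega>)\<^sup>2 + (1 / \<delta>) * ((\<theta> i)\<^sup>2 * G k i \<omega> ^ 4)"
        using cube_le_square_plus_fourth[OF abs_ge_zero \<delta>, of "\<theta> i" "G k i \<omega>"] by simp
    qed simp
    finally show ?thesis .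
  qed
  have EGD: "(\<Sum>i\<in>V. \<theta> i * expectation (\<lambda>\<omega>. \<bar>G j i \<omega>\<bar> * (D i \<omega>)\<^sup>2)) \<le> B\<^sup>2 * real (card J) ^ 3 *
      (\<Sum>k\<in>J. \<delta> * (p k * (\<Sum>A\<in>Pow V. (a k A)\<^sup>2)) + (1 / \<delta>) * (\<Sum>i\<in>V. (\<theta> i)\<^sup>2 * expectation (\<lambda>\<omega>. G k i \<omega> ^ 4)))"
    if j: "j \<in> J" for j
  proof -
    have "(\<Sum>i\<in>V. \<theta> i * expectation (\<lambda>\<omega>. \<bar>G j i \<omega>\<bar> * (D i \<omega>)\<^sup>2))
      \<le> (\<Sum>i\<in>V. B\<^sup>2 * real (card J) ^ 3 * (\<Sum>k\<in>J. \<delta> * expectation (\<lambda>\<omega>. (G k i \<omega>)\<^sup>2) + (1 / \<delta>) * ((\<theta> i)\<^sup>2 * expectation (\<lambda>\<omega>. G k i \<omega> ^ 4))))"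
    proof (rule sum_mono)
      fix i assume i: "i \<in> V"
      have "\<theta> i * expectation (\<lambda>\<omega>. \<bar>G j i \<omega>\<bar> * (D i \<omega>)\<^sup>2) = expectation (\<lambda>\<omega>. \<theta> i * (\<bar>G j i \<omega>\<bar> * (D i \<omega>)\<^sup>2))" by simp
      also have "\<dots> \<le> expectation (\<lambda>\<omega>. B\<^sup>2 * real (card J) ^ 3 * (\<Sum>k\<in>J. \<delta> * (G k i \<omega>)\<^sup>2 + (1 / \<delta>) * ((\<theta> i)\<^sup>2 * G k i \<omega> ^ 4)))"
        by (intro integral_mono GD j i all_moments_integrable all_moments_intros)
      also have "\<dots> = B\<^sup>2 * real (card J) ^ 3 * (\<Sum>k\<in>J. \<delta> * expectation (\<lambda>\<omega>. (G k i \<omega>)\<^sup>2) + (1 / \<delta>) * ((\<theta> i)\<^sup>2 * expectation (\<lambda>\<omega>. G k i \<omega> ^ 4)))"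
      proof -
        have "integrable M (\<lambda>\<omega>. (G k i \<omega>)\<^sup>2)" "integrable M (\<lambda>\<omega>. G k i \<omega> ^ 4)" for k
          by (intro all_moments_integrable all_moments_intros)+
        then show ?thesis by simp
      qed
      finally show "\<theta> i * expectation (\<lambda>\<omega>. \<bar>G j i \<omega>\<bar> * (D i \<omega>)\<^sup>2) \<le> \<dots>" .
    qed
    also have "\<dots> = B\<^sup>2 * real (card J) ^ 3 * (\<Sum>k\<in>J. \<Sum>i\<in>V. \<delta> * expectation (\<lambda>\<omega>. (G k i \<omega>)\<^sup>2) + (1 / \<delta>) * ((\<theta> i)\<^sup>2 * expectation (\<lambda>\<omega>. G k i \<omega> ^ 4)))"
      unfolding sum_distrib_left[symmetric] by (subst sum.swap) (rule refl)
    also have "(\<Sum>k\<in>J. \<Sum>i\<in>V. \<delta> * expectation (\<lambda>\<omega>. (G k i \<omega>)\<^sup>2) + (1 / \<delta>) * ((\<theta> i)\<^sup>2 * expectation (\<lambda>\<omega>. G k i \<omega> ^ 4)))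
      = (\<Sum>k\<in>J. \<delta> * (p k * (\<Sum>A\<in>Pow V. (a k A)\<^sup>2)) + (1 / \<delta>) * (\<Sum>i\<in>V. (\<theta> i)\<^sup>2 * expectation (\<lambda>\<omega>. G k i \<omega> ^ 4)))"
    proof (intro sum.cong refl)
      fix k assume k: "k \<in> J"
      have "(\<Sum>i\<in>V. expectation (\<lambda>\<omega>. (G k i \<omega>)\<^sup>2)) = p k * (\<Sum>A\<in>Pow V. (a k A)\<^sup>2)"
        unfolding G_def expectation_mform_square[OF V] by (rule sum_djoin_singleton_square[OF V(1)]) (use a k in auto)
      then show "(\<Sum>i\<in>V. \<delta> * expectation (\<lambda>\<omega>. (G k i \<omega>)\<^sup>2) + (1 / \<delta>) * ((\<theta> i)\<^sup>2 * expectation (\<lambda>\<omega>. G k i \<omega> ^ 4)))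
        = \<delta> * (p k * (\<Sum>A\<in>Pow V. (a k A)\<^sup>2)) + (1 / \<delta>) * (\<Sum>i\<in>V. (\<theta> i)\<^sup>2 * expectation (\<lambda>\<omega>. G k i \<omega> ^ 4))"
        by (simp only: sum.distrib sum_distrib_left[symmetric])
    qed
    finally show ?thesis .
  qed
  have E2: "?E2 = (\<Sum>j\<in>J. \<bar>c j\<bar> * (B\<^sup>2 * real (card J) ^ 3 *
      (\<Sum>k\<in>J. \<delta> * (p k * (\<Sum>A\<in>Pow V. (a k A)\<^sup>2)) + (1 / \<delta>) * (\<Sum>i\<in>V. (\<theta> i)\<^sup>2 * expectation (\<lambda>\<omega>. G k i \<omega> ^ 4)))))"
    by (simp add: c_def B_def G_def)
  have "cmod (\<i> * expectation (\<lambda>\<omega>. of_real (W \<omega>) * iexp (s * W \<omega>)) + of_real (s * v) * expectation (\<lambda>\<omega>. iexp (s * W \<omega>))) \<le> ?E1 + ?E2"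
    if s: "0 \<le> s" "s \<le> 1" for s
  proof -
    let ?f = "\<lambda>j i. expectation (\<lambda>\<omega>. of_real (X i \<omega> * G j i \<omega>) * iexp (s * W \<omega>))"
    let ?g = "\<lambda>j i. expectation (\<lambda>\<omega>. of_real (G j i \<omega> * D i \<omega>) * iexp (s * W \<omega>))"
    let ?h = "\<lambda>j k. expectation (\<lambda>\<omega>. of_real (U j k \<omega> - p j * C j k) * iexp (s * W \<omega>))"
    have i1: "integrable M (\<lambda>\<omega>. of_real (X i \<omega> * G j i \<omega>) * iexp (s * W \<omega>))" if "i \<in> V" for i j
      using that by (intro integrable_mult_iexp all_moments_integrable all_moments_intros) measurable
    have i2: "integrable M (\<lambda>\<omega>. of_real (G j i \<omega> * D i \<omega>) * iexp (s * W \<omega>))" for i j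
      by (intro integrable_mult_iexp all_moments_integrable all_moments_intros) measurable
    have i3: "integrable M (\<lambda>\<omega>. of_real (U j k \<omega> - p j * C j k) * iexp (s * W \<omega>))" for j k
      by (intro integrable_mult_iexp all_moments_integrable all_moments_intros) measurable
    have i4: "integrable M (\<lambda>\<omega>. iexp (s * W \<omega>))" by (rule integrable_iexp) auto
    have e1: "expectation (\<lambda>\<omega>. of_real (W \<omega>) * iexp (s * W \<omega>)) = (\<Sum>j\<in>J. \<Sum>i\<in>V. of_real (c j) * ?f j i)"
    proof -
      have "(\<lambda>\<omega>. of_real (W \<omega>) * iexp (s * W \<omega>)) = (\<lambda>\<omega>. \<Sum>j\<in>J. \<Sum>i\<in>V. of_real (c j) * (of_real (X i \<omega> * G j i \<omega>) * iexp (s * W \<omega>)))"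
        by (subst (1) WX) (simp add: sum_distrib_left sum_distrib_right mult_ac)
      then show ?thesis using i1 by simp
    qed
    have e2: "(\<Sum>j\<in>J. \<Sum>i\<in>V. of_real (c j) * ?g j i) = (\<Sum>j\<in>J. \<Sum>k\<in>J. of_real (c j * t k) * ?h j k) + of_real v * expectation (\<lambda>\<omega>. iexp (s * W \<omega>))"
    proof -
      have "(\<Sum>j\<in>J. \<Sum>i\<in>V. of_real (c j) * ?g j i) = expectation (\<lambda>\<omega>. of_real (\<Sum>j\<in>J. c j * (\<Sum>i\<in>V. G j i \<omega> * D i \<omega>)) * iexp (s * W \<omega>))"
      proof -
        have "(\<lambda>\<omega>. of_real (\<Sum>j\<in>J. c j * (\<Sum>i\<in>V. G j i \<omega> * D i \<omega>)) * iexp (s * W \<omega>))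
          = (\<lambda>\<omega>. \<Sum>j\<in>J. \<Sum>i\<in>V. of_real (c j) * (of_real (G j i \<omega> * D i \<omega>) * iexp (s * W \<omega>)))"
          by (simp add: sum_distrib_left sum_distrib_right mult_ac)
        then show ?thesis using i2 by simp
      qed
      also have "\<dots> = expectation (\<lambda>\<omega>. (\<Sum>j\<in>J. \<Sum>k\<in>J. of_real (c j * t k) * (of_real (U j k \<omega> - p j * C j k) * iexp (s * W \<omega>))) + of_real v * iexp (s * W \<omega>))"
      proof (intro Bochner_Integration.integral_cong refl)
        fix \<omega>
        have "(\<Sum>j\<in>J. c j * (\<Sum>i\<in>V. G j i \<omega> * D i \<omega>)) = (\<Sum>j\<in>J. \<Sum>k\<in>J. c j * t k * (U j k \<omega> - p j * C j k)) + v"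
          unfolding DU vc by (simp add: sum.distrib[symmetric] algebra_simps)
        then show "of_real (\<Sum>j\<in>J. c j * (\<Sum>i\<in>V. G j i \<omega> * D i \<omega>)) * iexp (s * W \<omega>)
          = (\<Sum>j\<in>J. \<Sum>k\<in>J. of_real (c j * t k) * (of_real (U j k \<omega> - p j * C j k) * iexp (s * W \<omega>))) + of_real v * iexp (s * W \<omega>)"
          by (simp add: sum_distrib_right distrib_right mult.assoc)
      qed
      also have "\<dots> = (\<Sum>j\<in>J. \<Sum>k\<in>J. of_real (c j * t k) * ?h j k) + of_real v * expectation (\<lambda>\<omega>. iexp (s * W \<omega>))"
        using i3 i4 by simp
      finally show ?thesis .
    qed
    let ?A = "\<Sum>j\<in>J. \<Sum>i\<in>V. of_real (c j) * (?f j i - \<i> * of_real s * ?g j i)"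
    let ?H = "\<Sum>j\<in>J. \<Sum>k\<in>J. of_real (c j * t k) * ?h j k"
    have lin: "(\<Sum>j\<in>J. \<Sum>i\<in>V. of_real (c j) * (f j i - z * g j i))
        = (\<Sum>j\<in>J. \<Sum>i\<in>V. of_real (c j) * f j i) - z * (\<Sum>j\<in>J. \<Sum>i\<in>V. of_real (c j) * g j i)"
      for f g :: "'d \<Rightarrow> 'i \<Rightarrow> complex" and z
      by (simp add: sum_subtractf sum_distrib_left right_diff_distrib mult_ac)
    \<comment> \<open>\<open>H + of_real v * \<psi>\<close> stands for the sum of the terms
      \<open>G * D\<close>, with its limit \<open>v\<close> split off; the multiples of
      \<open>\<psi>\<close> cancel and only the two errors remain.\<close>
    have "\<i> * P + of_real (s * v) * \<psi> = \<i> * (P - \<i> * of_real s * (H + of_real v * \<psi>)) - of_real s * H" for P H \<psi> :: complex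
      by (simp add: complex_eq_iff algebra_simps)
    from this[of _ _ ?H]
    have eq: "\<i> * expectation (\<lambda>\<omega>. of_real (W \<omega>) * iexp (s * W \<omega>)) + of_real (s * v) * expectation (\<lambda>\<omega>. iexp (s * W \<omega>))
      = \<i> * ?A - of_real s * ?H"
      unfolding lin e1 e2 .
    have tri: "cmod (\<i> * z - of_real s * z') \<le> cmod z + s * cmod z'" for z z'
      by (rule order_trans[OF norm_triangle_ineq4]) (use s in \<open>simp add: norm_mult\<close>)
    have A: "cmod ?A \<le> ?E2"
    proof -
      have "cmod (\<Sum>j\<in>J. \<Sum>i\<in>V. of_real (c j) * (?f j i - \<i> * of_real s * ?g j i))
        \<le> (\<Sum>j\<in>J. \<Sum>i\<in>V. \<bar>c j\<bar> * cmod (?f j i - \<i> * of_real s * ?g j i))"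
        by (intro order_trans[OF norm_sum] sum_mono order_trans[OF norm_sum]) (simp only: norm_mult norm_of_real order_refl)
      also have "\<dots> \<le> (\<Sum>j\<in>J. \<Sum>i\<in>V. \<bar>c j\<bar> * (\<theta> i * expectation (\<lambda>\<omega>. \<bar>G j i \<omega>\<bar> * (D i \<omega>)\<^sup>2)))"
      proof (intro sum_mono mult_left_mono abs_ge_zero)
        fix j i assume "i \<in> V"
        let ?e = "expectation (\<lambda>\<omega>. \<bar>G j i \<omega>\<bar> * (D i \<omega>)\<^sup>2)"
        have "0 \<le> \<theta> i * ?e" using \<theta>_pos[of i] V \<open>i \<in> V\<close> by (intro mult_nonneg_nonneg) auto
        moreover have "s\<^sup>2 / 2 \<le> 1" using s power_le_one[of s 2] by simp
        ultimately have "s\<^sup>2 / 2 * (\<theta> i * ?e) \<le> 1 * (\<theta> i * ?e)" by (rule mult_right_mono[rotated])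
        then show "cmod (?f j i - \<i> * of_real s * ?g j i) \<le> \<theta> i * ?e"
          using stein_mform[OF V \<open>i \<in> V\<close>, where g = "a j" and w = w and s = s] unfolding W_def G_def D_def by linarith
      qed
      also have "\<dots> \<le> ?E2"
        unfolding E2 sum_distrib_left[symmetric] by (intro sum_mono mult_left_mono EGD) auto
      finally show ?thesis .
    qed
    have "cmod ?H \<le> (\<Sum>j\<in>J. \<Sum>k\<in>J. \<bar>c j * t k\<bar> * cmod (?h j k))"
      by (intro order_trans[OF norm_sum] sum_mono order_trans[OF norm_sum]) (simp only: norm_mult norm_of_real order_refl)
    also have "\<dots> \<le> ?E1"
      unfolding c_def[symmetric]
    proof (intro sum_mono mult_left_mono abs_ge_zero)
      fix j k assume jk: "j \<in> J" "k \<in> J"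
      have "cmod (?h j k) \<le> expectation (\<lambda>\<omega>. \<bar>U j k \<omega> - p j * C j k\<bar>)"
        by (rule norm_integral_le[OF i3])
          (intro all_moments_integrable all_moments_intros, simp only: norm_mult norm_iexp norm_of_real mult_1_right order_refl)
      also have "\<dots> \<le> sqrt (var j k) + p j * \<bar>(\<Sum>A\<in>Pow V. a j A * a k A) - C j k\<bar>" by (rule U_bound[OF jk])
      finally show "cmod (?h j k) \<le> sqrt (var j k) + p j * \<bar>(\<Sum>A\<in>Pow V. a j A * a k A) - C j k\<bar>" .
    qed
    finally have H: "cmod ?H \<le> ?E1" .
    have "s * cmod ?H \<le> 1 * cmod ?H" using s(2) by (intro mult_right_mono) auto
    then show ?thesis unfolding eq using tri[of ?A ?H] A H by linarith
  qed
  from characteristic_function_gaussian_bound[OF am(1) v(2) this] show ?thesis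
    by (simp add: W F_def)
qed

end

subsection \<open>The multivariate normal distribution\<close>

lemma Basis_vec_eq: "(Basis :: (real ^ 'n) set) = range (\<lambda>i. axis i 1)"
  by (auto simp: Basis_vec_def)

lemma inj_axis_1: "inj (\<lambda>i. axis i (1::real))"
  by (auto simp: inj_on_def axis_eq_axis)

lemma sum_Basis_vec: "(\<Sum>b\<in>(Basis :: (real ^ 'n) set). F b) = (\<Sum>i\<in>UNIV. F (axis i 1))"
  unfolding Basis_vec_eq by (subst sum.reindex[OF inj_axis_1]) simp

lemma prod_Basis_vec: "(\<Prod>b\<in>(Basis :: (real ^ 'n) set). F b) = (\<Prod>i\<in>UNIV. F (axis i 1))"
  unfolding Basis_vec_eq by (subst prod.reindex[OF inj_axis_1]) simp

section \<open>Lebesgue measure under invertible linear maps\<close>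

lemma borel_measurable_linear:
  fixes f :: "'a::euclidean_space \<Rightarrow> 'b::euclidean_space"
  shows "linear f \<Longrightarrow> f \<in> borel_measurable borel"
  by (intro borel_measurable_continuous_onI linear_continuous_on) (simp add: linear_conv_bounded_linear)

lemma nn_integral_lborel_shear:
  fixes h :: "real ^ 'n \<Rightarrow> ennreal"
  assumes [measurable]: "h \<in> borel_measurable borel" and mn: "m \<noteq> n"
  shows "(\<integral>\<^sup>+x. h (\<chi> i. if i = m then x $ m + x $ n else x $ i) \<partial>lborel) = (\<integral>\<^sup>+x. h x \<partial>lborel)"
proof -
  interpret product_sigma_finite "\<lambda>_ :: real ^ 'n. lborel :: real measure"
    by (rule product_sigma_finite.intro) (rule sigma_finite_lborel)
  let ?e = "\<lambda>i. axis i (1::real) :: real ^ 'n"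
  let ?s = "\<lambda>x :: real ^ 'n. \<chi> i. if i = m then x $ m + x $ n else x $ i"
  let ?B = "Basis - {?e m}" and ?P = "PiM (Basis - {?e m}) (\<lambda>_. lborel :: real measure)"
  let ?v = "\<lambda>x. \<Sum>b\<in>Basis. x b *\<^sub>R b :: real ^ 'n"
  have ins: "insert (?e m) ?B = Basis" by (auto simp: insert_absorb)
  have [measurable]: "?s \<in> borel_measurable borel"
    by (rule borel_measurable_linear, rule linearI) (auto simp: vec_eq_iff algebra_simps)
  have split: "(\<integral>\<^sup>+x. k x \<partial>lborel) = (\<integral>\<^sup>+x. \<integral>\<^sup>+y. k (?v (x(?e m := y))) \<partial>lborel \<partial>?P)"
    if [measurable]: "k \<in> borel_measurable borel" for k :: "real ^ 'n \<Rightarrow> ennreal"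
  proof -
    have "(\<integral>\<^sup>+x. k x \<partial>lborel) = (\<integral>\<^sup>+x. k (?v x) \<partial>PiM (insert (?e m) ?B) (\<lambda>_. lborel))"
      unfolding ins by (subst lborel_eq) (simp add: nn_integral_distr)
    also have "\<dots> = (\<integral>\<^sup>+x. \<integral>\<^sup>+y. k (?v (x(?e m := y))) \<partial>lborel \<partial>?P)"
    proof (rule product_nn_integral_insert)
      have "(\<lambda>x. k (?v x)) \<in> borel_measurable (PiM Basis (\<lambda>_. lborel))" by measurable
      then show "(\<lambda>x. k (?v x)) \<in> borel_measurable (PiM (insert (?e m) ?B) (\<lambda>_. lborel))" by (simp only: ins)
    qed auto
    finally show ?thesis .
  qed
  have comp: "?v x $ i = x (?e i)" for x :: "real ^ 'n \<Rightarrow> real" and i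
  proof -
    have "?v x $ i = (\<Sum>j\<in>UNIV. if i = j then x (?e j) else 0)"
      unfolding sum_Basis_vec sum_component by (intro sum.cong) (auto simp: axis_def)
    then show ?thesis by simp
  qed
  have sh: "?s (?v (x(?e m := y))) = ?v (x(?e m := x (?e n) + y))" for x y
  proof (rule vec_eq_iff[THEN iffD2], rule allI)
    fix i show "?s (?v (x(?e m := y))) $ i = ?v (x(?e m := x (?e n) + y)) $ i"
      unfolding vec_lambda_beta comp using mn by (auto simp: axis_eq_axis)
  qed
  have [measurable]: "(\<lambda>y. h (?v (x(?e m := y)))) \<in> borel_measurable borel" for x
  proof -
    have "(\<lambda>y. ?v (x(?e m := y))) = (\<lambda>y. \<Sum>b\<in>Basis. (if b = ?e m then y else x b) *\<^sub>R b)" by (simp add: fun_upd_def)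
    then have "(\<lambda>y. ?v (x(?e m := y))) \<in> borel_measurable borel" by simp
    then show ?thesis by measurable
  qed
  have "(\<integral>\<^sup>+x. h (?s x) \<partial>lborel) = (\<integral>\<^sup>+x. \<integral>\<^sup>+y. h (?v (x(?e m := x (?e n) + y))) \<partial>lborel \<partial>?P)"
    by (subst split) (simp_all only: sh, measurable)
  also have "\<dots> = (\<integral>\<^sup>+x. \<integral>\<^sup>+y. h (?v (x(?e m := y))) \<partial>lborel \<partial>?P)"
  proof (rule nn_integral_cong)
    fix x show "(\<integral>\<^sup>+y. h (?v (x(?e m := x (?e n) + y))) \<partial>lborel) = (\<integral>\<^sup>+y. h (?v (x(?e m := y))) \<partial>lborel)"
      using nn_integral_real_affine[of "\<lambda>y. h (?v (x(?e m := y)))" 1 "x (?e n)"] by simp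
  qed
  also have "\<dots> = (\<integral>\<^sup>+x. h x \<partial>lborel)" by (subst split) auto
  finally show ?thesis .
qed

text \<open>A permutation of coordinates maps boxes to boxes with the same product of side lengths,
  and the values on boxes determine the measure.\<close>

lemma nn_integral_lborel_permute:
  fixes h :: "real ^ 'n \<Rightarrow> ennreal"
  assumes [measurable]: "h \<in> borel_measurable borel" and p: "p permutes UNIV"
  shows "(\<integral>\<^sup>+x. h (\<chi> i. x $ p i) \<partial>lborel) = (\<integral>\<^sup>+x. h x \<partial>lborel)"
proof -
  let ?s = "\<lambda>x :: real ^ 'n. \<chi> i. x $ p i"
  have [measurable]: "?s \<in> borel_measurable borel"
    by (rule borel_measurable_linear, rule linearI) (auto simp: vec_eq_iff)
  have "lborel = distr lborel borel ?s"
  proof (rule lborel_eqI)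
    fix l u :: "real ^ 'n" assume "\<And>b. b \<in> Basis \<Longrightarrow> l \<bullet> b \<le> u \<bullet> b"
    from this[of "axis _ 1"] have lu: "l $ i \<le> u $ i" for i by (simp add: inner_axis)
    let ?r = "\<lambda>x :: real ^ 'n. \<chi> i. x $ inv p i"
    have "?s -` box l u = box (?r l) (?r u)"
      using p by (auto simp: mem_box_cart permutes_inverses) (metis permutes_inverses(1,2))+
    then have "emeasure (distr lborel borel ?s) (box l u) = emeasure lborel (box (?r l) (?r u))"
      by (simp add: emeasure_distr)
    also have "\<dots> = (\<Prod>i\<in>UNIV. ennreal ((?r u - ?r l) $ i))"
      by (subst emeasure_lborel_box) (auto simp: Basis_vec_eq inner_axis lu prod.reindex[OF inj_axis_1] prod_ennreal)
    also have "\<dots> = (\<Prod>i\<in>UNIV. ennreal ((u - l) $ inv p i))" by simp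
    also have "\<dots> = (\<Prod>i\<in>UNIV. ennreal ((u - l) $ i))"
      by (rule prod.permute[OF permutes_inv[OF p], symmetric, unfolded comp_def])
    finally show "emeasure (distr lborel borel ?s) (box l u) = ennreal (\<Prod>b\<in>Basis. (u - l) \<bullet> b)"
      by (simp add: prod_Basis_vec inner_axis prod_ennreal lu)
  qed simp
  then have "(\<integral>\<^sup>+x. h x \<partial>lborel) = (\<integral>\<^sup>+x. h x \<partial>distr lborel borel ?s)" by simp
  then show ?thesis by (simp add: nn_integral_distr)
qed

lemma nn_integral_lborel_stretch:
  fixes h :: "real ^ 'n \<Rightarrow> ennreal"
  assumes [measurable]: "h \<in> borel_measurable borel" and c: "\<And>i. c i \<noteq> 0"
  shows "(\<integral>\<^sup>+x. h x \<partial>lborel) = ennreal (\<Prod>i\<in>UNIV. \<bar>c i\<bar>) * (\<integral>\<^sup>+x. h (\<chi> i. c i * x $ i) \<partial>lborel)"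
proof -
  let ?c = "\<lambda>j :: real ^ 'n. (\<chi> i. c i) \<bullet> j"
  have "lborel = density (distr lborel borel (\<lambda>x. 0 + (\<Sum>j\<in>Basis. (?c j * (x \<bullet> j)) *\<^sub>R j))) (\<lambda>x. ennreal (\<Prod>j\<in>Basis. \<bar>?c j\<bar>))"
    by (rule lborel_affine_euclidean) (use c in \<open>auto simp: Basis_vec_eq inner_axis\<close>)
  also have "(\<lambda>x. 0 + (\<Sum>j\<in>Basis. (?c j * (x \<bullet> j)) *\<^sub>R j)) = (\<lambda>x. \<chi> i. c i * x $ i)"
    by (simp add: sum_Basis_vec inner_axis vec_eq_iff fun_eq_iff) (simp add: axis_def if_distrib[of "(*) _"] cong: if_cong)
  also have "(\<Prod>j\<in>Basis. \<bar>?c j\<bar>) = (\<Prod>i\<in>UNIV. \<bar>c i\<bar>)"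
    by (simp add: prod_Basis_vec inner_axis)
  finally have e: "lborel = density (distr lborel borel (\<lambda>x :: real ^ 'n. \<chi> i. c i * x $ i)) (\<lambda>x. ennreal (\<Prod>i\<in>UNIV. \<bar>c i\<bar>))" .
  have [measurable]: "(\<lambda>x :: real ^ 'n. \<chi> i. c i * x $ i) \<in> borel_measurable borel"
    by (rule borel_measurable_linear, rule linearI) (auto simp: vec_eq_iff algebra_simps)
  show ?thesis
    by (subst e) (simp add: nn_integral_density nn_integral_distr nn_integral_cmult)
qed

text \<open>Change of variables by decomposition into elementary maps. The determinant condition is
  part of the induction statement: for a composition it passes to both factors, and a map with a
  zero row satisfies the statement vacuously.\<close>

lemma nn_integral_lborel_linear:
  fixes f :: "real ^ 'n \<Rightarrow> real ^ 'n" and h :: "real ^ 'n \<Rightarrow> ennreal"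
  assumes "linear f" "det (matrix f) \<noteq> 0" "h \<in> borel_measurable borel"
  shows "(\<integral>\<^sup>+x. h x \<partial>lborel) = ennreal \<bar>det (matrix f)\<bar> * (\<integral>\<^sup>+x. h (f x) \<partial>lborel)"
proof -
  have "det (matrix f) \<noteq> 0 \<longrightarrow> (\<forall>h\<in>borel_measurable borel.
     (\<integral>\<^sup>+x. h x \<partial>lborel) = ennreal \<bar>det (matrix f)\<bar> * (\<integral>\<^sup>+x. h (f x) \<partial>lborel))"
  proof (rule induct_linear_elementary[OF assms(1)], goal_cases)
    case (1 f g)
    show ?case
    proof (intro impI ballI)
      fix h :: "real ^ 'n \<Rightarrow> ennreal" assume h: "h \<in> borel_measurable borel" and d: "det (matrix (f \<circ> g)) \<noteq> 0"
      have m: "det (matrix (f \<circ> g)) = det (matrix f) * det (matrix g)"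
        using 1 by (simp add: matrix_compose det_mul)
      have "(\<lambda>x. h (f x)) \<in> borel_measurable borel"
        using h borel_measurable_linear[OF 1(1)] by (rule measurable_compose[rotated])
      then have "(\<integral>\<^sup>+x. h (f x) \<partial>lborel) = ennreal \<bar>det (matrix g)\<bar> * (\<integral>\<^sup>+x. h (f (g x)) \<partial>lborel)"
        using 1(4) d unfolding m by simp
      moreover have "(\<integral>\<^sup>+x. h x \<partial>lborel) = ennreal \<bar>det (matrix f)\<bar> * (\<integral>\<^sup>+x. h (f x) \<partial>lborel)"
        using 1(3) h d unfolding m by simp
      ultimately show "(\<integral>\<^sup>+x. h x \<partial>lborel) = ennreal \<bar>det (matrix (f \<circ> g))\<bar> * (\<integral>\<^sup>+x. h ((f \<circ> g) x) \<partial>lborel)"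
        unfolding m by (simp add: abs_mult ennreal_mult mult.assoc)
    qed
  next
    case (2 f i)
    have "row i (matrix f) = 0" using 2(2) by (simp add: row_def matrix_def vec_eq_iff)
    then show ?case by (simp add: det_zero_row)
  next
    case (3 c)
    have d: "det (matrix (\<lambda>x :: real ^ 'n. \<chi> i. c i * x $ i)) = (\<Prod>i\<in>UNIV. c i)"
      by (subst det_diagonal) (auto simp: matrix_def axis_def)
    show ?case
      unfolding d by (auto simp: abs_prod intro!: nn_integral_lborel_stretch)
  next
    case (4 m n)
    have p: "Transposition.transpose m n permutes UNIV" by (rule permutes_swap_id) auto
    have "matrix (\<lambda>x :: real ^ 'n. \<chi> i. x $ Transposition.transpose m n i) = (\<chi> i. mat 1 $ Transposition.transpose m n i)"
      by (simp add: matrix_def mat_def axis_def vec_eq_iff)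
    then have "\<bar>det (matrix (\<lambda>x :: real ^ 'n. \<chi> i. x $ Transposition.transpose m n i))\<bar> = 1"
      by (simp add: det_permute_rows[OF p] abs_mult sign_def)
    then show ?case using nn_integral_lborel_permute[OF _ p] by simp
  next
    case (5 m n)
    have "matrix (\<lambda>x :: real ^ 'n. \<chi> i. if i = m then x $ m + x $ n else x $ i)
      = (\<chi> k. if k = m then row m (mat 1) + 1 *s row n (mat 1) else row k (mat 1))"
      by (auto simp: matrix_def mat_def axis_def row_def vec_eq_iff)
    then have "det (matrix (\<lambda>x :: real ^ 'n. \<chi> i. if i = m then x $ m + x $ n else x $ i)) = 1"
      using det_row_operation[OF 5, of "mat 1 :: real ^ 'n ^ 'n" 1] by simp
    then show ?case using nn_integral_lborel_shear[OF _ 5] by simp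
  qed
  then show ?thesis using assms by blast
qed

section \<open>Diagonalizing a positive definite form\<close>

lemma matrix_inv_eqI:
  fixes A B :: "real ^ 'n ^ 'n"
  assumes "A ** B = mat 1" shows "matrix_inv A = B"
proof -
  have BA: "B ** A = mat 1" using assms by (simp add: matrix_left_right_inverse)
  then have "A ** matrix_inv A = mat 1 \<and> matrix_inv A ** A = mat 1"
    unfolding matrix_inv_def by (intro someI[of "\<lambda>A'. A ** A' = mat 1 \<and> A' ** A = mat 1" B]) (simp add: assms)
  then have "B = B ** (A ** matrix_inv A)" by simp
  also have "\<dots> = matrix_inv A" by (simp add: matrix_mul_assoc BA)
  finally show ?thesis by simp
qed

lemma inner_matrix_vector_mult: "(A *v x) \<bullet> y = x \<bullet> (transpose A *v (y :: real ^ 'n))"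
  by (metis dot_lmul_matrix inner_commute vector_transpose_matrix)

text \<open>Gram-Schmidt with respect to the inner product defined by \<open>C\<close>.\<close>

lemma positive_definite_orthonormal:
  fixes C :: "real ^ 'n ^ 'n"
  assumes C: "positive_definite C"
  obtains V :: "real ^ 'n ^ 'n" where "transpose V ** C ** V = mat 1"
proof -
  let ?b = "\<lambda>x y. x \<bullet> (C *v y)"
  have sym: "?b x y = ?b y x" for x y
    using C by (metis inner_commute inner_matrix_vector_mult positive_definite_def)
  have pos: "x \<noteq> 0 \<Longrightarrow> 0 < ?b x x" for x using C by (simp add: positive_definite_def)
  have lin: "?b (x - y) z = ?b x z - ?b y z" "?b (s *\<^sub>R x) z = s * ?b x z" "?b (\<Sum>i\<in>S. w i) z = (\<Sum>i\<in>S. ?b (w i) z)" for x y z s S and w :: "'n \<Rightarrow> real ^ 'n"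
    by (simp_all add: inner_diff_left inner_sum_left)
  have "\<exists>v :: 'n \<Rightarrow> real ^ 'n. \<forall>i\<in>S. \<forall>j\<in>S. ?b (v i) (v j) = of_bool (i = j)" for S :: "'n set"
    using finite[of S]
  proof (induction S rule: finite_induct)
    case (insert k S)
    then obtain v where v: "\<And>i j. i \<in> S \<Longrightarrow> j \<in> S \<Longrightarrow> ?b (v i) (v j) = of_bool (i = j)" by blast
    have "card S < CARD('n)" using insert(2) by (intro psubset_card_mono) auto
    then have "dim (span (v ` S)) < DIM(real ^ 'n)"
      using dim_le_card'[of "v ` S"] card_image_le[OF insert(1), of v] insert(1) by simp
    then obtain w where w: "w \<notin> span (v ` S)"
      by (metis UNIV_eq_I dim_UNIV less_irrefl)
    \<comment> \<open>The component of \<open>w\<close> orthogonal to the vectors found so far; it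
      is nonzero because \<open>w\<close> is outside their span.\<close>
    define u where "u = w - (\<Sum>i\<in>S. ?b w (v i) *\<^sub>R v i)"
    have "u \<noteq> 0"
    proof
      assume "u = 0"
      then have "w = (\<Sum>i\<in>S. ?b w (v i) *\<^sub>R v i)" by (simp add: u_def)
      then show False using w by (metis (no_types, lifting) image_eqI span_base span_scale span_sum)
    qed
    then have u: "0 < ?b u u" by (rule pos)
    have uv: "?b u (v j) = 0" if "j \<in> S" for j
    proof -
      have "?b u (v j) = ?b w (v j) - (\<Sum>i\<in>S. ?b w (v i) * of_bool (i = j))"
        using v that by (simp add: u_def lin)
      then show ?thesis using that insert(1) by simp
    qed
    let ?v = "v(k := (1 / sqrt (?b u u)) *\<^sub>R u)"
    have rr: "?b (c *\<^sub>R u) (c *\<^sub>R u) = c * c * ?b u u" for c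
      by (simp add: matrix_vector_mult_scaleR)
    have uu: "?b ((1 / sqrt (?b u u)) *\<^sub>R u) ((1 / sqrt (?b u u)) *\<^sub>R u) = 1"
      unfolding rr using u by simp
    have uv': "?b ((1 / sqrt (?b u u)) *\<^sub>R u) (v j) = 0" "?b (v j) ((1 / sqrt (?b u u)) *\<^sub>R u) = 0" if "j \<in> S" for j
      using uv[OF that] by (simp_all only: lin(2) sym[of "v j"] mult_zero_right)
    have "?b (?v i) (?v j) = of_bool (i = j)" if ij: "i \<in> insert k S" "j \<in> insert k S" for i j
    proof (cases "i = k"; cases "j = k")
      assume "i = k" "j = k" then show ?thesis using uu by (simp only: fun_upd_same) simp
    next
      assume "i = k" "j \<noteq> k" then show ?thesis using uv'(1)[of j] ij by (simp only: fun_upd_same fun_upd_other) simp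
    next
      assume "i \<noteq> k" "j = k" then show ?thesis using uv'(2)[of i] ij by (simp only: fun_upd_same fun_upd_other) simp
    next
      assume "i \<noteq> k" "j \<noteq> k" then show ?thesis using v[of i j] ij by simp
    qed
    then show ?case by blast
  qed simp
  then obtain v :: "'n \<Rightarrow> real ^ 'n" where v: "\<And>i j. ?b (v i) (v j) = of_bool (i = j)" by (metis UNIV_I)
  define V where "V = (\<chi> r c. v c $ r)"
  have "(transpose V ** C ** V) $ i $ j = ?b (v i) (v j)" for i j
  proof -
    have "(transpose V ** C ** V) $ i $ j = (transpose V ** (C ** V)) $ i $ j" by (simp add: matrix_mul_assoc)
    also have "\<dots> = ?b (v i) (v j)"
      by (simp add: matrix_matrix_mult_def V_def transpose_def inner_vec_def matrix_vector_mult_def)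
    finally show ?thesis .
  qed
  then have "transpose V ** C ** V = mat 1" by (simp add: vec_eq_iff v mat_def)
  then show ?thesis by (rule that)
qed

section \<open>Gaussian vectors as linear images of the standard one\<close>

definition std_normal_vec :: "(real ^ 'n) measure" where
  "std_normal_vec = density lborel (\<lambda>y. ennreal (exp (- (y \<bullet> y) / 2) / sqrt ((2 * pi) ^ CARD('n))))"

text \<open>The linear map turns the quadratic form of \<open>matrix_inv C\<close> into the
  Euclidean one, and its Jacobian cancels \<open>sqrt (det C)\<close> in the normalizing constant.
  This reduces total mass and Fourier transform to the standard case.\<close>

lemma multivariate_normal_eq_distr:
  fixes C :: "real ^ 'n ^ 'n"
  assumes C: "positive_definite C"
  obtains L :: "real ^ 'n ^ 'n" where "multivariate_normal C = distr std_normal_vec borel ((*v) L)" "L ** transpose L = C"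
proof -
  obtain V :: "real ^ 'n ^ 'n" where V: "transpose V ** C ** V = mat 1" by (rule positive_definite_orthonormal[OF C])
  have CT: "transpose C = C" using C by (simp add: positive_definite_def)
  \<comment> \<open>The relation \<open>transpose V ** C ** V = mat 1\<close> says that the inverse
    of \<open>C ** V\<close> is \<open>transpose V\<close>, from which
    \<open>L ** transpose L = C\<close> follows.\<close>
  define L where "L = C ** V"
  have VL: "transpose V ** L = mat 1" using V by (simp add: L_def matrix_mul_assoc)
  have LT: "transpose L = transpose V ** C" by (simp add: L_def matrix_transpose_mul CT)
  have CVV: "V ** transpose V ** C = mat 1"
  proof -
    have "(transpose V ** C) ** V = mat 1" by (rule V)
    then have "V ** (transpose V ** C) = mat 1" by (rule matrix_left_right_inverse1)
    then show ?thesis by (simp add: matrix_mul_assoc)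
  qed
  then have "C ** (V ** transpose V) = mat 1" by (rule matrix_left_right_inverse1)
  then have inv: "matrix_inv C = V ** transpose V" by (rule matrix_inv_eqI)
  have LL: "L ** transpose L = C"
  proof -
    have "L ** transpose L = C ** (V ** transpose V ** C)" unfolding LT unfolding L_def by (simp add: matrix_mul_assoc)
    then show ?thesis by (simp add: CVV)
  qed
  have detC: "det C = (det L)\<^sup>2" unfolding LL[symmetric] by (simp add: det_mul power2_eq_square)
  have detL: "det L \<noteq> 0" using VL by (metis det_I det_mul mult_zero_right zero_neq_one)
  let ?K = "(2 * pi) ^ CARD('n)"
  have lin: "linear ((*v) L)" by simp
  note [measurable] = borel_measurable_linear[OF lin]
  have quad: "(L *v y) \<bullet> (matrix_inv C *v (L *v y)) = y \<bullet> y" for y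
  proof -
    have "(L *v y) \<bullet> (matrix_inv C *v (L *v y)) = (transpose V *v (L *v y)) \<bullet> (transpose V *v (L *v y))"
      unfolding inv matrix_vector_mul_assoc[symmetric] by (metis inner_commute inner_matrix_vector_mult)
    also have "transpose V *v (L *v y) = y" by (simp add: matrix_vector_mul_assoc VL)
    finally show ?thesis .
  qed
  have [measurable]: "(\<lambda>x. x \<bullet> (matrix_inv C *v x)) \<in> borel_measurable borel"
    by (intro borel_measurable_inner) (auto intro: borel_measurable_linear)
  have "multivariate_normal C = distr std_normal_vec borel ((*v) L)"
  proof (rule measure_eqI)
    show "sets (multivariate_normal C) = sets (distr std_normal_vec borel ((*v) L))"
      by (simp add: multivariate_normal_def)
    fix A assume "A \<in> sets (multivariate_normal C)"
    then have [measurable]: "A \<in> sets borel" by (simp add: multivariate_normal_def)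
    let ?h = "\<lambda>x. ennreal (exp (- (x \<bullet> (matrix_inv C *v x)) / 2) / sqrt (?K * det C)) * indicator A x"
    have "emeasure (multivariate_normal C) A = (\<integral>\<^sup>+x. ?h x \<partial>lborel)"
      unfolding multivariate_normal_def by (subst emeasure_density) auto
    also have "\<dots> = ennreal \<bar>det L\<bar> * (\<integral>\<^sup>+y. ?h (L *v y) \<partial>lborel)"
      using nn_integral_lborel_linear[OF lin, of ?h] detL by simp
    also have "\<dots> = (\<integral>\<^sup>+y. ennreal \<bar>det L\<bar> * ?h (L *v y) \<partial>lborel)"
      by (subst nn_integral_cmult) auto
    also have "\<dots> = (\<integral>\<^sup>+y. ennreal (exp (- (y \<bullet> y) / 2) / sqrt ?K) * indicator ((*v) L -` A) y \<partial>lborel)"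
    proof (rule nn_integral_cong)
      fix y :: "real ^ 'n"
      have "\<bar>det L\<bar> * (exp (- (y \<bullet> y) / 2) / sqrt (?K * det C)) = exp (- (y \<bullet> y) / 2) / sqrt ?K"
        using detL by (simp add: detC real_sqrt_mult)
      then have "ennreal \<bar>det L\<bar> * ennreal (exp (- (y \<bullet> y) / 2) / sqrt (?K * det C)) = ennreal (exp (- (y \<bullet> y) / 2) / sqrt ?K)"
        by (simp flip: ennreal_mult')
      then show "ennreal \<bar>det L\<bar> * ?h (L *v y) = ennreal (exp (- (y \<bullet> y) / 2) / sqrt ?K) * indicator ((*v) L -` A) y"
        by (simp add: quad mult.assoc[symmetric] indicator_def)
    qed
    also have "\<dots> = emeasure (distr std_normal_vec borel ((*v) L)) A"
    proof -
      have "(*v) L -` A \<in> sets borel" using measurable_sets[OF borel_measurable_linear[OF lin], of A] by simp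
      then show ?thesis by (simp add: std_normal_vec_def emeasure_distr emeasure_density)
    qed
    finally show "emeasure (multivariate_normal C) A = emeasure (distr std_normal_vec borel ((*v) L)) A" .
  qed
  then show ?thesis using LL by (rule that)
qed

text \<open>The density times the exponential is a product of functions of one coordinate each, so
  the integral is a product of standard normal characteristic functions. Integrability is stated
  with it because the total mass is obtained from the case \<open>u = 0\<close>.\<close>

lemma
  fixes u :: "real ^ 'n"
  shows integral_std_normal_vec_iexp: "(\<integral>y. iexp (u \<bullet> y) \<partial>std_normal_vec) = of_real (exp (- (u \<bullet> u) / 2))"
    and integrable_std_normal_vec_density: "integrable lborel
      (\<lambda>y :: real ^ 'n. (exp (- (y \<bullet> y) / 2) / sqrt ((2 * pi) ^ CARD('n))) *\<^sub>R iexp (u \<bullet> y))"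
proof -
  interpret product_sigma_finite "\<lambda>_ :: real ^ 'n. lborel :: real measure"
    by (rule product_sigma_finite.intro) (rule sigma_finite_lborel)
  let ?B = "Basis :: (real ^ 'n) set" and ?P = "PiM (Basis :: (real ^ 'n) set) (\<lambda>_. lborel :: real measure)"
  let ?v = "\<lambda>x. \<Sum>b\<in>?B. x b *\<^sub>R b"
  let ?\<phi> = "\<lambda>b s. std_normal_density s *\<^sub>R iexp ((u \<bullet> b) * s)"
  let ?g = "\<lambda>y :: real ^ 'n. (exp (- (y \<bullet> y) / 2) / sqrt ((2 * pi) ^ CARD('n))) *\<^sub>R iexp (u \<bullet> y)"
  have nd: "std_normal_density s = exp (- (s\<^sup>2) / 2) / sqrt (2 * pi)" for s by (simp add: std_normal_density_def)
  have int: "integrable lborel (?\<phi> b)" for b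
  proof (rule Bochner_Integration.integrable_bound)
    show "integrable lborel std_normal_density" by simp
  qed auto
  have int\<phi>: "(\<integral>s. ?\<phi> b s \<partial>lborel) = of_real (exp (- ((u \<bullet> b)\<^sup>2) / 2))" for b
  proof -
    have "(\<integral>s. ?\<phi> b s \<partial>lborel) = char std_normal_distribution (u \<bullet> b)"
      unfolding char_def by (subst integral_density) auto
    then show ?thesis by (simp add: char_std_normal_distribution)
  qed
  have vb: "?v x \<bullet> b = x b" if "b \<in> ?B" for x b using that by (simp add: inner_sum_left_Basis)
  have g: "?g (?v x) = (\<Prod>b\<in>?B. ?\<phi> b (x b))" for x
  proof -
    have "?v x \<bullet> ?v x = (\<Sum>b\<in>?B. (x b)\<^sup>2)"
      by (subst euclidean_inner) (simp add: vb power2_eq_square)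
    then have "exp (- (?v x \<bullet> ?v x) / 2) = (\<Prod>b\<in>?B. exp (- ((x b)\<^sup>2) / 2))"
      by (simp add: exp_sum[symmetric] sum_negf sum_divide_distrib)
    moreover have "sqrt ((2 * pi) ^ CARD('n)) = (\<Prod>b\<in>?B. sqrt (2 * pi))" unfolding real_sqrt_power by simp
    ultimately have d: "exp (- (?v x \<bullet> ?v x) / 2) / sqrt ((2 * pi) ^ CARD('n)) = (\<Prod>b\<in>?B. std_normal_density (x b))"
      by (simp only: nd prod_dividef)
    have "u \<bullet> ?v x = (\<Sum>b\<in>?B. (u \<bullet> b) * x b)"
      by (subst euclidean_inner) (simp add: vb)
    then have "iexp (u \<bullet> ?v x) = (\<Prod>b\<in>?B. iexp ((u \<bullet> b) * x b))"
      by (simp add: exp_sum[symmetric] sum_distrib_left)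
    then show ?thesis unfolding d by (simp only: scaleR_conv_of_real of_real_prod prod.distrib)
  qed
  have intP: "integrable ?P (\<lambda>x. ?g (?v x))"
    unfolding g by (rule product_integrable_prod[OF finite_Basis int])
  show intg: "integrable lborel ?g"
    by (subst lborel_eq, subst integrable_distr_eq) (use intP in auto)
  have "(\<integral>y. iexp (u \<bullet> y) \<partial>std_normal_vec) = (\<integral>y. ?g y \<partial>lborel)"
    unfolding std_normal_vec_def by (subst integral_density) auto
  also have "\<dots> = (\<integral>x. ?g (?v x) \<partial>?P)" by (subst lborel_eq, subst integral_distr) auto
  also have "\<dots> = (\<Prod>b\<in>?B. \<integral>s. ?\<phi> b s \<partial>lborel)"
    unfolding g by (rule product_integral_prod[OF finite_Basis int])
  also have "\<dots> = of_real (\<Prod>b\<in>?B. exp (- ((u \<bullet> b)\<^sup>2) / 2))" by (simp only: int\<phi> of_real_prod)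
  also have "(\<Prod>b\<in>?B. exp (- ((u \<bullet> b)\<^sup>2) / 2)) = exp (- (u \<bullet> u) / 2)"
  proof -
    have "u \<bullet> u = (\<Sum>b\<in>?B. (u \<bullet> b)\<^sup>2)" by (subst euclidean_inner) (simp add: power2_eq_square)
    then show ?thesis by (simp add: exp_sum[symmetric] sum_negf sum_divide_distrib)
  qed
  finally show "(\<integral>y. iexp (u \<bullet> y) \<partial>std_normal_vec) = of_real (exp (- (u \<bullet> u) / 2))" .
qed

lemma sets_std_normal_vec [simp, measurable_cong]: "sets std_normal_vec = sets borel"
  by (simp add: std_normal_vec_def)

lemma prob_space_std_normal_vec: "prob_space (std_normal_vec :: (real ^ 'n) measure)"
proof
  let ?d = "\<lambda>y :: real ^ 'n. exp (- (y \<bullet> y) / 2) / sqrt ((2 * pi) ^ CARD('n))"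
  have int: "integrable lborel ?d"
    using integrable_std_normal_vec_density[of 0] integrable_Re by fastforce
  have "complex_of_real (\<integral>y. ?d y \<partial>lborel) = (\<integral>y. 1 \<partial>(std_normal_vec :: (real ^ 'n) measure))"
    unfolding std_normal_vec_def by (subst integral_density) (auto simp: scaleR_conv_of_real simp del: integral_const)
  also have "\<dots> = 1" using integral_std_normal_vec_iexp[of "0 :: real ^ 'n"] by simp
  finally have one: "(\<integral>y. ?d y \<partial>lborel) = 1" by simp
  have "emeasure (std_normal_vec :: (real ^ 'n) measure) (space std_normal_vec) = (\<integral>\<^sup>+y. ennreal (?d y) \<partial>lborel)"
    unfolding std_normal_vec_def by (subst emeasure_density) (auto simp: space_density)
  also have "\<dots> = ennreal (\<integral>y. ?d y \<partial>lborel)" by (rule nn_integral_eq_integral[OF int]) auto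
  finally show "emeasure (std_normal_vec :: (real ^ 'n) measure) (space std_normal_vec) = 1" unfolding one by simp
qed

lemma sets_multivariate_normal [simp, measurable_cong]: "sets (multivariate_normal C) = sets borel"
  by (simp add: multivariate_normal_def)

lemma
  fixes C :: "real ^ 'n ^ 'n"
  assumes C: "positive_definite C"
  shows prob_space_multivariate_normal: "prob_space (multivariate_normal C)"
    and integral_multivariate_normal_iexp:
      "(\<integral>x. iexp (t \<bullet> x) \<partial>multivariate_normal C) = of_real (exp (- (t \<bullet> (C *v t)) / 2))"
proof -
  obtain L :: "real ^ 'n ^ 'n" where L: "multivariate_normal C = distr std_normal_vec borel ((*v) L)" "L ** transpose L = C"
    by (rule multivariate_normal_eq_distr[OF C])
  have [measurable]: "(*v) L \<in> borel_measurable borel" by (rule borel_measurable_linear) simp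
  interpret prob_space "std_normal_vec :: (real ^ 'n) measure" by (rule prob_space_std_normal_vec)
  show "prob_space (multivariate_normal C)" unfolding L(1) by (rule prob_space_distr) measurable
  have "(\<integral>x. iexp (t \<bullet> x) \<partial>multivariate_normal C) = (\<integral>y. iexp (t \<bullet> (L *v y)) \<partial>std_normal_vec)"
    unfolding L(1) by (subst integral_distr) auto
  also have "\<dots> = (\<integral>y. iexp ((transpose L *v t) \<bullet> y) \<partial>std_normal_vec)"
    by (metis inner_commute inner_matrix_vector_mult)
  also have "\<dots> = of_real (exp (- ((transpose L *v t) \<bullet> (transpose L *v t)) / 2))"
    by (rule integral_std_normal_vec_iexp)
  also have "(transpose L *v t) \<bullet> (transpose L *v t) = t \<bullet> (C *v t)"
    by (simp only: inner_matrix_vector_mult transpose_transpose matrix_vector_mul_assoc L(2))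
  finally show "(\<integral>x. iexp (t \<bullet> x) \<partial>multivariate_normal C) = of_real (exp (- (t \<bullet> (C *v t)) / 2))" .
qed

subsection \<open>Convergence of characteristic functions of random vectors\<close>

text \<open>The test functions whose integrals converge as soon as the characteristic functions do,
  by linearity. The class is closed under products because exponents add.\<close>

inductive trig_poly :: "('a::real_inner \<Rightarrow> complex) \<Rightarrow> bool" where
  iexp: "trig_poly (\<lambda>x. c * iexp (t \<bullet> x))"
| add: "trig_poly f \<Longrightarrow> trig_poly g \<Longrightarrow> trig_poly (\<lambda>x. f x + g x)"

lemma trig_poly_const: "trig_poly (\<lambda>x. c)"
  using trig_poly.iexp[of c 0] by simp

lemma trig_poly_mult:
  assumes "trig_poly f" "trig_poly g" shows "trig_poly (\<lambda>x. f x * g x)"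
  using assms(1)
proof induction
  case (iexp c t)
  from assms(2) show ?case
  proof induction
    case (iexp d u)
    have "(\<lambda>x. c * iexp (t \<bullet> x) * (d * iexp (u \<bullet> x))) = (\<lambda>x. (c * d) * iexp ((t + u) \<bullet> x))"
      by (simp add: inner_add_left exp_add distrib_left mult_ac)
    then show ?case using trig_poly.iexp by metis
  next
    case (add g h)
    then show ?case using trig_poly.add by (simp add: distrib_left)
  qed
next
  case (add g h)
  then show ?case using trig_poly.add by (simp add: distrib_right)
qed

lemma trig_poly_sin: "trig_poly (\<lambda>x. of_real (sin (t \<bullet> x)))"
proof -
  have "(\<lambda>x. complex_of_real (sin (t \<bullet> x))) = (\<lambda>x. (1 / (2 * \<i>)) * iexp (t \<bullet> x) + (- (1 / (2 * \<i>))) * iexp ((- t) \<bullet> x))"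
    by (simp add: fun_eq_iff sin_of_real[symmetric] sin_exp_eq diff_divide_distrib right_diff_distrib)
  then show ?thesis by (simp only:) (intro trig_poly.intros)
qed

text \<open>A linear functional of the vector of sines is a combination of sines, that is of
  exponentials; products of such functions stay in the class.\<close>

lemma trig_poly_real_polynomial:
  fixes p :: "real ^ 'n \<Rightarrow> real"
  assumes "real_polynomial_function p"
  shows "trig_poly (\<lambda>x. of_real (p (\<chi> i. sin (r * x $ i))))"
  using assms
proof induction
  case (linear p)
  interpret bounded_linear p by (rule linear)
  let ?m = "\<lambda>i x. of_real (p (axis i 1)) * of_real (sin ((r *\<^sub>R axis i 1) \<bullet> x))"
  have m: "trig_poly (?m i)" for i by (intro trig_poly_mult trig_poly_const trig_poly_sin)
  have "trig_poly (\<lambda>x. \<Sum>i\<in>S. ?m i x)" for S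
  proof (induction S rule: infinite_finite_induct)
    case (insert i S)
    then show ?case using trig_poly.add[OF m[of i] insert.IH] by simp
  qed (simp_all add: trig_poly_const)
  moreover have "complex_of_real (p (\<chi> i. sin (r * x $ i))) = (\<Sum>i\<in>UNIV. of_real (p (axis i 1)) * of_real (sin ((r *\<^sub>R axis i 1) \<bullet> x)))" for x :: "real ^ 'n"
  proof -
    have "(\<chi> i. sin (r * x $ i)) = (\<Sum>i\<in>UNIV. sin (r * x $ i) *\<^sub>R axis i (1::real))"
      by (simp add: vec_eq_iff axis_def if_distrib cong: if_cong)
    then have "p (\<chi> i. sin (r * x $ i)) = (\<Sum>i\<in>UNIV. sin (r * x $ i) * p (axis i 1))"
      by (simp only: sum scaleR real_scaleR_def)
    then show ?thesis by (simp add: inner_axis' mult.commute)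
  qed
  ultimately show ?case by simp
next
  case (const c)
  then show ?case by (rule trig_poly_const)
next
  case (add f g)
  then show ?case using trig_poly.add[OF add.IH] by simp
next
  case (mult f g)
  then show ?case using trig_poly_mult[OF mult.IH] by simp
qed

lemma trig_poly_integrable:
  fixes f :: "real ^ 'n \<Rightarrow> complex"
  assumes N: "prob_space N" "sets N = sets borel" and "trig_poly f" shows "integrable N f"
  using assms(3)
proof induction
  case (iexp c t)
  interpret prob_space N by (rule N)
  have [measurable_cong]: "sets N = sets borel" by (rule N)
  have "integrable N (\<lambda>x. iexp (t \<bullet> x))"
    by (rule integrable_const_bound[where B = 1]) (auto simp: norm_exp_i_times)
  then show ?case by simp
qed auto

text \<open>The function \<open>x \<mapsto> arcsin (sin x)\<close> is periodic and the identity on \<open>[- pi / 2, pi / 2]\<close>. Replacing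
  each coordinate by a rescaled version of it turns \<open>\<phi>\<close> into a continuous function of the
  vector \<open>s\<close> of sines, to which the Weierstrass theorem on a compact cube applies. The
  approximation is then uniform on the whole space.\<close>

lemma trig_poly_approximation:
  fixes \<phi> :: "real ^ 'n \<Rightarrow> real"
  assumes \<phi>: "continuous_on UNIV \<phi>" and R: "0 < R" and e: "0 < e" and B: "\<And>x. \<bar>\<phi> x\<bar> \<le> B"
  obtains T where "trig_poly T" "\<And>x. (\<And>i. \<bar>x $ i\<bar> \<le> R) \<Longrightarrow> cmod (T x - of_real (\<phi> x)) \<le> e"
    "\<And>x. cmod (T x) \<le> B + e"
proof -
  \<comment> \<open>The scaling maps \<open>[-R, R]\<close> onto the interval
    \<open>[- pi / 2, pi / 2]\<close> on which \<open>arcsin\<close> inverts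
    \<open>sin\<close>.\<close>
  define r where "r = pi / (2 * R)"
  have r: "0 < r" using R by (simp add: r_def)
  let ?cube = "cbox (- 1) 1 :: (real ^ 'n) set"
  define \<Psi> where "\<Psi> s = \<phi> (\<chi> i. arcsin (s $ i) / r)" for s :: "real ^ 'n"
  have one: "(- 1 :: real ^ 'n) $ i = -1" "(1 :: real ^ 'n) $ i = 1" for i by simp_all
  have cont: "continuous_on ?cube \<Psi>"
    unfolding \<Psi>_def
  proof (rule continuous_on_compose2[OF \<phi>])
    show "continuous_on ?cube (\<lambda>s. \<chi> i. arcsin (s $ i) / r)"
      using r by (intro continuous_on_vec_lambda continuous_intros) (auto simp: mem_box_cart one)
  qed auto
  obtain p where p: "real_polynomial_function p" "\<And>s. s \<in> ?cube \<Longrightarrow> \<bar>\<Psi> s - p s\<bar> < e"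
    using Stone_Weierstrass_real_polynomial_function[OF compact_cbox cont e] by blast
  let ?s = "\<lambda>x :: real ^ 'n. \<chi> i. sin (r * x $ i)"
  have s: "?s x \<in> ?cube" for x by (simp add: mem_box_cart one)
  show ?thesis
  proof (rule that[OF trig_poly_real_polynomial[OF p(1), of r]])
    fix x :: "real ^ 'n" assume x: "\<And>i. \<bar>x $ i\<bar> \<le> R"
    have "arcsin (sin (r * x $ i)) = r * x $ i" for i
    proof (rule arcsin_sin)
      have "r * \<bar>x $ i\<bar> \<le> r * R" using x[of i] r by simp
      also have "r * R = pi / 2" using R by (simp add: r_def)
      finally have "\<bar>r * x $ i\<bar> \<le> pi / 2" using r by (simp add: abs_mult)
      then show "- (pi / 2) \<le> r * x $ i" "r * x $ i \<le> pi / 2" by linarith+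
    qed
    then have "\<Psi> (?s x) = \<phi> x" using r by (simp add: \<Psi>_def)
    then show "cmod (of_real (p (?s x)) - of_real (\<phi> x)) \<le> e"
      using p(2)[OF s[of x]] by (simp only: of_real_diff[symmetric] norm_of_real; linarith)
  next
    fix x :: "real ^ 'n"
    have "\<bar>\<Psi> (?s x)\<bar> \<le> B" by (simp add: \<Psi>_def B)
    then show "cmod (of_real (p (?s x))) \<le> B + e"
      using p(2)[OF s[of x]] by (simp only: norm_of_real; linarith)
  qed
qed

text \<open>Weak convergence tests real functions, so cosine and sine are treated
  separately.\<close>

lemma weak_conv_vec_iexp:
  fixes L :: "nat \<Rightarrow> (real ^ 'n) measure"
  assumes K: "prob_space K" "sets K = sets borel"
    and L: "\<And>n. prob_space (L n)" "\<And>n. sets (L n) = sets borel"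
    and w: "weak_conv_vec L K"
  shows "(\<lambda>n. \<integral>x. iexp (t \<bullet> x) \<partial>L n) \<longlonglongrightarrow> (\<integral>x. iexp (t \<bullet> x) \<partial>K)"
proof -
  have b: "continuous_on UNIV (\<lambda>x. cos (t \<bullet> x))" "continuous_on UNIV (\<lambda>x. sin (t \<bullet> x))"
    "bounded (range (\<lambda>x. cos (t \<bullet> x)))" "bounded (range (\<lambda>x. sin (t \<bullet> x)))"
    by (auto intro!: continuous_intros boundedI[where B = 1])
  have c: "(\<lambda>n. \<integral>x. cos (t \<bullet> x) \<partial>L n) \<longlonglongrightarrow> (\<integral>x. cos (t \<bullet> x) \<partial>K)"
    "(\<lambda>n. \<integral>x. sin (t \<bullet> x) \<partial>L n) \<longlonglongrightarrow> (\<integral>x. sin (t \<bullet> x) \<partial>K)"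
    using w[unfolded weak_conv_vec_def, rule_format, OF conjI] b by blast+
  have e: "(\<integral>x. iexp (t \<bullet> x) \<partial>N) = of_real (\<integral>x. cos (t \<bullet> x) \<partial>N) + \<i> * of_real (\<integral>x. sin (t \<bullet> x) \<partial>N)"
    if N: "prob_space N" "sets N = sets borel" for N :: "(real ^ 'n) measure"
  proof -
    interpret N: prob_space N by (rule N)
    have [measurable_cong]: "sets N = sets borel" by (rule N)
    have "integrable N (\<lambda>x. cos (t \<bullet> x))" "integrable N (\<lambda>x. sin (t \<bullet> x))"
      by (rule N.integrable_const_bound[where B = 1]; simp)+
    then show ?thesis
      by (simp add: exp_Euler cos_of_real sin_of_real flip: of_real_mult)
  qed
  show ?thesis unfolding e[OF K] e[OF L] by (intro tendsto_intros c)
qed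

text \<open>A test function is replaced by a trigonometric polynomial with error \<open>e\<close> on
  a cube and at most \<open>2 B + e\<close> outside, where tightness makes the mass small. Tightness
  is a hypothesis here because in the application it comes directly from second moments.\<close>

lemma levy_continuity_vec:
  fixes L :: "nat \<Rightarrow> (real ^ 'n) measure"
  assumes K: "prob_space K" "sets K = sets borel"
    and L: "\<And>n. prob_space (L n)" "\<And>n. sets (L n) = sets borel"
    and char: "\<And>t. (\<lambda>n. \<integral>x. iexp (t \<bullet> x) \<partial>L n) \<longlonglongrightarrow> (\<integral>x. iexp (t \<bullet> x) \<partial>K)"
    and tight: "\<And>e. 0 < e \<Longrightarrow> \<exists>R>0. \<forall>\<^sub>F n in sequentially. measure (L n) {x. \<exists>i. R < \<bar>x $ i\<bar>} \<le> e"
  shows "weak_conv_vec L K"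
  unfolding weak_conv_vec_def
proof (intro allI impI, elim conjE)
  fix \<phi> :: "real ^ 'n \<Rightarrow> real" assume \<phi>: "continuous_on UNIV \<phi>" "bounded (range \<phi>)"
  then obtain B where B: "0 < B" "\<And>x. \<bar>\<phi> x\<bar> \<le> B" by (auto simp: bounded_pos)
  interpret K: prob_space K by (rule K)
  have [measurable]: "\<phi> \<in> borel_measurable borel" by (rule borel_measurable_continuous_onI[OF \<phi>(1)])
  have out_meas [measurable]: "{x :: real ^ 'n. \<exists>i. R < \<bar>x $ i\<bar>} \<in> sets borel" for R
    by measurable
  have Tconv: "(\<lambda>n. \<integral>x. T x \<partial>L n) \<longlonglongrightarrow> (\<integral>x. T x \<partial>K)" if "trig_poly T" for T
    using that
  proof induction
    case (iexp c t)
    then show ?case using char[of t] by (simp add: tendsto_mult_left)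
  next
    case (add f g)
    have "(\<integral>x. f x + g x \<partial>N) = (\<integral>x. f x \<partial>N) + (\<integral>x. g x \<partial>N)" if "prob_space N" "sets N = sets borel" for N
      using trig_poly_integrable[OF that add.hyps(1)] trig_poly_integrable[OF that add.hyps(2)] by simp
    then show ?case using tendsto_add[OF add.IH] K L by simp
  qed
  have approx: "cmod ((\<integral>x. T x \<partial>N) - of_real (\<integral>x. \<phi> x \<partial>N)) \<le> e + (2 * B + e) * measure N {x. \<exists>i. R < \<bar>x $ i\<bar>}"
    if N: "prob_space N" "sets N = sets borel" and T: "trig_poly T" and e: "0 < e"
      and T1: "\<And>x. (\<And>i. \<bar>x $ i\<bar> \<le> R) \<Longrightarrow> cmod (T x - of_real (\<phi> x)) \<le> e" and T2: "\<And>x. cmod (T x) \<le> B + e" for N T e R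
  proof -
    interpret N: prob_space N by (rule N)
    have [measurable_cong]: "sets N = sets borel" by (rule N)
    let ?O = "{x :: real ^ 'n. \<exists>i. R < \<bar>x $ i\<bar>}"
    have i: "integrable N T" by (rule trig_poly_integrable[OF N T])
    have i\<phi>: "integrable N \<phi>" by (rule N.integrable_const_bound[where B = B]) (auto simp: B)
    have "(\<integral>x. T x \<partial>N) - of_real (\<integral>x. \<phi> x \<partial>N) = (\<integral>x. T x - of_real (\<phi> x) \<partial>N)" using i i\<phi> by simp
    also have "cmod \<dots> \<le> (\<integral>x. cmod (T x - of_real (\<phi> x)) \<partial>N)" by (rule integral_norm_bound)
    also have "\<dots> \<le> (\<integral>x. e + (2 * B + e) * indicator ?O x \<partial>N)"
    proof (rule integral_mono)
      show "integrable N (\<lambda>x. cmod (T x - of_real (\<phi> x)))" using i i\<phi> by simp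
      show "integrable N (\<lambda>x. e + (2 * B + e) * indicator ?O x)"
        by (intro Bochner_Integration.integrable_add integrable_mult_right integrable_real_indicator) (auto simp: N.emeasure_eq_measure)
      fix x
      show "cmod (T x - of_real (\<phi> x)) \<le> e + (2 * B + e) * indicator ?O x"
      proof (cases "x \<in> ?O")
        case True
        have "cmod (T x - of_real (\<phi> x)) \<le> cmod (T x) + \<bar>\<phi> x\<bar>" using norm_triangle_ineq4[of "T x" "of_real (\<phi> x)"] by simp
        also have "\<dots> \<le> (B + e) + B" by (intro add_mono T2 B)
        finally show ?thesis using True e by simp
      next
        case False
        then show ?thesis using T1[of x] by (auto simp: not_less)
      qed
    qed
    also have "\<dots> = e + (2 * B + e) * measure N ?O"
    proof -
      have "integrable N (indicator ?O :: _ \<Rightarrow> real)" by (intro integrable_real_indicator) (auto simp: N.emeasure_eq_measure)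
      then show ?thesis by (simp add: N.prob_space)
    qed
    finally show ?thesis .
  qed
  \<comment> \<open>A single probability measure is tight: the complements of growing cubes decrease
    to the empty set.\<close>
  have tightK: "\<exists>R0. \<forall>R\<ge>R0. measure K {x. \<exists>i. R < \<bar>x $ i\<bar>} < e" if e: "0 < e" for e
  proof -
    have [measurable_cong]: "sets K = sets borel" by (rule K)
    have "(\<lambda>n. measure K {x. \<exists>i. real n < \<bar>x $ i\<bar>}) \<longlonglongrightarrow> measure K (\<Inter>n. {x. \<exists>i. real n < \<bar>x $ i\<bar>})"
    proof (rule K.finite_Lim_measure_decseq)
      show "range (\<lambda>n. {x :: real ^ 'n. \<exists>i. real n < \<bar>x $ i\<bar>}) \<subseteq> K.events" by auto
      show "decseq (\<lambda>n. {x :: real ^ 'n. \<exists>i. real n < \<bar>x $ i\<bar>})"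
        unfolding decseq_def
      proof (intro allI impI Collect_mono, elim exE)
        fix m n :: nat and x :: "real ^ 'n" and i assume "m \<le> n" "real n < \<bar>x $ i\<bar>"
        then have "real m < \<bar>x $ i\<bar>" by linarith
        then show "\<exists>i. real m < \<bar>x $ i\<bar>" by blast
      qed
    qed
    also have "(\<Inter>n. {x :: real ^ 'n. \<exists>i. real n < \<bar>x $ i\<bar>}) = {}"
    proof -
      have "\<exists>n. \<forall>i. \<bar>x $ i\<bar> \<le> real n" for x :: "real ^ 'n"
        using real_arch_simple[of "norm x"] component_le_norm_cart[of x] order_trans by blast
      then show ?thesis by (force simp: not_less[symmetric])
    qed
    finally have "\<forall>\<^sub>F n in sequentially. measure K {x. \<exists>i. real n < \<bar>x $ i\<bar>} < e"
      using e by (auto dest!: order_tendstoD(2)[where a = e])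
    then obtain n where n: "measure K {x. \<exists>i. real n < \<bar>x $ i\<bar>} < e"
      by (meson eventually_sequentially order_refl)
    show ?thesis
    proof (intro exI[of _ "real n"] allI impI)
      fix R :: real assume "real n \<le> R"
      then have "measure K {x. \<exists>i. R < \<bar>x $ i\<bar>} \<le> measure K {x. \<exists>i. real n < \<bar>x $ i\<bar>}"
        by (intro K.finite_measure_mono) (auto intro: order_le_less_trans)
      then show "measure K {x. \<exists>i. R < \<bar>x $ i\<bar>} < e" using n by simp
    qed
  qed
  show "(\<lambda>n. \<integral>x. \<phi> x \<partial>L n) \<longlonglongrightarrow> (\<integral>x. \<phi> x \<partial>K)"
  proof (rule tendstoI)
    fix \<epsilon> :: real assume \<epsilon>: "0 < \<epsilon>"
    \<comment> \<open>With \<open>e \<le> 1\<close> the factor \<open>2 B + e\<close> is at most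
      \<open>2 B + 1\<close>, so each of the two replacement errors is at most \<epsilon>/4; the
      convergence of the polynomial integrals takes another quarter.\<close>
    define e where "e = min 1 (\<epsilon> / 8)"
    define d where "d = \<epsilon> / (8 * (2 * B + 1))"
    have e: "0 < e" "e \<le> 1" "e \<le> \<epsilon> / 8" using \<epsilon> by (auto simp: e_def)
    have d: "0 < d" "(2 * B + e) * d \<le> \<epsilon> / 8"
    proof -
      show "0 < d" using \<epsilon> B by (simp add: d_def)
      then have "(2 * B + e) * d \<le> (2 * B + 1) * d" using e by simp
      also have "\<dots> = \<epsilon> / 8" using B by (simp add: d_def field_simps)
      finally show "(2 * B + e) * d \<le> \<epsilon> / 8" .
    qed
    obtain R1 where R1: "0 < R1" "\<forall>\<^sub>F n in sequentially. measure (L n) {x. \<exists>i. R1 < \<bar>x $ i\<bar>} \<le> d"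
      using tight[OF d(1)] by auto
    obtain R0 where R0: "\<And>R. R0 \<le> R \<Longrightarrow> measure K {x. \<exists>i. R < \<bar>x $ i\<bar>} < d" using tightK[OF d(1)] by auto
    define R where "R = max R0 R1"
    have R: "0 < R" using R1 by (simp add: R_def)
    obtain T where T: "trig_poly T" "\<And>x. (\<And>i. \<bar>x $ i\<bar> \<le> R) \<Longrightarrow> cmod (T x - of_real (\<phi> x)) \<le> e" "\<And>x. cmod (T x) \<le> B + e"
      using trig_poly_approximation[OF \<phi>(1) R e(1) B(2)] by metis
    have KT: "cmod ((\<integral>x. T x \<partial>K) - of_real (\<integral>x. \<phi> x \<partial>K)) \<le> e + (2 * B + e) * d"
    proof -
      have "cmod ((\<integral>x. T x \<partial>K) - of_real (\<integral>x. \<phi> x \<partial>K)) \<le> e + (2 * B + e) * measure K {x. \<exists>i. R < \<bar>x $ i\<bar>}"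
        by (rule approx[OF K T(1) e(1)]) (fact T)+
      also have "\<dots> \<le> e + (2 * B + e) * d"
        using R0[of R] B(1) e(1) by (intro add_left_mono mult_left_mono) (auto simp only: R_def max.cobounded1 intro: less_imp_le)
      finally show ?thesis .
    qed
    have "\<forall>\<^sub>F n in sequentially. dist (\<integral>x. T x \<partial>L n) (\<integral>x. T x \<partial>K) < \<epsilon> / 4"
      using tendstoD[OF Tconv[OF T(1)], of "\<epsilon> / 4"] \<epsilon> by simp
    with R1(2) show "\<forall>\<^sub>F n in sequentially. dist (\<integral>x. \<phi> x \<partial>L n) (\<integral>x. \<phi> x \<partial>K) < \<epsilon>"
    proof eventually_elim
      case (elim n)
      interpret Ln: prob_space "L n" by (rule L)
      have "measure (L n) {x. \<exists>i. R < \<bar>x $ i\<bar>} \<le> measure (L n) {x. \<exists>i. R1 < \<bar>x $ i\<bar>}"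
        using L(2)[of n] by (intro Ln.finite_measure_mono) (auto simp: R_def)
      then have "measure (L n) {x. \<exists>i. R < \<bar>x $ i\<bar>} \<le> d" using elim(1) by simp
      then have "(2 * B + e) * measure (L n) {x. \<exists>i. R < \<bar>x $ i\<bar>} \<le> (2 * B + e) * d"
        using B e by (intro mult_left_mono) auto
      moreover have "cmod ((\<integral>x. T x \<partial>L n) - of_real (\<integral>x. \<phi> x \<partial>L n)) \<le> e + (2 * B + e) * measure (L n) {x. \<exists>i. R < \<bar>x $ i\<bar>}"
        by (rule approx[OF L T(1) e(1)]) (fact T)+
      ultimately have LT: "cmod ((\<integral>x. T x \<partial>L n) - of_real (\<integral>x. \<phi> x \<partial>L n)) \<le> e + (2 * B + e) * d"
        by linarith
      have "dist (\<integral>x. \<phi> x \<partial>L n) (\<integral>x. \<phi> x \<partial>K) = cmod (of_real (\<integral>x. \<phi> x \<partial>L n) - of_real (\<integral>x. \<phi> x \<partial>K))"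
        by (simp add: dist_real_def flip: of_real_diff)
      also have "\<dots> \<le> cmod ((\<integral>x. T x \<partial>L n) - of_real (\<integral>x. \<phi> x \<partial>L n)) + dist (\<integral>x. T x \<partial>L n) (\<integral>x. T x \<partial>K)
          + cmod ((\<integral>x. T x \<partial>K) - of_real (\<integral>x. \<phi> x \<partial>K))"
        unfolding dist_norm by norm
      finally show ?case using KT LT elim(2) d(2) e \<epsilon> by linarith
    qed
  qed
qed

subsection \<open>Homogeneous sums, contractions and multiple integrals\<close>

text \<open>Literally the term by which \<open>contraction\<close> assembles the arguments of its
  kernel, so that unfolding identifies the two.\<close>

definition cat :: "nat \<Rightarrow> nat \<Rightarrow> (nat \<Rightarrow> 'a) \<Rightarrow> (nat \<Rightarrow> 'a) \<Rightarrow> nat \<Rightarrow> 'a" where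
  "cat r q a b = (\<lambda>k\<in>{..<q}. if k < r then a k else b (k - r))"

lemma finite_index_tuples [simp]: "finite (index_tuples q N)"
  by (simp add: index_tuples_def finite_PiE)

lemma sum_index_tuples_cat:
  "(\<Sum>i\<in>index_tuples (r + s) N. F i) = (\<Sum>a\<in>index_tuples r N. \<Sum>b\<in>index_tuples s N. F (cat r (r + s) a b))"
proof -
  have "(\<Sum>i\<in>index_tuples (r + s) N. F i) = (\<Sum>(a, b)\<in>index_tuples r N \<times> index_tuples s N. F (cat r (r + s) a b))"
  proof (rule sum.reindex_bij_witness[where i = "\<lambda>(a, b). cat r (r + s) a b" and
        j = "\<lambda>i. (restrict i {..<r}, \<lambda>k\<in>{..<s}. i (r + k))"], goal_cases)
    case (1 i)
    then show ?case by (auto simp: index_tuples_def cat_def PiE_iff extensional_def fun_eq_iff)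
  next
    case (2 i)
    then show ?case by (auto simp: index_tuples_def PiE_iff)
  next
    case (3 p)
    then show ?case by (auto simp: index_tuples_def cat_def PiE_iff extensional_def fun_eq_iff)
  next
    case (4 p)
    then show ?case by (auto simp: index_tuples_def cat_def PiE_iff extensional_def)
  next
    case (5 i)
    then have "cat r (r + s) (restrict i {..<r}) (\<lambda>k\<in>{..<s}. i (r + k)) = i"
      by (auto simp: index_tuples_def cat_def PiE_iff extensional_def fun_eq_iff)
    then show ?case by simp
  qed
  then show ?thesis by (simp add: sum.cartesian_product)
qed

lemma cat_in_index_tuples:
  "a \<in> index_tuples r N \<Longrightarrow> b \<in> index_tuples s N \<Longrightarrow> cat r (r + s) a b \<in> index_tuples (r + s) N"
  by (auto simp: index_tuples_def cat_def PiE_iff)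

lemma lessThan_add_eq: "{..<r + s :: nat} = {..<r} \<union> (\<lambda>k. r + k) ` {..<s}"
proof (intro set_eqI iffI)
  fix k assume k: "k \<in> {..<r + s}"
  show "k \<in> {..<r} \<union> (\<lambda>k. r + k) ` {..<s}"
  proof (cases "k < r")
    case False
    then have "k = r + (k - r)" "k - r < s" using k by auto
    then show ?thesis by blast
  qed simp
qed auto

lemma prod_cat:
  "(\<Prod>k<r + s. h (cat r (r + s) a b k) (cat r (r + s) x y k)) = (\<Prod>k<r. h (a k) (x k)) * (\<Prod>k<s. h (b k) (y k) :: real)"
proof -
  have "(\<Prod>k<r + s. h (cat r (r + s) a b k) (cat r (r + s) x y k))
    = (\<Prod>k<r. h (cat r (r + s) a b k) (cat r (r + s) x y k)) * (\<Prod>k\<in>(\<lambda>k. r + k) ` {..<s}. h (cat r (r + s) a b k) (cat r (r + s) x y k))"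
    unfolding lessThan_add_eq[of r s] by (rule prod.union_disjoint) auto
  also have "\<dots> = (\<Prod>k<r. h (a k) (x k)) * (\<Prod>k<s. h (b k) (y k))"
    by (subst prod.reindex) (auto simp: cat_def intro!: arg_cong2[where f = "(*)"] prod.cong)
  finally show ?thesis .
qed

text \<open>An arbitrary enumeration of \<open>A\<close>; for a symmetric kernel the choice does not
  affect the value. Extensionality makes it an index tuple.\<close>

definition enum_tuple :: "nat \<Rightarrow> nat set \<Rightarrow> nat \<Rightarrow> nat" where
  "enum_tuple q A = (SOME i. i \<in> extensional {..<q} \<and> bij_betw i {..<q} A)"

text \<open>The coefficient of \<open>\<Prod>c\<in>A. y c\<close> in a homogeneous sum collects the \<open>q!\<close> tuples enumerating \<open>A\<close>.\<close>

definition set_coeff :: "nat \<Rightarrow> nat \<Rightarrow> ((nat \<Rightarrow> nat) \<Rightarrow> real) \<Rightarrow> nat set \<Rightarrow> real" where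
  "set_coeff q N f A = (if A \<subseteq> {1..N} \<and> card A = q then fact q * f (enum_tuple q A) else 0)"

lemma set_coeff_card: "set_coeff q N f A \<noteq> 0 \<Longrightarrow> card A = q"
  and set_coeff_subset: "set_coeff q N f A \<noteq> 0 \<Longrightarrow> A \<subseteq> {1..N}"
  by (auto simp: set_coeff_def split: if_splits)

lemma enum_tuple:
  assumes "finite A" "card A = q"
  shows "enum_tuple q A \<in> extensional {..<q}" "bij_betw (enum_tuple q A) {..<q} A"
proof -
  obtain h where "bij_betw h {..<q} A"
    using assms finite_same_card_bij[of "{..<q}" A] by auto
  then have "\<exists>i. i \<in> extensional {..<q} \<and> bij_betw i {..<q} A"
    using bij_betw_cong[of "{..<q}" "restrict h {..<q}" h A] by (intro exI[of _ "restrict h {..<q}"]) simp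
  from someI_ex[OF this] show "enum_tuple q A \<in> extensional {..<q}" "bij_betw (enum_tuple q A) {..<q} A"
    by (auto simp: enum_tuple_def)
qed

lemma index_tuple_eq_set_coeff:
  assumes sym: "symmetric_on_tuples q N f" and diag: "vanishes_on_diagonals q N f" and i: "i \<in> index_tuples q N"
  shows "f i = (if inj_on i {..<q} then set_coeff q N f (i ` {..<q}) / fact q else 0)"
proof (cases "inj_on i {..<q}")
  case True
  let ?A = "i ` {..<q}" and ?e = "enum_tuple q (i ` {..<q})"
  have A: "finite ?A" "card ?A = q" "?A \<subseteq> {1..N}"
    using True i by (auto simp: card_image index_tuples_def)
  note e = enum_tuple[OF A(1,2)]
  have bi: "bij_betw i {..<q} ?A" using True by (simp add: inj_on_imp_bij_betw)
  \<comment> \<open>The permutation of positions that carries \<open>i\<close> to the chosen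
    enumeration of its image. It is the identity outside the positions, where both tuples are
    undefined.\<close>
  define \<pi> where "\<pi> k = (if k < q then inv_into {..<q} i (?e k) else k)" for k
  have "bij_betw \<pi> {..<q} {..<q}"
    using bij_betw_trans[OF e(2) bij_betw_inv_into[OF bi]] by (rule bij_betw_cong[THEN iffD1, rotated]) (auto simp: \<pi>_def)
  then have "\<pi> permutes {..<q}" by (rule bij_imp_permutes) (auto simp: \<pi>_def)
  moreover have "i \<circ> \<pi> = ?e"
  proof
    fix k show "(i \<circ> \<pi>) k = ?e k"
    proof (cases "k < q")
      case True
      then have "?e k \<in> ?A" using e(2) by (auto simp: bij_betw_def)
      then show ?thesis using True by (simp add: \<pi>_def f_inv_into_f)
    next
      case False
      then show ?thesis using e(1) i by (simp add: \<pi>_def index_tuples_def PiE_iff extensional_def)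
    qed
  qed
  ultimately have "f i = f ?e" using sym i by (metis symmetric_on_tuples_def)
  then show ?thesis using True A by (simp add: set_coeff_def)
next
  case False
  then have "\<exists>k<q. \<exists>l<q. k \<noteq> l \<and> i k = i l" by (auto simp: inj_on_def)
  then show ?thesis using diag i False by (auto simp: vanishes_on_diagonals_def)
qed

text \<open>Composition of the fixed enumeration with permutations of the positions reaches every
  enumeration of \<open>A\<close> exactly once.\<close>

lemma card_injective_tuples:
  assumes "A \<subseteq> {1..N}" "card A = q"
  shows "card {i \<in> index_tuples q N. inj_on i {..<q} \<and> i ` {..<q} = A} = fact q"
proof -
  have A: "finite A" using assms by (auto intro: finite_subset)
  note e = enum_tuple[OF A assms(2)]
  have eA: "enum_tuple q A k \<in> A" if "k < q" for k using e(2) that by (auto simp: bij_betw_def)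
  have "bij_betw (\<lambda>\<pi>. enum_tuple q A \<circ> \<pi>) {\<pi>. \<pi> permutes {..<q}} {i \<in> index_tuples q N. inj_on i {..<q} \<and> i ` {..<q} = A}"
  proof (rule bij_betw_byWitness[where f' = "\<lambda>i k. if k < q then inv_into {..<q} (enum_tuple q A) (i k) else k"])
    show "\<forall>\<pi>\<in>{\<pi>. \<pi> permutes {..<q}}. (\<lambda>k. if k < q then inv_into {..<q} (enum_tuple q A) ((enum_tuple q A \<circ> \<pi>) k) else k) = \<pi>"
    proof (intro ballI ext)
      fix \<pi> k assume "\<pi> \<in> {\<pi>. \<pi> permutes {..<q}}"
      then have p: "\<pi> permutes {..<q}" by simp
      show "(if k < q then inv_into {..<q} (enum_tuple q A) ((enum_tuple q A \<circ> \<pi>) k) else k) = \<pi> k"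
      proof (cases "k < q")
        case True
        then have "\<pi> k \<in> {..<q}" using permutes_in_image[OF p, of k] by simp
        then show ?thesis using True e(2) by (simp add: bij_betw_def inv_into_f_f)
      qed (use permutes_not_in[OF p, of k] in simp)
    qed
    show "\<forall>i\<in>{i \<in> index_tuples q N. inj_on i {..<q} \<and> i ` {..<q} = A}.
        enum_tuple q A \<circ> (\<lambda>k. if k < q then inv_into {..<q} (enum_tuple q A) (i k) else k) = i"
    proof (intro ballI ext)
      fix i k assume i: "i \<in> {i \<in> index_tuples q N. inj_on i {..<q} \<and> i ` {..<q} = A}"
      show "(enum_tuple q A \<circ> (\<lambda>k. if k < q then inv_into {..<q} (enum_tuple q A) (i k) else k)) k = i k"
      proof (cases "k < q")
        case True
        then have "i k \<in> enum_tuple q A ` {..<q}" using i e(2) by (auto simp: bij_betw_def)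
        then show ?thesis using True by (simp add: f_inv_into_f)
      next
        case False
        then show ?thesis using i e(1) by (simp add: index_tuples_def PiE_iff extensional_def)
      qed
    qed
    show "(\<lambda>\<pi>. enum_tuple q A \<circ> \<pi>) ` {\<pi>. \<pi> permutes {..<q}} \<subseteq> {i \<in> index_tuples q N. inj_on i {..<q} \<and> i ` {..<q} = A}"
    proof clarify
      fix \<pi> assume p: "\<pi> permutes {..<q}"
      have b: "bij_betw (enum_tuple q A \<circ> \<pi>) {..<q} A"
        using bij_betw_trans[OF permutes_imp_bij[OF p] e(2)] .
      have "enum_tuple q A \<circ> \<pi> \<in> index_tuples q N"
        unfolding index_tuples_def
      proof (rule PiE_I)
        fix k assume "k \<in> {..<q}"
        then show "(enum_tuple q A \<circ> \<pi>) k \<in> {1..N}" using bij_betwE[OF b] assms(1) by auto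
      next
        fix k assume "k \<notin> {..<q}"
        then show "(enum_tuple q A \<circ> \<pi>) k = undefined"
          using permutes_not_in[OF p, of k] e(1) by (simp add: extensional_def)
      qed
      then show "enum_tuple q A \<circ> \<pi> \<in> index_tuples q N \<and> inj_on (enum_tuple q A \<circ> \<pi>) {..<q} \<and> (enum_tuple q A \<circ> \<pi>) ` {..<q} = A"
        using b by (auto simp: bij_betw_def)
    qed
    show "(\<lambda>i k. if k < q then inv_into {..<q} (enum_tuple q A) (i k) else k) ` {i \<in> index_tuples q N. inj_on i {..<q} \<and> i ` {..<q} = A} \<subseteq> {\<pi>. \<pi> permutes {..<q}}"
    proof clarify
      fix i assume i: "inj_on i {..<q}" "A = i ` {..<q}"
      have "bij_betw i {..<q} A" using i by (simp add: inj_on_imp_bij_betw)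
      from bij_betw_trans[OF this bij_betw_inv_into[OF e(2)]]
      have "bij_betw (\<lambda>k. if k < q then inv_into {..<q} (enum_tuple q A) (i k) else k) {..<q} {..<q}"
        by (rule bij_betw_cong[THEN iffD1, rotated]) auto
      then show "(\<lambda>k. if k < q then inv_into {..<q} (enum_tuple q (i ` {..<q})) (i k) else k) permutes {..<q}"
        unfolding i(2) by (rule bij_imp_permutes) auto
    qed
  qed
  then have "card {\<pi>. \<pi> permutes {..<q}} = card {i \<in> index_tuples q N. inj_on i {..<q} \<and> i ` {..<q} = A}"
    by (rule bij_betw_same_card)
  then show ?thesis by (simp add: card_permutations)
qed

text \<open>The tuples are grouped by their image, and each set of size \<open>q\<close> has
  \<open>fact q\<close> injective enumerations.\<close>

lemma sum_index_tuples_image: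
  fixes \<phi> :: "nat set \<Rightarrow> real"
  shows "(\<Sum>i\<in>index_tuples q N. if inj_on i {..<q} then \<phi> (i ` {..<q}) else 0)
    = fact q * (\<Sum>A | A \<subseteq> {1..N} \<and> card A = q. \<phi> A)"
proof -
  let ?T = "{i \<in> index_tuples q N. inj_on i {..<q}}" and ?S = "{A. A \<subseteq> {1..N} \<and> card A = q}"
  have fin: "finite ?S" by (rule finite_subset[of _ "Pow {1..N}"]) auto
  have "(\<Sum>i\<in>index_tuples q N. if inj_on i {..<q} then \<phi> (i ` {..<q}) else 0) = (\<Sum>i\<in>?T. \<phi> (i ` {..<q}))"
    by (rule sum.inter_filter[symmetric]) simp
  also have "\<dots> = (\<Sum>A\<in>?S. \<Sum>i\<in>{i \<in> ?T. i ` {..<q} = A}. \<phi> (i ` {..<q}))"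
  proof (rule sum.group[symmetric, OF _ fin])
    show "(\<lambda>i. i ` {..<q}) ` ?T \<subseteq> ?S"
    proof (rule image_subsetI)
      fix i assume "i \<in> ?T"
      then have "inj_on i {..<q}" "i ` {..<q} \<subseteq> {1..N}" by (auto simp: index_tuples_def)
      then show "i ` {..<q} \<in> ?S" by (simp add: card_image)
    qed
  qed simp
  also have "\<dots> = (\<Sum>A\<in>?S. fact q * \<phi> A)"
  proof (rule sum.cong[OF refl])
    fix A assume A: "A \<in> ?S"
    have "(\<Sum>i\<in>{i \<in> ?T. i ` {..<q} = A}. \<phi> (i ` {..<q})) = (\<Sum>i\<in>{i \<in> index_tuples q N. inj_on i {..<q} \<and> i ` {..<q} = A}. \<phi> A)"
      by (rule sum.cong) auto
    also have "\<dots> = fact q * \<phi> A" using A by (simp add: card_injective_tuples)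
    finally show "(\<Sum>i\<in>{i \<in> ?T. i ` {..<q} = A}. \<phi> (i ` {..<q})) = fact q * \<phi> A" .
  qed
  finally show ?thesis by (simp add: sum_distrib_left)
qed

text \<open>Allows components with different ranges \<open>N j n\<close> to live on one common index
  set.\<close>

lemma contr_superset:
  assumes V: "finite V" "U \<subseteq> V" and a: "\<And>A. a A \<noteq> 0 \<Longrightarrow> A \<subseteq> U"
  shows "contr V r a a = contr U r a a"
proof -
  have z: "djoin a K A = 0" if "\<not> (K \<subseteq> U \<and> A \<subseteq> U)" for K A
    using a[of "K \<union> A"] that by (auto simp: djoin_def)
  have inner: "(\<Sum>K | K \<subseteq> V \<and> card K = r. djoin a K A * djoin a K B) = (\<Sum>K | K \<subseteq> U \<and> card K = r. djoin a K A * djoin a K B)" for A B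
  proof (rule sum.mono_neutral_right)
    show "\<forall>K\<in>{K. K \<subseteq> V \<and> card K = r} - {K. K \<subseteq> U \<and> card K = r}. djoin a K A * djoin a K B = 0"
    proof
      fix K assume "K \<in> {K. K \<subseteq> V \<and> card K = r} - {K. K \<subseteq> U \<and> card K = r}"
      then have "\<not> K \<subseteq> U" by auto
      then show "djoin a K A * djoin a K B = 0" using z[of K A] by simp
    qed
  qed (use V in auto)
  have "contr V r a a = (\<Sum>(A, B)\<in>Pow V \<times> Pow V. (\<Sum>K | K \<subseteq> U \<and> card K = r. djoin a K A * djoin a K B)\<^sup>2)"
    by (simp add: contr_def inner sum.cartesian_product)
  also have "\<dots> = (\<Sum>(A, B)\<in>Pow U \<times> Pow U. (\<Sum>K | K \<subseteq> U \<and> card K = r. djoin a K A * djoin a K B)\<^sup>2)"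
  proof (rule sum.mono_neutral_right)
    show "\<forall>p\<in>Pow V \<times> Pow V - Pow U \<times> Pow U. (case p of (A, B) \<Rightarrow> (\<Sum>K | K \<subseteq> U \<and> card K = r. djoin a K A * djoin a K B)\<^sup>2) = 0"
    proof
      fix p assume p: "p \<in> Pow V \<times> Pow V - Pow U \<times> Pow U"
      obtain A B where "p = (A, B)" by (cases p)
      moreover from this have "djoin a K A * djoin a K B = 0" for K using z[of K A] z[of K B] p by auto
      ultimately show "(case p of (A, B) \<Rightarrow> (\<Sum>K | K \<subseteq> U \<and> card K = r. djoin a K A * djoin a K B)\<^sup>2) = 0"
        by (auto intro!: sum.neutral)
    qed
  qed (use V in auto)
  finally show ?thesis by (simp add: contr_def sum.cartesian_product)
qed

text \<open>Each kernel value is a set coefficient divided by \<open>fact (r + s)\<close>, and the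
  sum over \<open>a\<close> runs through every block \<open>fact r\<close> times. Both enter the
  square; the two outer sums over tuples contribute \<open>fact s\<close> each.\<close>

lemma sum_square_index_tuples_eq_contr:
  assumes sym: "symmetric_on_tuples (r + s) N f" and diag: "vanishes_on_diagonals (r + s) N f"
  shows "(\<Sum>b\<in>index_tuples s N. \<Sum>c\<in>index_tuples s N.
      (\<Sum>a\<in>index_tuples r N. f (cat r (r + s) a b) * f (cat r (r + s) a c))\<^sup>2)
    = (fact s * fact r / (fact (r + s))\<^sup>2)\<^sup>2 * contr {1..N} r (set_coeff (r + s) N f) (set_coeff (r + s) N f)"
proof -
  let ?a = "set_coeff (r + s) N f" and ?q = "fact (r + s) :: real" and ?V = "{1..N}"
  define D where "D K B C = djoin ?a K B * djoin ?a K C" for K B C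
  have fcat: "f (cat r (r + s) a b) = (if inj_on a {..<r} then if inj_on b {..<s} then djoin ?a (a ` {..<r}) (b ` {..<s}) / ?q else 0 else 0)"
    if a: "a \<in> index_tuples r N" and b: "b \<in> index_tuples s N" for a b
  proof -
    let ?i = "cat r (r + s) a b"
    have im: "?i ` {..<r + s} = a ` {..<r} \<union> b ` {..<s}"
    proof -
      have "?i ` {..<r + s} = ?i ` {..<r} \<union> (\<lambda>k. ?i (r + k)) ` {..<s}"
        unfolding lessThan_add_eq[of r s] by (simp add: image_Un image_image)
      also have "?i ` {..<r} = a ` {..<r}" by (intro image_cong) (auto simp: cat_def)
      also have "(\<lambda>k. ?i (r + k)) ` {..<s} = b ` {..<s}" by (intro image_cong) (auto simp: cat_def)
      finally show ?thesis .
    qed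
    \<comment> \<open>Injectivity is decided by counting: the image has \<open>r + s\<close>
      elements only if both parts are injective with disjoint images. Disjointness is the condition
      in \<open>djoin\<close>.\<close>
    have "inj_on ?i {..<r + s} \<longleftrightarrow> inj_on a {..<r} \<and> inj_on b {..<s} \<and> a ` {..<r} \<inter> b ` {..<s} = {}"
    proof -
      have "inj_on ?i {..<r + s} \<longleftrightarrow> card (a ` {..<r} \<union> b ` {..<s}) = r + s"
        unfolding im[symmetric] by (subst inj_on_iff_eq_card) auto
      also have "\<dots> \<longleftrightarrow> inj_on a {..<r} \<and> inj_on b {..<s} \<and> a ` {..<r} \<inter> b ` {..<s} = {}"
      proof
        assume c: "card (a ` {..<r} \<union> b ` {..<s}) = r + s"
        have "card (a ` {..<r}) \<le> r" "card (b ` {..<s}) \<le> s" using card_image_le[of "{..<r}" a] card_image_le[of "{..<s}" b] by auto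
        moreover have "card (a ` {..<r}) + card (b ` {..<s}) = r + s + card (a ` {..<r} \<inter> b ` {..<s})"
          using card_Un_Int[of "a ` {..<r}" "b ` {..<s}"] c by simp
        ultimately have "card (a ` {..<r}) = r" "card (b ` {..<s}) = s" "card (a ` {..<r} \<inter> b ` {..<s}) = 0" by linarith+
        then show "inj_on a {..<r} \<and> inj_on b {..<s} \<and> a ` {..<r} \<inter> b ` {..<s} = {}"
          by (auto simp: inj_on_iff_eq_card)
      next
        assume "inj_on a {..<r} \<and> inj_on b {..<s} \<and> a ` {..<r} \<inter> b ` {..<s} = {}"
        then show "card (a ` {..<r} \<union> b ` {..<s}) = r + s"
          by (subst card_Un_disjoint) (auto simp: card_image)
      qed
      finally show ?thesis .
    qed
    then show ?thesis
      using index_tuple_eq_set_coeff[OF sym diag cat_in_index_tuples[OF a b]] by (auto simp: im djoin_def)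
  qed
  have inner: "(\<Sum>a\<in>index_tuples r N. f (cat r (r + s) a b) * f (cat r (r + s) a c))
    = (if inj_on b {..<s} then if inj_on c {..<s} then fact r / ?q\<^sup>2 * (\<Sum>K | K \<subseteq> ?V \<and> card K = r. D K (b ` {..<s}) (c ` {..<s})) else 0 else 0)"
    if b: "b \<in> index_tuples s N" and c: "c \<in> index_tuples s N" for b c
  proof (cases "inj_on b {..<s} \<and> inj_on c {..<s}")
    case True
    have "(\<Sum>a\<in>index_tuples r N. f (cat r (r + s) a b) * f (cat r (r + s) a c))
      = (\<Sum>a\<in>index_tuples r N. if inj_on a {..<r} then D (a ` {..<r}) (b ` {..<s}) (c ` {..<s}) / ?q\<^sup>2 else 0)"
      using True b c by (intro sum.cong refl) (simp add: fcat D_def power2_eq_square)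
    also have "\<dots> = fact r * (\<Sum>K | K \<subseteq> ?V \<and> card K = r. D K (b ` {..<s}) (c ` {..<s}) / ?q\<^sup>2)"
      by (rule sum_index_tuples_image)
    finally show ?thesis using True by (simp add: sum_divide_distrib[symmetric])
  next
    case False
    then have "f (cat r (r + s) a b) * f (cat r (r + s) a c) = 0" if "a \<in> index_tuples r N" for a
      using fcat[OF that b] fcat[OF that c] by auto
    then show ?thesis using False by (auto intro!: sum.neutral)
  qed
  let ?h = "\<lambda>B C. (fact r / ?q\<^sup>2 * (\<Sum>K | K \<subseteq> ?V \<and> card K = r. D K B C))\<^sup>2"
  have "(\<Sum>b\<in>index_tuples s N. \<Sum>c\<in>index_tuples s N. (\<Sum>a\<in>index_tuples r N. f (cat r (r + s) a b) * f (cat r (r + s) a c))\<^sup>2)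
    = (\<Sum>b\<in>index_tuples s N. if inj_on b {..<s} then (\<Sum>c\<in>index_tuples s N. if inj_on c {..<s} then ?h (b ` {..<s}) (c ` {..<s}) else 0) else 0)"
    by (intro sum.cong refl) (auto simp: inner intro!: sum.cong)
  also have "\<dots> = (\<Sum>b\<in>index_tuples s N. if inj_on b {..<s} then fact s * (\<Sum>C | C \<subseteq> ?V \<and> card C = s. ?h (b ` {..<s}) C) else 0)"
  proof (rule sum.cong[OF refl])
    fix b
    show "(if inj_on b {..<s} then (\<Sum>c\<in>index_tuples s N. if inj_on c {..<s} then ?h (b ` {..<s}) (c ` {..<s}) else 0) else 0)
      = (if inj_on b {..<s} then fact s * (\<Sum>C | C \<subseteq> ?V \<and> card C = s. ?h (b ` {..<s}) C) else 0)"
      by (simp only: sum_index_tuples_image[where \<phi> = "?h (b ` {..<s})"])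
  qed
  also have "\<dots> = fact s * (\<Sum>B | B \<subseteq> ?V \<and> card B = s. fact s * (\<Sum>C | C \<subseteq> ?V \<and> card C = s. ?h B C))"
    by (rule sum_index_tuples_image[where \<phi> = "\<lambda>B. fact s * (\<Sum>C | C \<subseteq> ?V \<and> card C = s. ?h B C)"])
  also have "\<dots> = (fact s * fact r / ?q\<^sup>2)\<^sup>2 * (\<Sum>B | B \<subseteq> ?V \<and> card B = s. \<Sum>C | C \<subseteq> ?V \<and> card C = s. (\<Sum>K | K \<subseteq> ?V \<and> card K = r. D K B C)\<^sup>2)"
  proof -
    have "c * (c * (k\<^sup>2 * T)) = (c * k)\<^sup>2 * T" for c k T :: real by (simp add: power2_eq_square)
    then show ?thesis
      by (simp only: power_mult_distrib[of "fact r / ?q\<^sup>2"] sum_distrib_left[symmetric] times_divide_eq_right[symmetric])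
  qed
  also have "(\<Sum>B | B \<subseteq> ?V \<and> card B = s. \<Sum>C | C \<subseteq> ?V \<and> card C = s. (\<Sum>K | K \<subseteq> ?V \<and> card K = r. D K B C)\<^sup>2) = contr ?V r ?a ?a"
  proof -
    have z: "djoin ?a K B = 0" if "card K = r" "K \<subseteq> ?V" "B \<subseteq> ?V" "card B \<noteq> s" for K B
    proof (rule ccontr)
      assume "djoin ?a K B \<noteq> 0"
      then have "K \<inter> B = {}" "card (K \<union> B) = r + s"
        using set_coeff_card[of "r + s" N f "K \<union> B"] by (auto simp: djoin_def split: if_splits)
      moreover have "finite K" "finite B" using that by (auto intro: finite_subset)
      ultimately show False using that card_Un_disjoint[of K B] by simp
    qed
    have "contr ?V r ?a ?a = (\<Sum>(B, C)\<in>Pow ?V \<times> Pow ?V. (\<Sum>K | K \<subseteq> ?V \<and> card K = r. D K B C)\<^sup>2)"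
      by (simp add: contr_def D_def sum.cartesian_product)
    also have "\<dots> = (\<Sum>(B, C)\<in>{B. B \<subseteq> ?V \<and> card B = s} \<times> {B. B \<subseteq> ?V \<and> card B = s}. (\<Sum>K | K \<subseteq> ?V \<and> card K = r. D K B C)\<^sup>2)"
    proof (rule sum.mono_neutral_right)
      show "\<forall>p\<in>Pow ?V \<times> Pow ?V - {B. B \<subseteq> ?V \<and> card B = s} \<times> {B. B \<subseteq> ?V \<and> card B = s}. (case p of (B, C) \<Rightarrow> (\<Sum>K | K \<subseteq> ?V \<and> card K = r. D K B C)\<^sup>2) = 0"
      proof
        fix p assume p: "p \<in> Pow ?V \<times> Pow ?V - {B. B \<subseteq> ?V \<and> card B = s} \<times> {B. B \<subseteq> ?V \<and> card B = s}"
        obtain B C where BC: "p = (B, C)" by (cases p)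
        have "(\<Sum>K | K \<subseteq> ?V \<and> card K = r. D K B C) = 0"
          using p z[of _ B] z[of _ C] by (intro sum.neutral) (auto simp: D_def BC)
        then show "(case p of (B, C) \<Rightarrow> (\<Sum>K | K \<subseteq> ?V \<and> card K = r. D K B C)\<^sup>2) = 0" by (simp add: BC)
      qed
    qed auto
    finally show ?thesis by (simp add: sum.cartesian_product)
  qed
  finally show ?thesis .
qed

text \<open>The \<open>fact q\<close> tuples with the same image cancel the factorial in the
  relation between \<open>f\<close> and \<open>set_coeff\<close>. The index set \<open>V\<close> may
  exceed the range, since the coefficients vanish there.\<close>

lemma hom_sum_eq_mform:
  assumes sym: "symmetric_on_tuples q N f" and diag: "vanishes_on_diagonals q N f"
    and V: "finite V" "{1..N} \<subseteq> V"
  shows "hom_sum q N f X \<omega> = mform V (set_coeff q N f) (\<lambda>c. X c \<omega>)"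
proof -
  let ?a = "set_coeff q N f"
  have "hom_sum q N f X \<omega> = (\<Sum>i\<in>index_tuples q N. if inj_on i {..<q} then ?a (i ` {..<q}) / fact q * (\<Prod>c\<in>i ` {..<q}. X c \<omega>) else 0)"
    unfolding hom_sum_def
    by (intro sum.cong refl) (auto simp: index_tuple_eq_set_coeff[OF sym diag] prod.reindex)
  also have "\<dots> = fact q * (\<Sum>A | A \<subseteq> {1..N} \<and> card A = q. ?a A / fact q * (\<Prod>c\<in>A. X c \<omega>))"
    by (rule sum_index_tuples_image)
  also have "\<dots> = (\<Sum>A | A \<subseteq> {1..N} \<and> card A = q. ?a A * (\<Prod>c\<in>A. X c \<omega>))"
    by (simp add: sum_distrib_left)
  also have "\<dots> = mform V ?a (\<lambda>c. X c \<omega>)"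
    unfolding mform_def
  proof (rule sum.mono_neutral_left)
    show "\<forall>A\<in>Pow V - {A. A \<subseteq> {1..N} \<and> card A = q}. ?a A * (\<Prod>c\<in>A. X c \<omega>) = 0"
      by (auto simp: set_coeff_def)
  qed (use V in auto)
  finally show ?thesis .
qed

section \<open>Contractions of tensor sums over an orthonormal family\<close>

lemma index_tuple_bounds:
  assumes "i \<in> index_tuples q N" "k < q" shows "1 \<le> i k" "i k \<in> {1..N}"
  using PiE_mem[of i "{..<q}" "\<lambda>_. {1..N}" k] assms by (simp_all add: index_tuples_def)

text \<open>The norms of the contractions depend on the functions \<open>g i\<close> only through
  their orthonormality, so the indicators are left out of the computation.\<close>

locale orthonormal_family = sigma_finite_measure \<mu> for \<mu> :: "'z measure" +
  fixes g :: "nat \<Rightarrow> 'z \<Rightarrow> real"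
  assumes g_measurable [measurable]: "\<And>i. 1 \<le> i \<Longrightarrow> g i \<in> borel_measurable \<mu>"
    and g_integrable: "\<And>i j. 1 \<le> i \<Longrightarrow> 1 \<le> j \<Longrightarrow> integrable \<mu> (\<lambda>z. g i z * g j z)"
    and g_orthonormal: "\<And>i j. 1 \<le> i \<Longrightarrow> 1 \<le> j \<Longrightarrow> (\<integral>z. g i z * g j z \<partial>\<mu>) = of_bool (i = j)"
begin

definition tens :: "nat \<Rightarrow> (nat \<Rightarrow> nat) \<Rightarrow> (nat \<Rightarrow> 'z) \<Rightarrow> real" where
  "tens q i x = (\<Prod>k<q. g (i k) (x k))"

lemma tensor_sum_eq: "tensor_sum q N f g x = (\<Sum>i\<in>index_tuples q N. f i * tens q i x)"
  unfolding tensor_sum_def tensor_def tens_def ..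

lemma
  assumes i: "i \<in> index_tuples q N" and j: "j \<in> index_tuples q N"
  shows tens_integrable: "integrable (power_measure \<mu> q) (\<lambda>x. tens q i x * tens q j x)"
    and tens_orthonormal: "(\<integral>x. tens q i x * tens q j x \<partial>power_measure \<mu> q) = of_bool (i = j)"
proof -
  interpret product_sigma_finite "\<lambda>_ :: nat. \<mu>"
    by (rule product_sigma_finite.intro) (rule sigma_finite_measure_axioms)
  have e: "tens q i x * tens q j x = (\<Prod>k<q. g (i k) (x k) * g (j k) (x k))" for x
    by (simp add: tens_def prod.distrib)
  have int: "integrable \<mu> (\<lambda>z. g (i k) z * g (j k) z)" if "k \<in> {..<q}" for k
    using that index_tuple_bounds(1)[OF i] index_tuple_bounds(1)[OF j] by (intro g_integrable) auto
  show "integrable (power_measure \<mu> q) (\<lambda>x. tens q i x * tens q j x)"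
    unfolding e by (rule product_integrable_prod[OF finite_lessThan int])
  have "(\<integral>x. tens q i x * tens q j x \<partial>power_measure \<mu> q) = (\<Prod>k<q. \<integral>z. g (i k) z * g (j k) z \<partial>\<mu>)"
    unfolding e by (rule product_integral_prod[OF finite_lessThan int])
  also have "\<dots> = (\<Prod>k<q. of_bool (i k = j k))"
    using index_tuple_bounds(1)[OF i] index_tuple_bounds(1)[OF j] by (intro prod.cong refl g_orthonormal) auto
  also have "\<dots> = of_bool (i = j)"
  proof (cases "i = j")
    case False
    then obtain k where "k < q" "i k \<noteq> j k"
      using i j by (metis PiE_ext index_tuples_def lessThan_iff)
    then show ?thesis using False by (intro trans[OF prod_zero]) auto
  qed simp
  finally show "(\<integral>x. tens q i x * tens q j x \<partial>power_measure \<mu> q) = of_bool (i = j)" .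
qed

text \<open>Parseval's identity for the orthonormal tensor products.\<close>

lemma integral_square_tens_sum:
  "(\<integral>x. (\<Sum>i\<in>index_tuples q N. m i * tens q i x)\<^sup>2 \<partial>power_measure \<mu> q) = (\<Sum>i\<in>index_tuples q N. (m i)\<^sup>2)"
proof -
  have "(\<integral>x. (\<Sum>i\<in>index_tuples q N. m i * tens q i x)\<^sup>2 \<partial>power_measure \<mu> q)
    = (\<integral>x. (\<Sum>i\<in>index_tuples q N. \<Sum>j\<in>index_tuples q N. m i * m j * (tens q i x * tens q j x)) \<partial>power_measure \<mu> q)"
    by (simp add: power2_eq_square sum_product mult_ac)
  also have "\<dots> = (\<Sum>i\<in>index_tuples q N. \<Sum>j\<in>index_tuples q N. m i * m j * of_bool (i = j))"
    by (simp add: tens_integrable tens_orthonormal)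
  also have "\<dots> = (\<Sum>i\<in>index_tuples q N. (m i)\<^sup>2)"
    by (intro sum.cong refl) (simp add: of_bool_def if_distrib power2_eq_square cong: if_cong)
  finally show ?thesis .
qed

lemma tensor_sum_cat:
  "tensor_sum (r + s) N f g (cat r (r + s) z y)
    = (\<Sum>a\<in>index_tuples r N. \<Sum>b\<in>index_tuples s N. f (cat r (r + s) a b) * (tens r a z * tens s b y))"
  unfolding tensor_sum_eq sum_index_tuples_cat tens_def prod_cat[where h = g] ..

text \<open>Integration over the \<open>r\<close> shared arguments leaves the diagonal
  \<open>a = a'\<close> of a double sum. The contraction is again a tensor sum, indexed by the
  concatenation \<open>e\<close> of the two free index tuples, so Parseval gives its norm.\<close>

lemma contraction_eq:
  "contraction \<mu> (r + s) r (tensor_sum (r + s) N f g) y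
    = (\<Sum>e\<in>index_tuples (s + s) N. (\<Sum>a\<in>index_tuples r N. f (cat r (r + s) a (restrict e {..<s})) * f (cat r (r + s) a (\<lambda>k\<in>{..<s}. e (s + k)))) * tens (s + s) e y)"
proof -
  let ?T = "index_tuples" and ?y = "\<lambda>k. y (s + k)"
  define c where "c b b' = (\<Sum>a\<in>?T r N. f (cat r (r + s) a b) * f (cat r (r + s) a b'))" for b b'
  have "contraction \<mu> (r + s) r (tensor_sum (r + s) N f g) y
    = (\<integral>z. tensor_sum (r + s) N f g (cat r (r + s) z y) * tensor_sum (r + s) N f g (cat r (r + s) z ?y) \<partial>power_measure \<mu> r)"
    unfolding contraction_def cat_def by (simp only: diff_add_inverse)
  also have "\<dots> = (\<integral>z. (\<Sum>a\<in>?T r N. \<Sum>b\<in>?T s N. \<Sum>a'\<in>?T r N. \<Sum>b'\<in>?T s N.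
      (f (cat r (r + s) a b) * tens s b y * (f (cat r (r + s) a' b') * tens s b' ?y)) * (tens r a z * tens r a' z)) \<partial>power_measure \<mu> r)"
    unfolding tensor_sum_cat sum_distrib_right unfolding sum_distrib_left by (simp only: mult_ac)
  also have "\<dots> = (\<Sum>a\<in>?T r N. \<Sum>b\<in>?T s N. \<Sum>a'\<in>?T r N. \<Sum>b'\<in>?T s N.
      (f (cat r (r + s) a b) * tens s b y * (f (cat r (r + s) a' b') * tens s b' ?y)) * of_bool (a = a'))"
    by (simp add: tens_integrable tens_orthonormal)
  also have "\<dots> = (\<Sum>a\<in>?T r N. \<Sum>b\<in>?T s N. \<Sum>b'\<in>?T s N. \<Sum>a'\<in>?T r N.
      (f (cat r (r + s) a b) * tens s b y * (f (cat r (r + s) a' b') * tens s b' ?y)) * of_bool (a = a'))"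
    by (intro sum.cong refl sum.swap)
  also have "\<dots> = (\<Sum>a\<in>?T r N. \<Sum>b\<in>?T s N. \<Sum>b'\<in>?T s N.
      f (cat r (r + s) a b) * f (cat r (r + s) a b') * (tens s b y * tens s b' ?y))"
    by (intro sum.cong refl) (simp add: of_bool_def if_distrib mult_ac cong: if_cong)
  also have "\<dots> = (\<Sum>b\<in>?T s N. \<Sum>b'\<in>?T s N. \<Sum>a\<in>?T r N.
      f (cat r (r + s) a b) * f (cat r (r + s) a b') * (tens s b y * tens s b' ?y))"
    by (rule trans[OF sum.swap], rule sum.cong[OF refl], rule sum.swap)
  also have "\<dots> = (\<Sum>b\<in>?T s N. \<Sum>b'\<in>?T s N. c b b' * (tens s b y * tens s b' ?y))"
    by (simp add: c_def sum_distrib_right)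
  also have "\<dots> = (\<Sum>e\<in>?T (s + s) N. c (restrict e {..<s}) (\<lambda>k\<in>{..<s}. e (s + k)) * tens (s + s) e y)"
    unfolding sum_index_tuples_cat
  proof (intro sum.cong refl)
    fix b b' assume b: "b \<in> ?T s N" "b' \<in> ?T s N"
    have "restrict (cat s (s + s) b b') {..<s} = b" "(\<lambda>k\<in>{..<s}. cat s (s + s) b b' (s + k)) = b'"
      using b by (auto simp: cat_def index_tuples_def PiE_iff extensional_def fun_eq_iff)
    moreover have "tens (s + s) (cat s (s + s) b b') y = tens s b y * tens s b' ?y"
    proof -
      have "tens (s + s) (cat s (s + s) b b') y = tens (s + s) (cat s (s + s) b b') (cat s (s + s) y ?y)"
        unfolding tens_def by (intro prod.cong refl) (auto simp: cat_def)
      then show ?thesis unfolding tens_def prod_cat[where h = g] .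
    qed
    ultimately show "c b b' * (tens s b y * tens s b' ?y) = c (restrict (cat s (s + s) b b') {..<s}) (\<lambda>k\<in>{..<s}. cat s (s + s) b b' (s + k)) * tens (s + s) (cat s (s + s) b b') y"
      by simp
  qed
  finally show ?thesis by (simp add: c_def)
qed

lemma L2_norm_contraction:
  assumes sym: "symmetric_on_tuples q N f" and diag: "vanishes_on_diagonals q N f" and r: "r \<le> q"
  shows "L2_norm (power_measure \<mu> (2 * q - 2 * r)) (contraction \<mu> q r (tensor_sum q N f g))
    = fact (q - r) * fact r / (fact q)\<^sup>2 * sqrt (contr {1..N} r (set_coeff q N f) (set_coeff q N f))"
proof -
  obtain s where q: "q = r + s" using r le_Suc_ex by blast
  have m: "2 * q - 2 * r = s + s" by (simp add: q)
  have "(\<integral>y. (contraction \<mu> q r (tensor_sum q N f g) y)\<^sup>2 \<partial>power_measure \<mu> (2 * q - 2 * r))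
    = (\<Sum>e\<in>index_tuples (s + s) N. (\<Sum>a\<in>index_tuples r N. f (cat r (r + s) a (restrict e {..<s})) * f (cat r (r + s) a (\<lambda>k\<in>{..<s}. e (s + k))))\<^sup>2)"
    unfolding m unfolding q contraction_eq by (rule integral_square_tens_sum)
  also have "\<dots> = (\<Sum>b\<in>index_tuples s N. \<Sum>c\<in>index_tuples s N. (\<Sum>a\<in>index_tuples r N. f (cat r (r + s) a b) * f (cat r (r + s) a c))\<^sup>2)"
    unfolding sum_index_tuples_cat
  proof (intro sum.cong refl)
    fix b b' assume b: "b \<in> index_tuples s N" "b' \<in> index_tuples s N"
    have "restrict (cat s (s + s) b b') {..<s} = b" "(\<lambda>k\<in>{..<s}. cat s (s + s) b b' (s + k)) = b'"
      using b by (auto simp: cat_def index_tuples_def PiE_iff extensional_def fun_eq_iff)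
    then show "(\<Sum>a\<in>index_tuples r N. f (cat r (r + s) a (restrict (cat s (s + s) b b') {..<s})) * f (cat r (r + s) a (\<lambda>k\<in>{..<s}. cat s (s + s) b b' (s + k))))\<^sup>2
      = (\<Sum>a\<in>index_tuples r N. f (cat r (r + s) a b) * f (cat r (r + s) a b'))\<^sup>2" by simp
  qed
  also have "\<dots> = (fact s * fact r / (fact (r + s))\<^sup>2)\<^sup>2 * contr {1..N} r (set_coeff (r + s) N f) (set_coeff (r + s) N f)"
    by (rule sum_square_index_tuples_eq_contr) (use sym diag in \<open>simp_all add: q\<close>)
  finally show ?thesis by (simp add: L2_norm_def real_sqrt_mult q)
qed

end

lemma orthonormal_family_indicators:
  assumes \<mu>: "sigma_finite_measure \<mu>" and A: "\<And>i. i \<ge> 1 \<Longrightarrow> A i \<in> sets \<mu>" and disj: "disjoint_family_on A {1..}"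
    and mA: "\<And>i. i \<ge> 1 \<Longrightarrow> emeasure \<mu> (A i) = ennreal (lam i)" and lam: "\<And>i. i \<ge> 1 \<Longrightarrow> 0 < lam i"
  shows "orthonormal_family \<mu> (\<lambda>i z. indicator (A i) z / sqrt (lam i))"
proof -
  interpret sigma_finite_measure \<mu> by fact
  have e: "indicator (A i) z / sqrt (lam i) * (indicator (A j) z / sqrt (lam j)) = (if i = j then indicator (A i) z / lam i else 0)"
    if "1 \<le> i" "1 \<le> j" for i j z
  proof (cases "i = j")
    case True
    then show ?thesis using lam[OF that(1)] by (simp add: indicator_def)
  next
    case False
    then have "A i \<inter> A j = {}" using disj that by (auto simp: disjoint_family_on_def)
    then show ?thesis using False by (auto simp: indicator_def)
  qed
  have int: "integrable \<mu> (indicator (A i) :: _ \<Rightarrow> real)" if "1 \<le> i" for i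
    using A[OF that] mA[OF that] by (intro integrable_real_indicator) auto
  show ?thesis
  proof
    fix i j :: nat assume i: "1 \<le> i" and j: "1 \<le> j"
    show "integrable \<mu> (\<lambda>z. indicator (A i) z / sqrt (lam i) * (indicator (A j) z / sqrt (lam j)))"
      unfolding e[OF i j] using int[OF i] by (cases "i = j") auto
    have "measure \<mu> (A i) = lam i" using mA[OF i] lam[OF i] by (simp add: measure_def)
    then show "(\<integral>z. indicator (A i) z / sqrt (lam i) * (indicator (A j) z / sqrt (lam j)) \<partial>\<mu>) = of_bool (i = j)"
      unfolding e[OF i j] using A[OF i] lam[OF i] by (cases "i = j") (auto simp: sets.Int_space_eq2)
  qed (use A in measurable)
qed

text \<open>The kernel is itself elementary, with the blocks \<open>A i\<close>, so a constant
  sequence approximates it. The elementary integral \<open>J\<close> agrees with the homogeneous sum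
  only almost surely, which suffices for convergence in \<open>L^2\<close>.\<close>

lemma has_multiple_integral_hom_sum:
  fixes M :: "'w measure" and \<mu> :: "'z measure"
  assumes \<mu>: "sigma_finite_measure \<mu>" and A: "\<And>i. i \<ge> 1 \<Longrightarrow> A i \<in> sets \<mu>" and disj: "disjoint_family_on A {1..}"
    and mA: "\<And>i. i \<ge> 1 \<Longrightarrow> emeasure \<mu> (A i) = ennreal (lam i)" and lam: "\<And>i. i \<ge> 1 \<Longrightarrow> 0 < lam i"
    and \<eta>: "\<And>i. i \<ge> 1 \<Longrightarrow> \<eta> (A i) \<in> borel_measurable M" and P: "\<And>i. i \<ge> 1 \<Longrightarrow> P i \<in> borel_measurable M"
    and P\<eta>: "\<And>i. i \<ge> 1 \<Longrightarrow> AE \<omega> in M. P i \<omega> = \<eta> (A i) \<omega> / sqrt (lam i)"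
    and diag: "vanishes_on_diagonals q N f"
  shows "has_multiple_integral M \<mu> \<eta> q (tensor_sum q N f (\<lambda>i z. indicator (A i) z / sqrt (lam i))) (hom_sum q N f P)"
proof -
  \<comment> \<open>The normalizations of the indicators move into the coefficients; zeros on
    diagonals are preserved.\<close>
  define c where "c i = f i / (\<Prod>k<q. sqrt (lam (i k)))" for i
  define J where "J = hom_sum q N c (\<lambda>i. \<eta> (A i))"
  let ?g = "tensor_sum q N f (\<lambda>i z. indicator (A i) z / sqrt (lam i))"
  have g: "?g = tensor_sum q N c (\<lambda>i. indicator (A i))"
    by (simp add: fun_eq_iff tensor_sum_def tensor_def c_def prod_dividef)
  note i1 = index_tuple_bounds(1)
  have elem: "has_elementary_integral \<mu> \<eta> q ?g J"
    unfolding has_elementary_integral_def g J_def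
    using diag disj A mA by (intro exI[of _ N] exI[of _ c] exI[of _ A])
      (auto simp: vanishes_on_diagonals_def c_def disjoint_family_on_def)
  have gm: "?g \<in> borel_measurable (power_measure \<mu> q)"
  proof -
    interpret orthonormal_family \<mu> "\<lambda>i z. indicator (A i) z / sqrt (lam i)"
      by (rule orthonormal_family_indicators[OF \<mu> A disj mA lam])
    show ?thesis
      unfolding tensor_sum_def tensor_def
    proof (intro borel_measurable_sum borel_measurable_times borel_measurable_const borel_measurable_prod)
      fix i k assume i: "i \<in> index_tuples q N" and k: "k \<in> {..<q}"
      have "(\<lambda>x. x k) \<in> measurable (power_measure \<mu> q) \<mu>" by (rule measurable_component_singleton) (rule k)
      moreover have "(\<lambda>z. indicator (A (i k)) z / sqrt (lam (i k))) \<in> borel_measurable \<mu>"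
        by (rule g_measurable[OF i1[OF i]]) (use k in simp)
      ultimately show "(\<lambda>x. indicator (A (i k)) (x k) / sqrt (lam (i k))) \<in> borel_measurable (power_measure \<mu> q)"
        by (rule measurable_compose)
    qed
  qed
  have Jm: "J \<in> borel_measurable M"
    unfolding J_def hom_sum_def[abs_def]
    by (intro borel_measurable_sum borel_measurable_times borel_measurable_const borel_measurable_prod \<eta> i1) auto
  have Fm: "hom_sum q N f P \<in> borel_measurable M"
    unfolding hom_sum_def[abs_def]
    by (intro borel_measurable_sum borel_measurable_times borel_measurable_const borel_measurable_prod P i1) auto
  have "AE \<omega> in M. \<forall>i\<in>{1..N}. P i \<omega> = \<eta> (A i) \<omega> / sqrt (lam i)"
    using P\<eta> by (intro AE_finite_allI) auto
  then have ae: "AE \<omega> in M. J \<omega> = hom_sum q N f P \<omega>"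
  proof eventually_elim
    case (elim \<omega>)
    show ?case
      unfolding J_def hom_sum_def
    proof (intro sum.cong refl)
      fix i assume i: "i \<in> index_tuples q N"
      have "(\<Prod>k<q. P (i k) \<omega>) = (\<Prod>k<q. \<eta> (A (i k)) \<omega> / sqrt (lam (i k)))"
        using index_tuple_bounds(2)[OF i] elim by (intro prod.cong refl) auto
      then show "c i * (\<Prod>k<q. \<eta> (A (i k)) \<omega>) = f i * (\<Prod>k<q. P (i k) \<omega>)"
        by (simp add: c_def prod_dividef)
    qed
  qed
  have "(\<integral>\<^sup>+\<omega>. ennreal ((J \<omega> - hom_sum q N f P \<omega>)\<^sup>2) \<partial>M) = (\<integral>\<^sup>+\<omega>. 0 \<partial>M)"
    by (rule nn_integral_cong_AE) (use ae in eventually_elim, simp)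
  then show ?thesis
    unfolding has_multiple_integral_def converges_L2_def
    using elem gm Jm Fm by (intro exI[of _ "\<lambda>_. ?g"] exI[of _ "\<lambda>_. J"]) simp
qed

subsection \<open>Limits along a sequence of multilinear forms\<close>

text \<open>The fourth power is truncated at \<open>R ^ 4\<close> to a bounded continuous function;
  beyond \<open>R\<close> the loss is at most \<open>x ^ 6 / R^2\<close>, which the sixth moments
  control uniformly.\<close>

lemma weak_conv_m_fourth_moment:
  assumes L: "\<And>n. real_distribution (L n)" and K: "real_distribution K" and w: "weak_conv_m L K"
    and iL: "\<forall>\<^sub>F n in sequentially. integrable (L n) (\<lambda>x. x ^ 6) \<and> (\<integral>x. x ^ 6 \<partial>L n) \<le> B"
    and iK: "integrable K (\<lambda>x. x ^ 6)"
  shows "(\<lambda>n. \<integral>x. x ^ 4 \<partial>L n) \<longlonglongrightarrow> (\<integral>x. x ^ 4 \<partial>K)"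
proof (rule tendstoI)
  fix e :: real assume e: "0 < e"
  define D where "D = \<bar>B\<bar> + (\<integral>x. x ^ 6 \<partial>K) + 1"
  have K0: "0 \<le> (\<integral>x. x ^ 6 \<partial>K)" by (intro integral_nonneg_AE AE_I2) simp
  then have D: "0 < D" "B \<le> D" "(\<integral>x. x ^ 6 \<partial>K) \<le> D" unfolding D_def by linarith+
  \<comment> \<open>Chosen so that \<open>D / R^2 = e / 4\<close>, with \<open>D\<close> a common
    bound for the sixth moments.\<close>
  define R where "R = sqrt (4 * D / e)"
  have R: "R\<^sup>2 = 4 * D / e" "0 < R" using D e by (simp_all add: R_def)
  define g where "g x = min (x ^ 4) (R ^ 4)" for x :: real
  have gx: "\<bar>x ^ 4 - g x\<bar> \<le> x ^ 6 / R\<^sup>2" "\<bar>g x\<bar> \<le> R ^ 4" "x ^ 4 \<le> 1 + x ^ 6" for x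
  proof -
    show "\<bar>x ^ 4 - g x\<bar> \<le> x ^ 6 / R\<^sup>2"
    proof (cases "\<bar>x\<bar> \<le> R")
      case True
      then have "x ^ 4 \<le> R ^ 4" using power_mono[OF True abs_ge_zero, of 4] by (simp add: power_even_abs)
      then show ?thesis by (simp add: g_def)
    next
      case False
      then have "R\<^sup>2 \<le> x\<^sup>2" using R power_mono[of R "\<bar>x\<bar>" 2] by simp
      then have "R\<^sup>2 * x ^ 4 \<le> x\<^sup>2 * x ^ 4" by (intro mult_right_mono) auto
      then have "x ^ 4 \<le> x ^ 6 / R\<^sup>2" using R(2) by (simp add: pos_le_divide_eq mult.commute flip: power_add)
      moreover have "\<bar>x ^ 4 - g x\<bar> \<le> x ^ 4" by (simp add: g_def min_def)
      ultimately show ?thesis by linarith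
    qed
    show "\<bar>g x\<bar> \<le> R ^ 4" using R by (simp add: g_def min_def)
    show "x ^ 4 \<le> 1 + x ^ 6"
    proof (cases "\<bar>x\<bar> \<le> 1")
      case True
      then have "x ^ 4 \<le> 1" using power_le_one[OF abs_ge_zero True, of 4] by (simp add: power_even_abs)
      then show ?thesis by (simp add: add_increasing2)
    next
      case False
      then have "\<bar>x\<bar> ^ 4 \<le> \<bar>x\<bar> ^ 6" by (intro power_increasing) auto
      then show ?thesis by (simp add: power_even_abs)
    qed
  qed
  have close: "\<bar>(\<integral>x. x ^ 4 \<partial>N) - (\<integral>x. g x \<partial>N)\<bar> \<le> e / 4"
    if N: "real_distribution N" and i: "integrable N (\<lambda>x. x ^ 6)" and b: "(\<integral>x. x ^ 6 \<partial>N) \<le> D" for N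
  proof -
    interpret N: real_distribution N by (rule N)
    have i4: "integrable N (\<lambda>x. x ^ 4)"
    proof (rule Bochner_Integration.integrable_bound)
      show "integrable N (\<lambda>x. 1 + x ^ 6)" using i by simp
    qed (use gx(3) in auto)
    have ig: "integrable N g"
      by (rule N.integrable_const_bound[where B = "R ^ 4"]) (use gx(2) in \<open>auto simp: g_def[abs_def]\<close>)
    have "\<bar>(\<integral>x. x ^ 4 \<partial>N) - (\<integral>x. g x \<partial>N)\<bar> = \<bar>\<integral>x. x ^ 4 - g x \<partial>N\<bar>" using i4 ig by simp
    also have "\<dots> \<le> (\<integral>x. \<bar>x ^ 4 - g x\<bar> \<partial>N)" by (rule integral_abs_bound)
    also have "\<dots> \<le> (\<integral>x. x ^ 6 / R\<^sup>2 \<partial>N)" using i4 ig i gx(1) by (intro integral_mono) auto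
    also have "\<dots> = (\<integral>x. x ^ 6 \<partial>N) / R\<^sup>2" by simp
    also have "\<dots> \<le> D / R\<^sup>2" using b by (intro divide_right_mono) auto
    also have "\<dots> = e / 4" using D e by (simp add: R(1))
    finally show ?thesis .
  qed
  have "(\<lambda>n. \<integral>x. g x \<partial>L n) \<longlonglongrightarrow> (\<integral>x. g x \<partial>K)"
  proof (rule weak_conv_imp_integral_bdd_continuous_conv[OF L K w])
    show "isCont g x" for x unfolding g_def[abs_def] by (intro continuous_intros)
    show "norm (g x) \<le> R ^ 4" for x using gx(2) by simp
  qed
  then have "\<forall>\<^sub>F n in sequentially. dist (\<integral>x. g x \<partial>L n) (\<integral>x. g x \<partial>K) < e / 4"
    using e by (intro tendstoD) auto
  with iL show "\<forall>\<^sub>F n in sequentially. dist (\<integral>x. x ^ 4 \<partial>L n) (\<integral>x. x ^ 4 \<partial>K) < e"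
  proof eventually_elim
    case (elim n)
    then show ?case
      using close[OF L, of n] close[OF K iK D(3)] D(2) e unfolding dist_real_def by linarith
  qed
qed

lemma
  fixes \<sigma> :: real assumes \<sigma>: "0 < \<sigma>"
  defines "N \<equiv> density lborel (\<lambda>x. ennreal (normal_density 0 \<sigma> x))"
  shows real_distribution_normal: "real_distribution N"
    and char_normal: "char N t = of_real (exp (- ((\<sigma> * t)\<^sup>2) / 2))"
    and normal_fourth_moment: "(\<integral>x. x ^ 4 \<partial>N) = 3 * \<sigma> ^ 4"
    and normal_sixth_moment: "integrable N (\<lambda>x. x ^ 6)"
proof -
  show "real_distribution N"
    unfolding N_def using \<sigma> by (intro real_distribution.intro prob_space_normal_density) (auto simp: real_distribution_axioms_def)
  have "char N t = (\<integral>x. normal_density 0 \<sigma> x *\<^sub>R iexp (t * x) \<partial>lborel)"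
    unfolding char_def N_def by (subst integral_density) auto
  also have "\<dots> = \<bar>\<sigma>\<bar> *\<^sub>R (\<integral>x. normal_density 0 \<sigma> (0 + \<sigma> * x) *\<^sub>R iexp (t * (0 + \<sigma> * x)) \<partial>lborel)"
    by (rule lborel_integral_real_affine) (use \<sigma> in simp)
  also have "\<dots> = (\<integral>x. \<bar>\<sigma>\<bar> *\<^sub>R (normal_density 0 \<sigma> (0 + \<sigma> * x) *\<^sub>R iexp (t * (0 + \<sigma> * x))) \<partial>lborel)"
    by (rule integral_scaleR_right[symmetric])
  also have "\<dots> = (\<integral>x. std_normal_density x *\<^sub>R iexp ((\<sigma> * t) * x) \<partial>lborel)"
    using \<sigma> by (intro Bochner_Integration.integral_cong refl)
      (simp add: normal_density_def real_sqrt_mult power_mult_distrib mult_ac)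
  also have "\<dots> = char std_normal_distribution (\<sigma> * t)"
    unfolding char_def by (subst integral_density) auto
  finally show "char N t = of_real (exp (- ((\<sigma> * t)\<^sup>2) / 2))" by (simp add: char_std_normal_distribution)
  have m: "has_bochner_integral lborel (\<lambda>x. normal_density 0 \<sigma> x * x ^ (2 * k)) (fact (2 * k) / ((2 / \<sigma>\<^sup>2) ^ k * fact k))" for k
    using normal_moment_even[OF \<sigma>, of 0 k] by simp
  have "(\<integral>x. x ^ 4 \<partial>N) = (\<integral>x. normal_density 0 \<sigma> x * x ^ (2 * 2) \<partial>lborel)"
    unfolding N_def by (subst integral_density) auto
  also have "\<dots> = fact (2 * 2) / ((2 / \<sigma>\<^sup>2) ^ 2 * fact 2)" by (rule has_bochner_integral_integral_eq[OF m])
  also have "\<dots> = 3 * \<sigma> ^ 4" using \<sigma> by (simp add: fact_numeral power_divide field_simps flip: power_mult)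
  finally show "(\<integral>x. x ^ 4 \<partial>N) = 3 * \<sigma> ^ 4" .
  have "integrable lborel (\<lambda>x. normal_density 0 \<sigma> x * x ^ (2 * 3))" using m[of 3] by (rule integrable.intros)
  then show "integrable N (\<lambda>x. x ^ 6)"
    unfolding N_def by (subst integrable_density) auto
qed

section \<open>Fourth moments of forms and of their derivatives\<close>

lemma mform_card_1:
  assumes V: "finite V" and a: "\<And>A. a A \<noteq> 0 \<Longrightarrow> card A = 1"
  shows "mform V a y = (\<Sum>i\<in>V. a {i} * y i)"
proof -
  have "mform V a y = (\<Sum>A\<in>(\<lambda>i. {i}) ` V. a A * (\<Prod>c\<in>A. y c))"
    unfolding mform_def
  proof (rule sum.mono_neutral_right)
    show "\<forall>A\<in>Pow V - (\<lambda>i. {i}) ` V. a A * (\<Prod>c\<in>A. y c) = 0"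
    proof
      fix A assume "A \<in> Pow V - (\<lambda>i. {i}) ` V"
      then have "card A \<noteq> 1" by (auto simp: card_1_singleton_iff)
      then show "a A * (\<Prod>c\<in>A. y c) = 0" using a[of A] by auto
    qed
  qed (use V in auto)
  then show ?thesis by (simp add: sum.reindex)
qed

context poisson_family
begin

text \<open>Fourth cumulants of independent variables add up. The second moment is carried along in
  the induction because the fourth moment of a sum contains products of second moments.\<close>

lemma fourth_moment_linear:
  assumes "finite V" "V \<subseteq> I"
  shows "expectation (\<lambda>\<omega>. (\<Sum>i\<in>V. b i * X i \<omega>) ^ 4) = 3 * (\<Sum>i\<in>V. (b i)\<^sup>2)\<^sup>2 + (\<Sum>i\<in>V. (\<theta> i)\<^sup>2 * b i ^ 4)
    \<and> expectation (\<lambda>\<omega>. (\<Sum>i\<in>V. b i * X i \<omega>)\<^sup>2) = (\<Sum>i\<in>V. (b i)\<^sup>2)"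
  using assms
proof (induction V rule: finite_induct)
  case empty
  then show ?case by simp
next
  case (insert i V)
  define S where "S \<omega> = (\<Sum>j\<in>V. b j * X j \<omega>)" for \<omega>
  have V: "V \<subseteq> I" "i \<in> I" using insert by auto
  let ?P = "std_poisson (lam i)" and ?Y = "\<lambda>\<omega>. \<lambda>c\<in>V. X c \<omega>"
  note l = lam_pos[OF V(2)]
  interpret P: prob_space ?P by (rule prob_space_std_poisson)
  note mom = std_poisson_moments[OF l, folded \<theta>_def]
  have SY: "S \<omega> = (\<Sum>j\<in>V. b j * ?Y \<omega> j)" for \<omega> unfolding S_def by (intro sum.cong) auto
  have amS: "all_moments M S" "all_moments M (X i)" unfolding S_def using V by (intro all_moments_intros; auto)+
  have ins: "(\<Sum>j\<in>insert i V. b j * X j \<omega>) = S \<omega> + b i * X i \<omega>" for \<omega>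
    using insert by (simp add: S_def)
  have E: "expectation (\<lambda>\<omega>. (S \<omega> + b i * X i \<omega>) ^ k) = expectation (\<lambda>\<omega>. \<integral>x. (S \<omega> + b i * x) ^ k \<partial>?P)" for k
    unfolding SY
  proof (rule expectation_disintegrate(1)[OF V(2,1) insert(2), where \<Phi> = "\<lambda>x y. ((\<Sum>j\<in>V. b j * y j) + b i * x) ^ k"])
    show "(\<lambda>(x, y). ((\<Sum>j\<in>V. b j * y j) + b i * x) ^ k) \<in> borel_measurable (borel \<Otimes>\<^sub>M PiM V (\<lambda>_. borel))"
      by measurable
    show "integrable M (\<lambda>\<omega>. ((\<Sum>j\<in>V. b j * ?Y \<omega> j) + b i * X i \<omega>) ^ k)"
      unfolding SY[symmetric]
      by (intro all_moments_integrable all_moments_power all_moments_add all_moments_mult all_moments_const amS)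
  qed
  have e2: "(s + b i * x)\<^sup>2 = s\<^sup>2 + 2 * s * b i * x + (b i)\<^sup>2 * x\<^sup>2" for s x by algebra
  have e4: "(s + b i * x) ^ 4 = s ^ 4 + 4 * s ^ 3 * b i * x + 6 * s\<^sup>2 * (b i)\<^sup>2 * x\<^sup>2 + 4 * s * b i ^ 3 * x ^ 3 + b i ^ 4 * x ^ 4" for s x
    by algebra
  note [simp] = std_poisson_integrable_power[OF l] std_poisson_measure_UNIV[OF l]
  have i2: "(\<integral>x. (s + b i * x)\<^sup>2 \<partial>?P) = s\<^sup>2 + (b i)\<^sup>2" for s
    unfolding e2 by (simp add: mom)
  have i4: "(\<integral>x. (s + b i * x) ^ 4 \<partial>?P) = s ^ 4 + 6 * (b i)\<^sup>2 * s\<^sup>2 + 4 * b i ^ 3 * \<theta> i * s + b i ^ 4 * (3 + (\<theta> i)\<^sup>2)" for s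
    unfolding e4 by (simp add: mom)
  have int: "integrable M (\<lambda>\<omega>. S \<omega> ^ 4)" "integrable M (\<lambda>\<omega>. (S \<omega>)\<^sup>2)" "integrable M S"
    by (intro all_moments_integrable all_moments_power amS)+
  have ES: "expectation S = 0"
  proof -
    have "expectation (X j) = 0" if "j \<in> V" for j
      using integral_law[of j "\<lambda>x. x"] std_poisson_moments(1)[OF lam_pos, of j] that V by auto
    moreover have "integrable M (X j)" if "j \<in> V" for j
      using that V by (intro all_moments_integrable all_moments_X) auto
    ultimately show ?thesis unfolding S_def[abs_def] by simp
  qed
  have IH: "expectation (\<lambda>\<omega>. S \<omega> ^ 4) = 3 * (\<Sum>i\<in>V. (b i)\<^sup>2)\<^sup>2 + (\<Sum>i\<in>V. (\<theta> i)\<^sup>2 * b i ^ 4)"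
    "expectation (\<lambda>\<omega>. (S \<omega>)\<^sup>2) = (\<Sum>i\<in>V. (b i)\<^sup>2)"
    using insert(3) V unfolding S_def by auto
  show ?case
    unfolding ins E i2 i4 using int ES IH insert(1,2)
    by (simp add: prob_space) (simp add: power2_eq_square power4_eq_xxxx algebra_simps)
qed

lemma fourth_moment_card_1:
  assumes V: "finite V" "V \<subseteq> I" and a: "\<And>A. a A \<noteq> 0 \<Longrightarrow> card A = 1"
  shows "expectation (\<lambda>\<omega>. mform V a (\<lambda>c. X c \<omega>) ^ 4)
    = 3 * (expectation (\<lambda>\<omega>. (mform V a (\<lambda>c. X c \<omega>))\<^sup>2))\<^sup>2 + (\<Sum>i\<in>V. (a {i}) ^ 4 * (1 / lam i))"
proof -
  have "(\<Sum>i\<in>V. (\<theta> i)\<^sup>2 * a {i} ^ 4) = (\<Sum>i\<in>V. (a {i}) ^ 4 * (1 / lam i))"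
    using V by (intro sum.cong refl) (auto simp: \<theta>_square)
  then show ?thesis
    using fourth_moment_linear[OF V, of "\<lambda>i. a {i}"] by (simp add: mform_card_1[OF V(1) a])
qed

text \<open>The derivative of a linear form is the constant \<open>a {i}\<close>, so the remainder
  in the Stein bound is exactly the sum in the condition for degree one.\<close>

lemma sum_fourth_moment_derivatives_card_1:
  assumes V: "finite V" "V \<subseteq> I" and a: "\<And>A. a A \<noteq> 0 \<Longrightarrow> card A = 1"
  shows "(\<Sum>i\<in>V. (\<theta> i)\<^sup>2 * expectation (\<lambda>\<omega>. mform V (djoin a {i}) (\<lambda>c. X c \<omega>) ^ 4)) = (\<Sum>i\<in>V. (a {i}) ^ 4 * (1 / lam i))"
proof (intro sum.cong refl)
  fix i assume i: "i \<in> V"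
  have "mform V (djoin a {i}) y = a {i}" for y
  proof -
    have "mform V (djoin a {i}) y = (\<Sum>A\<in>Pow V. if A = {} then a {i} else 0)"
      unfolding mform_def
    proof (intro sum.cong refl)
      fix A assume "A \<in> Pow V"
      then have "finite A" using V by (auto intro: finite_subset)
      moreover have "djoin a {i} A \<noteq> 0 \<Longrightarrow> card (insert i A) = 1 \<and> i \<notin> A"
        using a[of "insert i A"] by (auto simp: djoin_def split: if_splits)
      ultimately have "djoin a {i} A \<noteq> 0 \<Longrightarrow> A = {}" by (auto simp: card_insert_if)
      then show "djoin a {i} A * (\<Prod>c\<in>A. y c) = (if A = {} then a {i} else 0)"
        by (cases "djoin a {i} A = 0") (auto simp: djoin_def)
    qed
    then show ?thesis using V by simp
  qed
  then show "(\<theta> i)\<^sup>2 * expectation (\<lambda>\<omega>. mform V (djoin a {i}) (\<lambda>c. X c \<omega>) ^ 4) = (a {i}) ^ 4 * (1 / lam i)"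
    using i V by (auto simp: prob_space \<theta>_square)
qed

text \<open>Derivatives are forms of degree at most \<open>p\<close>, so hypercontractivity bounds
  their fourth moments by squared influences, whose sum is at most the contraction of order
  one.\<close>

lemma sum_fourth_moment_derivatives_le:
  assumes V: "finite V" "V \<subseteq> I" and a: "\<And>A. a A \<noteq> 0 \<Longrightarrow> card A = p"
  shows "(\<Sum>i\<in>V. (\<theta> i)\<^sup>2 * expectation (\<lambda>\<omega>. mform V (djoin a {i}) (\<lambda>c. X c \<omega>) ^ 4))
    \<le> 1 / \<alpha> * sqrt (hyp ^ (3 * p)) * contr V 1 a a"
proof -
  let ?c = "sqrt (hyp ^ (3 * p))"
  have c: "0 \<le> ?c" using hyp_ge_1 by simp
  have "(\<Sum>i\<in>V. (\<theta> i)\<^sup>2 * expectation (\<lambda>\<omega>. mform V (djoin a {i}) (\<lambda>c. X c \<omega>) ^ 4))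
    \<le> (\<Sum>i\<in>V. (1 / \<alpha>) * (?c * (\<Sum>A\<in>Pow V. (djoin a {i} A)\<^sup>2)\<^sup>2))"
  proof (intro sum_mono mult_mono)
    fix i assume "i \<in> V"
    then show "(\<theta> i)\<^sup>2 \<le> 1 / \<alpha>" using V by (intro \<theta>_square_le) auto
    \<comment> \<open>The coefficients are cut off outside \<open>V\<close>, where the degree bound
      compares cardinalities of finite sets.\<close>
    define d where "d A = (if A \<subseteq> V then djoin a {i} A else 0)" for A
    have d: "d A \<noteq> 0 \<Longrightarrow> card A \<le> p" for A
      using a[of "insert i A"] card_mono[of "insert i A" A] finite_subset[OF _ V(1), of A]
      by (auto simp: d_def djoin_def split: if_splits)
    have "mform V (djoin a {i}) y = mform V d y" for y by (intro mform_cong) (auto simp: d_def)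
    moreover have "(\<Sum>A\<in>Pow V. (d A)\<^sup>2) = (\<Sum>A\<in>Pow V. (djoin a {i} A)\<^sup>2)" by (intro sum.cong) (auto simp: d_def)
    ultimately show "expectation (\<lambda>\<omega>. mform V (djoin a {i}) (\<lambda>c. X c \<omega>) ^ 4) \<le> ?c * (\<Sum>A\<in>Pow V. (djoin a {i} A)\<^sup>2)\<^sup>2"
      using fourth_moment_le[OF V, of d p] d by simp
  qed (use \<alpha>_pos in auto)
  also have "\<dots> = 1 / \<alpha> * ?c * (\<Sum>i\<in>V. (\<Sum>A\<in>Pow V. (djoin a {i} A)\<^sup>2)\<^sup>2)"
    by (simp add: sum_distrib_left mult.assoc)
  also have "\<dots> \<le> 1 / \<alpha> * ?c * contr V 1 a a"
    using c \<alpha>_pos sum_influences_le_contr[OF V(1), of a] by (intro mult_left_mono) auto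
  finally show ?thesis .
qed

text \<open>The projection on constants gives one squared second moment and the blocks of size
  \<open>0\<close> and \<open>p\<close> give two more; together they cancel the Gaussian value of
  the fourth moment.\<close>

lemma fourth_cumulant_ge_contr:
  assumes V: "finite V" "V \<subseteq> I" and a: "\<And>A. a A \<noteq> 0 \<Longrightarrow> card A = p" and r: "1 \<le> r" "r < p"
  shows "contr V r a a \<le> expectation (\<lambda>\<omega>. mform V a (\<lambda>c. X c \<omega>) ^ 4)
    - 3 * (expectation (\<lambda>\<omega>. (mform V a (\<lambda>c. X c \<omega>))\<^sup>2))\<^sup>2"
  using fourth_moment_ge[OF V a] sum_pairs_same_union_inter_ge[OF V(1) a r] r
  unfolding expectation_mform_square[OF V] by fastforce

end

section \<open>Covariance matrices and the limit of the characteristic functions\<close>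

lemma positive_definite_quadratic_nonneg: "positive_definite C \<Longrightarrow> 0 \<le> t \<bullet> (C *v t)"
  by (cases "t = 0") (auto simp: positive_definite_def intro: less_imp_le)

lemma positive_definite_diagonal_pos:
  fixes C :: "real ^ 'n ^ 'n" assumes "positive_definite C" shows "0 < C $ j $ j"
proof -
  have "0 < axis j 1 \<bullet> (C *v axis j 1)" using assms by (simp add: positive_definite_def axis_eq_0_iff)
  then show ?thesis by (simp add: inner_axis' matrix_vector_mult_basis column_def)
qed

lemma quadratic_form_eq_sum:
  fixes C :: "real ^ 'n ^ 'n"
  shows "t \<bullet> (C *v t) = (\<Sum>j\<in>UNIV. \<Sum>k\<in>UNIV. t $ j * t $ k * C $ j $ k)"
  by (simp add: inner_vec_def matrix_vector_mult_def sum_distrib_left mult_ac)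

lemma borel_measurable_vec_lambda:
  fixes F :: "'n::finite \<Rightarrow> 'w \<Rightarrow> real"
  assumes "\<And>j. F j \<in> borel_measurable M" shows "(\<lambda>\<omega>. \<chi> j. F j \<omega>) \<in> borel_measurable M"
  by (subst borel_measurable_euclidean_space) (auto simp: Basis_vec_eq inner_axis assms)

text \<open>A mixed contraction of order \<open>r\<close> between forms of different degrees
  involves pure contractions whose order may reach or exceed the degree. The former is a squared
  norm and stays bounded, the latter is zero.\<close>

lemma contr_tendsto_of_lt:
  assumes V: "\<And>n. finite (V n)" and a: "\<And>n A. a n A \<noteq> 0 \<Longrightarrow> card A = p"
    and lim: "(\<lambda>n. \<Sum>A\<in>Pow (V n). (a n A)\<^sup>2) \<longlonglongrightarrow> c"
    and contr: "\<And>r. 1 \<le> r \<Longrightarrow> r < p \<Longrightarrow> (\<lambda>n. contr (V n) r (a n) (a n)) \<longlonglongrightarrow> 0" and r: "1 \<le> r"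
  shows "(\<lambda>n. contr (V n) r (a n) (a n)) \<longlonglongrightarrow> (if r = p then c\<^sup>2 else 0)"
proof -
  consider "r < p" | "r = p" | "p < r" by linarith
  then show ?thesis
  proof cases
    case 1 then show ?thesis using contr[OF r] by simp
  next
    case 2
    have "contr (V n) p (a n) (a n) = (\<Sum>A\<in>Pow (V n). (a n A)\<^sup>2)\<^sup>2" for n by (rule contr_card[OF V]) (rule a)
    then show ?thesis using 2 lim by (auto intro!: tendsto_intros)
  next
    case 3
    have "contr (V n) r (a n) (a n) = 0" for n by (rule contr_eq_0_of_card[OF _ V 3]) (rule a)
    then show ?thesis using 3 by simp
  qed
qed

context poisson_family
begin

text \<open>For fixed \<delta> every error except \<delta> times the bounded total influence
  \<open>s n\<close> tends to zero; \<delta> is then made small.\<close>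

lemma characteristic_function_tendsto:
  fixes a :: "'d \<Rightarrow> nat \<Rightarrow> 'i set \<Rightarrow> real" and t :: "'d \<Rightarrow> real"
  assumes J: "finite J" and V: "\<And>n. finite (V n)" "\<And>n. V n \<subseteq> I"
    and a: "\<And>j n A. j \<in> J \<Longrightarrow> a j n A \<noteq> 0 \<Longrightarrow> card A = p j" and p: "\<And>j. j \<in> J \<Longrightarrow> 1 \<le> p j"
    and v: "v = (\<Sum>j\<in>J. \<Sum>k\<in>J. t j * t k * C j k)" "0 \<le> v"
    and cov: "\<And>j k. j \<in> J \<Longrightarrow> k \<in> J \<Longrightarrow> (\<lambda>n. \<Sum>A\<in>Pow (V n). a j n A * a k n A) \<longlonglongrightarrow> C j k"
    and contr: "\<And>j r. j \<in> J \<Longrightarrow> 1 \<le> r \<Longrightarrow> r < p j \<Longrightarrow> (\<lambda>n. contr (V n) r (a j n) (a j n)) \<longlonglongrightarrow> 0"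
    and lin: "\<And>j. j \<in> J \<Longrightarrow> p j = 1 \<Longrightarrow> (\<lambda>n. \<Sum>i\<in>V n. (a j n {i}) ^ 4 * (1 / lam i)) \<longlonglongrightarrow> 0"
  shows "(\<lambda>n. expectation (\<lambda>\<omega>. iexp (\<Sum>j\<in>J. t j * mform (V n) (a j n) (\<lambda>c. X c \<omega>)))) \<longlonglongrightarrow> of_real (exp (- v / 2))"
proof -
  have sq: "(\<lambda>n. \<Sum>A\<in>Pow (V n). (a j n A)\<^sup>2) \<longlonglongrightarrow> C j j" if "j \<in> J" for j
    using cov[OF that that] by (simp add: power2_eq_square)
  define var where "var j k n = (4 * (3 + 1 / \<alpha>)) ^ (p j + p k) *
      ((real (p j))\<^sup>2 * (\<Sum>r = 1..p j. if r = p j \<and> r = p k then 0 else contr (V n) r (a j n) (a k n)))" for j k n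
  define e1 where "e1 n = (\<Sum>j\<in>J. \<Sum>k\<in>J. \<bar>t j / p j * t k\<bar> * (sqrt (var j k n) + p j * \<bar>(\<Sum>A\<in>Pow (V n). a j n A * a k n A) - C j k\<bar>))" for n
  define g where "g k n = (\<Sum>i\<in>V n. (\<theta> i)\<^sup>2 * expectation (\<lambda>\<omega>. mform (V n) (djoin (a k n) {i}) (\<lambda>c. X c \<omega>) ^ 4))" for k n
  define s where "s n = (\<Sum>k\<in>J. p k * (\<Sum>A\<in>Pow (V n). (a k n A)\<^sup>2))" for n
  define K where "K = (\<Sum>j\<in>J. \<bar>t j / p j\<bar> * ((1 + (\<Sum>k\<in>J. \<bar>t k\<bar>))\<^sup>2 * real (card J) ^ 3))"
  have K: "0 \<le> K" unfolding K_def by (intro sum_nonneg mult_nonneg_nonneg) auto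
  have contr0: "(\<lambda>n. if r = p j \<and> r = p k then 0 else contr (V n) r (a j n) (a k n)) \<longlonglongrightarrow> 0"
    if j: "j \<in> J" and k: "k \<in> J" and r: "1 \<le> r" for j k r
  proof (cases "r = p j \<and> r = p k")
    case False
    have lim: "(\<lambda>n. contr (V n) r (a i n) (a i n)) \<longlonglongrightarrow> (if r = p i then (C i i)\<^sup>2 else 0)" if "i \<in> J" for i
      by (rule contr_tendsto_of_lt[OF V(1) a[OF that] sq[OF that] contr[OF that] r])
    \<comment> \<open>Unless \<open>r\<close> equals both degrees, at least one factor tends to zero
      while the other converges.\<close>
    have "(\<lambda>n. sqrt (contr (V n) r (a j n) (a j n)) * sqrt (contr (V n) r (a k n) (a k n)))
        \<longlonglongrightarrow> sqrt (if r = p j then (C j j)\<^sup>2 else 0) * sqrt (if r = p k then (C k k)\<^sup>2 else 0)"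
      by (intro tendsto_mult tendsto_real_sqrt lim j k)
    also have "sqrt (if r = p j then (C j j)\<^sup>2 else 0) * sqrt (if r = p k then (C k k)\<^sup>2 else 0) = 0"
      using False by auto
    finally have "(\<lambda>n. contr (V n) r (a j n) (a k n)) \<longlonglongrightarrow> 0"
      by (rule tendsto_sandwich[OF _ _ tendsto_const, rotated 2]) (auto simp: contr_nonneg contr_le)
    then show ?thesis unfolding if_not_P[OF False] .
  qed auto
  have "(\<lambda>n. var j k n) \<longlonglongrightarrow> (4 * (3 + 1 / \<alpha>)) ^ (p j + p k) * ((real (p j))\<^sup>2 * (\<Sum>r = 1..p j. 0))" if "j \<in> J" "k \<in> J" for j k
    unfolding var_def using that by (intro tendsto_intros contr0) auto
  then have var0: "(\<lambda>n. sqrt (var j k n)) \<longlonglongrightarrow> 0" if "j \<in> J" "k \<in> J" for j k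
    using tendsto_real_sqrt[of "var j k" 0] that by simp
  have "e1 \<longlonglongrightarrow> (\<Sum>j\<in>J. \<Sum>k\<in>J. \<bar>t j / p j * t k\<bar> * (0 + p j * \<bar>C j k - C j k\<bar>))"
    unfolding e1_def by (intro tendsto_intros var0 cov)
  then have e1: "e1 \<longlonglongrightarrow> 0" by simp
  have g0: "(\<lambda>n. g k n) \<longlonglongrightarrow> 0" if k: "k \<in> J" for k
  proof (cases "p k = 1")
    case True
    have "g k n = (\<Sum>i\<in>V n. (a k n {i}) ^ 4 * (1 / lam i))" for n
      unfolding g_def by (rule sum_fourth_moment_derivatives_card_1[OF V]) (use a[OF k] True in auto)
    then show ?thesis using lin[OF k True] by simp
  next
    case False
    have "(\<lambda>n. 1 / \<alpha> * sqrt (hyp ^ (3 * p k)) * contr (V n) 1 (a k n) (a k n)) \<longlonglongrightarrow> 1 / \<alpha> * sqrt (hyp ^ (3 * p k)) * 0"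
      using False p[OF k] by (intro tendsto_mult_left contr k) auto
    then have "(\<lambda>n. 1 / \<alpha> * sqrt (hyp ^ (3 * p k)) * contr (V n) 1 (a k n) (a k n)) \<longlonglongrightarrow> 0" by simp
    then show ?thesis
    proof (rule tendsto_sandwich[OF _ _ tendsto_const, rotated 2])
      show "\<forall>\<^sub>F n in sequentially. 0 \<le> g k n"
        unfolding g_def by (intro always_eventually allI sum_nonneg mult_nonneg_nonneg) auto
      show "\<forall>\<^sub>F n in sequentially. g k n \<le> 1 / \<alpha> * sqrt (hyp ^ (3 * p k)) * contr (V n) 1 (a k n) (a k n)"
        unfolding g_def by (intro always_eventually allI sum_fourth_moment_derivatives_le V a k) auto
    qed
  qed
  have g: "(\<lambda>n. \<Sum>k\<in>J. g k n) \<longlonglongrightarrow> 0" using tendsto_sum[of J g "\<lambda>_. 0"] g0 by simp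
  have s: "s \<longlonglongrightarrow> (\<Sum>k\<in>J. p k * C k k)" unfolding s_def by (intro tendsto_intros sq)
  have bound: "cmod (expectation (\<lambda>\<omega>. iexp (\<Sum>j\<in>J. t j * mform (V n) (a j n) (\<lambda>c. X c \<omega>))) - of_real (exp (- v / 2)))
      \<le> e1 n + K * (\<delta> * s n + (1 / \<delta>) * (\<Sum>k\<in>J. g k n))" if "0 < \<delta>" for \<delta> n
  proof -
    have "(\<Sum>k\<in>J. \<delta> * (p k * (\<Sum>A\<in>Pow (V n). (a k n A)\<^sup>2)) + (1 / \<delta>) * g k n) = \<delta> * s n + (1 / \<delta>) * (\<Sum>k\<in>J. g k n)"
      unfolding s_def sum.distrib sum_distrib_left ..
    moreover have "cmod (expectation (\<lambda>\<omega>. iexp (\<Sum>j\<in>J. t j * mform (V n) (a j n) (\<lambda>c. X c \<omega>))) - of_real (exp (- v / 2)))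
      \<le> e1 n + (\<Sum>j\<in>J. \<bar>t j / p j\<bar> * ((1 + (\<Sum>k\<in>J. \<bar>t k\<bar>))\<^sup>2 * real (card J) ^ 3 *
          (\<Sum>k\<in>J. \<delta> * (p k * (\<Sum>A\<in>Pow (V n). (a k n A)\<^sup>2)) + (1 / \<delta>) * g k n)))"
      unfolding e1_def var_def g_def
      by (rule expectation_iexp_linear_combination_le[OF V J, where a = "\<lambda>j. a j n"]) (use a p v that in auto)
    moreover have "(\<Sum>j\<in>J. \<bar>t j / p j\<bar> * ((1 + (\<Sum>k\<in>J. \<bar>t k\<bar>))\<^sup>2 * real (card J) ^ 3 * z)) = K * z" for z
      unfolding K_def sum_distrib_right by (simp only: mult.assoc)
    ultimately show ?thesis by simp
  qed
  show ?thesis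
  proof (rule tendstoI)
    fix \<epsilon> :: real assume \<epsilon>: "0 < \<epsilon>"
    define S where "S = \<bar>\<Sum>k\<in>J. p k * C k k\<bar> + 1"
    \<comment> \<open>Makes the term \<open>K * (\<delta> * s n)\<close> at most \<epsilon>/4 as
      soon as \<open>s n < S\<close>; \<open>K + 1\<close> replaces \<open>K\<close> as a divisor
      because \<open>K\<close> may be zero.\<close>
    define \<delta> where "\<delta> = \<epsilon> / (4 * (K + 1) * S)"
    have S: "0 < S" by (simp add: S_def)
    have \<delta>: "0 < \<delta>" using \<epsilon> K S by (simp add: \<delta>_def)
    have "\<forall>\<^sub>F n in sequentially. s n < S"
      by (rule order_tendstoD(2)[OF s]) (simp add: S_def abs_le_iff less_le_trans)
    moreover have "\<forall>\<^sub>F n in sequentially. e1 n < \<epsilon> / 4" using \<epsilon> by (intro order_tendstoD(2)[OF e1]) simp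
    moreover have "\<forall>\<^sub>F n in sequentially. (\<Sum>k\<in>J. g k n) < \<epsilon> / 4 * \<delta> / (K + 1)"
      using \<epsilon> \<delta> K by (intro order_tendstoD(2)[OF g]) simp
    ultimately show "\<forall>\<^sub>F n in sequentially. dist (expectation (\<lambda>\<omega>. iexp (\<Sum>j\<in>J. t j * mform (V n) (a j n) (\<lambda>c. X c \<omega>)))) (of_real (exp (- v / 2))) < \<epsilon>"
    proof eventually_elim
      case (elim n)
      have "K * (\<delta> * s n) \<le> (K + 1) * (\<delta> * S)"
      proof -
        have "K * (\<delta> * s n) \<le> K * (\<delta> * S)" using K \<delta> elim(1) by (intro mult_left_mono) auto
        also have "\<dots> \<le> (K + 1) * (\<delta> * S)" using \<delta> S by (intro mult_right_mono) auto
        finally show ?thesis .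
      qed
      also have "\<dots> = \<epsilon> / 4"
      proof -
        have "b * (\<epsilon> / (4 * b * S) * S) = \<epsilon> / 4" if "b \<noteq> 0" for b using that S by simp
        then show ?thesis unfolding \<delta>_def by this (use K in simp)
      qed
      finally have b1: "K * (\<delta> * s n) \<le> \<epsilon> / 4" .
      have "K * ((1 / \<delta>) * (\<Sum>k\<in>J. g k n)) \<le> K * ((1 / \<delta>) * (\<epsilon> / 4 * \<delta> / (K + 1)))"
        using K \<delta> elim(3) by (intro mult_left_mono) auto
      also have "\<dots> = \<epsilon> / 4 * (K / (K + 1))" using \<delta> by simp
      also have "\<dots> \<le> \<epsilon> / 4 * 1" using \<epsilon> K by (intro mult_left_mono) auto
      finally have b2: "K * ((1 / \<delta>) * (\<Sum>k\<in>J. g k n)) \<le> \<epsilon> / 4" by simp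
      show ?case
        using bound[OF \<delta>, of n] b1 b2 elim(2) \<epsilon> unfolding dist_norm distrib_left by linarith
    qed
  qed
qed

end

theorem theorem3p8:
  fixes M :: "'w measure"
    and \<mu> :: "'z measure"
    and lam :: "nat \<Rightarrow> real" and \<alpha> :: real
    and P :: "nat \<Rightarrow> 'w \<Rightarrow> real"
    and A :: "nat \<Rightarrow> 'z set"
    and q :: "'d::{finite,linorder} \<Rightarrow> nat"
    and N :: "'d \<Rightarrow> nat \<Rightarrow> nat"
    and f :: "'d \<Rightarrow> nat \<Rightarrow> (nat \<Rightarrow> nat) \<Rightarrow> real"
    and F :: "'d \<Rightarrow> nat \<Rightarrow> 'w \<Rightarrow> real"
    and g :: "'d \<Rightarrow> nat \<Rightarrow> (nat \<Rightarrow> 'z) \<Rightarrow> real"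
    and C :: "real ^ ('d::{finite,linorder}) ^ ('d::{finite,linorder})"
  assumes lam_pos: "\<And>i. i \<ge> 1 \<Longrightarrow> lam i > 0"
    and lam_inf: "(INF i\<in>{1..}. lam i) = \<alpha>" "\<alpha> > 0"
    and M: "prob_space M"
    and P_indep: "prob_space.indep_vars M (\<lambda>_. borel) P {1..}"
    and P_law: "\<And>i. i \<ge> 1 \<Longrightarrow> distr M borel (P i) =
        distr (measure_pmf (poisson_pmf (lam i))) borel (\<lambda>k. (real k - lam i) / sqrt (lam i))"
    and \<mu>: "sigma_finite_measure \<mu>" "borel_isomorphic_space \<mu>" "non_atomic \<mu>"
    and A_sets: "\<And>i. i \<ge> 1 \<Longrightarrow> A i \<in> sets \<mu>"
    and A_disj: "disjoint_family_on A {1..}"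
    and A_measure: "\<And>i. i \<ge> 1 \<Longrightarrow> emeasure \<mu> (A i) = ennreal (lam i)"
    and q_pos: "\<And>j. q j \<ge> 1" and q_mono: "mono q"
    and N_ge: "\<And>j n. n \<ge> 1 \<Longrightarrow> N j n \<ge> q j"
    and N_lim: "\<And>j. filterlim (N j) at_top sequentially"
    and f_sym: "\<And>j n. n \<ge> 1 \<Longrightarrow> symmetric_on_tuples (q j) (N j n) (f j n)"
    and f_diag: "\<And>j n. n \<ge> 1 \<Longrightarrow> vanishes_on_diagonals (q j) (N j n) (f j n)"
    and F_def: "\<And>j n. F j n = hom_sum (q j) (N j n) (f j n) P"
    and g_def: "\<And>j n. g j n =
        tensor_sum (q j) (N j n) (f j n) (\<lambda>i z. indicator (A i) z / sqrt (lam i))"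
    and C_pd: "positive_definite C"
    and cov: "\<And>i j. (\<lambda>n. \<integral>\<omega>. F i n \<omega> * F j n \<omega> \<partial>M) \<longlonglongrightarrow> C $ i $ j"
  shows
    "(\<forall>\<eta>. compensated_poisson_measure M \<mu> \<eta> \<and>
          (\<forall>i\<ge>1. AE \<omega> in M. P i \<omega> = \<eta> (A i) \<omega> / sqrt (lam i)) \<longrightarrow>
        (\<forall>j. \<forall>n\<ge>1. has_multiple_integral M \<mu> \<eta> (q j) (g j n) (F j n)))
     \<and>
     (let
        S1 = weak_conv_vec (\<lambda>n. distr M borel (\<lambda>\<omega>. \<chi> (j::'d). F j n \<omega>)) (multivariate_normal C);
        S2 = (\<forall>j. (\<lambda>n. \<integral>\<omega>. (F j n \<omega>) ^ 4 \<partial>M) \<longlonglongrightarrow> 3 * (C $ j $ j)\<^sup>2);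
        S3 = ((\<forall>j. q j \<ge> 2 \<longrightarrow> (\<forall>r\<in>{1..q j - 1}.
                 (\<lambda>n. L2_norm (power_measure \<mu> (2 * q j - 2 * r)) (contraction \<mu> (q j) r (g j n)))
                   \<longlonglongrightarrow> 0)) \<and>
              (\<forall>j. q j = 1 \<longrightarrow>
                 (\<lambda>n. \<Sum>i=1..N j n. (f j n (\<lambda>_\<in>{..<1}. i)) ^ 4 * (1 / lam i)) \<longlonglongrightarrow> 0));
        S4 = (\<forall>j. weak_conv_m (\<lambda>n. distr M borel (F j n))
                 (density lborel (\<lambda>x. ennreal (normal_density 0 (sqrt (C $ j $ j)) x))))
      in (S1 \<longleftrightarrow> S2) \<and> (S2 \<longleftrightarrow> S3) \<and> (S3 \<longleftrightarrow> S4))"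
proof -
  have \<alpha>_le: "\<alpha> \<le> lam i" if "i \<ge> 1" for i
  proof -
    have "bdd_below (lam ` {1..})" by (rule bdd_belowI2[of _ 0]) (simp add: lam_pos less_imp_le)
    then show ?thesis unfolding lam_inf(1)[symmetric] by (rule cINF_lower) (use that in auto)
  qed
  interpret poisson_family M P lam "{1..}" \<alpha>
    by (intro poisson_family.intro poisson_family_axioms.intro M P_indep lam_inf(2))
      (auto simp: std_poisson_def P_law \<alpha>_le)
  interpret G: orthonormal_family \<mu> "\<lambda>i z. indicator (A i) z / sqrt (lam i)"
    by (rule orthonormal_family_indicators[OF \<mu>(1)]) (use A_sets A_disj A_measure lam_pos in simp_all)
  \<comment> \<open>One finite index set for all components at stage \<open>n\<close>, since the
    ranges \<open>N j n\<close> differ with \<open>j\<close>.\<close>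
  define V where "V n = {1..Max (range (\<lambda>j. N j n))}" for n
  define a where "a j n = set_coeff (q j) (N j n) (f j n)" for j n
  have V: "finite (V n)" "V n \<subseteq> {1..}" for n by (auto simp: V_def)
  have NV: "{1..N j n} \<subseteq> V n" for j n
  proof -
    have "N j n \<le> Max (range (\<lambda>j. N j n))" by (intro Max_ge) auto
    then show ?thesis by (auto simp: V_def)
  qed
  have a_card: "a j n A \<noteq> 0 \<Longrightarrow> card A = q j" for j n A
    unfolding a_def by (rule set_coeff_card)
  \<comment> \<open>Symmetry and zeros on diagonals are assumed from \<open>n = 1\<close> on, so
    limits are transferred along eventually equal sequences.\<close>
  have F: "F j n \<omega> = mform (V n) (a j n) (\<lambda>c. P c \<omega>)" if "n \<ge> 1" for j n \<omega>
    unfolding F_def a_def by (rule hom_sum_eq_mform[OF f_sym[OF that] f_diag[OF that] V(1) NV])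
  have F_meas [measurable]: "F j n \<in> borel_measurable M" for j n
    unfolding F_def hom_sum_def[abs_def]
    by (intro borel_measurable_sum borel_measurable_times borel_measurable_const borel_measurable_prod X_measurable)
      (auto dest: index_tuple_bounds(1))
  have F_eq: "F j n = (\<lambda>\<omega>. mform (V n) (a j n) (\<lambda>c. P c \<omega>))" if "n \<ge> 1" for j n
    using F[OF that] by auto
  have cov': "(\<lambda>n. \<Sum>A\<in>Pow (V n). a j n A * a k n A) \<longlonglongrightarrow> C $ j $ k" for j k
    by (rule Lim_transform_eventually[OF cov[of j k]])
      (use expectation_mform_mult[OF V] in \<open>auto simp: F_eq eventually_sequentially intro!: exI[of _ 1]\<close>)
  have var: "(\<lambda>n. \<integral>\<omega>. (F j n \<omega>)\<^sup>2 \<partial>M) \<longlonglongrightarrow> C $ j $ j" for j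
    using cov[of j j] by (simp add: power2_eq_square)
  have Cpos: "0 < C $ j $ j" for j by (rule positive_definite_diagonal_pos[OF C_pd])
  let ?L = "\<lambda>n. distr M borel (\<lambda>\<omega>. \<chi> j. F j n \<omega>)"
  have vec_meas [measurable]: "(\<lambda>\<omega>. \<chi> j. F j n \<omega>) \<in> borel_measurable M" for n
    by (rule borel_measurable_vec_lambda) simp
  have L: "prob_space (?L n)" for n by (rule prob_space_distr) simp
  have L_iexp: "(\<integral>x. iexp (t \<bullet> x) \<partial>?L n) = (\<integral>\<omega>. iexp (\<Sum>j\<in>UNIV. t $ j * F j n \<omega>) \<partial>M)" for t n
    by (subst integral_distr) (auto simp: inner_vec_def)
  let ?N = "\<lambda>j. density lborel (\<lambda>x. ennreal (normal_density 0 (sqrt (C $ j $ j)) x))"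
  have sqrtC: "0 < sqrt (C $ j $ j)" for j using Cpos by simp
  note normal_real = real_distribution_normal[OF sqrtC]
  have F_real: "real_distribution (distr M borel (F j n))" for j n
    by (rule real_distribution_distr) simp

  define S1 where "S1 = weak_conv_vec ?L (multivariate_normal C)"
  define S2 where "S2 \<longleftrightarrow> (\<forall>j. (\<lambda>n. \<integral>\<omega>. (F j n \<omega>) ^ 4 \<partial>M) \<longlonglongrightarrow> 3 * (C $ j $ j)\<^sup>2)"
  define S3 where "S3 \<longleftrightarrow> ((\<forall>j. q j \<ge> 2 \<longrightarrow> (\<forall>r\<in>{1..q j - 1}.
                 (\<lambda>n. L2_norm (power_measure \<mu> (2 * q j - 2 * r)) (contraction \<mu> (q j) r (g j n))) \<longlonglongrightarrow> 0)) \<and>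
              (\<forall>j. q j = 1 \<longrightarrow> (\<lambda>n. \<Sum>i=1..N j n. (f j n (\<lambda>_\<in>{..<1}. i)) ^ 4 * (1 / lam i)) \<longlonglongrightarrow> 0))"
  define S4 where "S4 \<longleftrightarrow> (\<forall>j. weak_conv_m (\<lambda>n. distr M borel (F j n)) (?N j))"

  \<comment> \<open>The constant depends on the degree and the order alone, so these norms tend to
    zero exactly when the \<open>contr\<close> do.\<close>
  have norm_contr: "L2_norm (power_measure \<mu> (2 * q j - 2 * r)) (contraction \<mu> (q j) r (g j n))
      = fact (q j - r) * fact r / (fact (q j))\<^sup>2 * sqrt (contr (V n) r (a j n) (a j n))"
    if n: "n \<ge> 1" and r: "r \<le> q j" for j n r
  proof -
    have "contr (V n) r (a j n) (a j n) = contr {1..N j n} r (a j n) (a j n)"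
      by (rule contr_superset[OF V(1) NV]) (use set_coeff_subset in \<open>simp add: a_def\<close>)
    then show ?thesis
      unfolding g_def using G.L2_norm_contraction[OF f_sym[OF n] f_diag[OF n] r] by (simp add: a_def)
  qed
  have lin_sum: "(\<Sum>i=1..N j n. (f j n (\<lambda>_\<in>{..<1}. i)) ^ 4 * (1 / lam i)) = (\<Sum>i\<in>V n. (a j n {i}) ^ 4 * (1 / lam i))"
    if n: "n \<ge> 1" and q: "q j = 1" for j n
  proof (rule sum.mono_neutral_cong_left[OF V(1) NV])
    show "\<forall>i\<in>V n - {1..N j n}. (a j n {i}) ^ 4 * (1 / lam i) = 0"
      by (auto simp: a_def set_coeff_def)
    fix i assume i: "i \<in> {1..N j n}"
    have t: "(\<lambda>_\<in>{..<1}. i) \<in> index_tuples (q j) (N j n)" using i by (auto simp: index_tuples_def q)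
    have "f j n (\<lambda>_\<in>{..<1}. i) = a j n ((\<lambda>_\<in>{..<1::nat}. i) ` {..<1})"
      using index_tuple_eq_set_coeff[OF f_sym[OF n] f_diag[OF n] t] by (simp del: One_nat_def add: a_def q inj_on_def)
    also have "(\<lambda>_\<in>{..<1::nat}. i) ` {..<1} = {i}" by auto
    finally show "(f j n (\<lambda>_\<in>{..<1}. i)) ^ 4 * (1 / lam i) = (a j n {i}) ^ 4 * (1 / lam i)" by (simp only:)
  qed

  \<comment> \<open>The characteristic function of a component is the joint one at multiples of a
    unit vector, which makes the one-dimensional continuity theorem applicable.\<close>
  have "S1 \<Longrightarrow> S4"
    unfolding S1_def S4_def
  proof
    fix j assume w: "weak_conv_vec ?L (multivariate_normal C)"
    show "weak_conv_m (\<lambda>n. distr M borel (F j n)) (?N j)"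
    proof (rule levy_continuity[OF F_real normal_real])
      fix s
      let ?t = "s *\<^sub>R axis j 1 :: real ^ ('d::{finite,linorder})"
      have "char (distr M borel (F j n)) s = (\<integral>x. iexp (?t \<bullet> x) \<partial>?L n)" for n
        unfolding L_iexp char_def by (subst integral_distr) (auto simp: axis_def if_distrib if_distribR cong: if_cong)
      moreover have "char (?N j) s = (\<integral>x. iexp (?t \<bullet> x) \<partial>multivariate_normal C)"
      proof -
        have "?t \<bullet> (C *v ?t) = (sqrt (C $ j $ j) * s)\<^sup>2"
          using Cpos[of j] by (simp add: matrix_vector_mult_scaleR inner_axis' matrix_vector_mult_basis column_def power_mult_distrib power2_eq_square)
        then show ?thesis unfolding char_normal[OF sqrtC] integral_multivariate_normal_iexp[OF C_pd] by simp
      qed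
      ultimately show "(\<lambda>n. char (distr M borel (F j n)) s) \<longlonglongrightarrow> char (?N j) s"
        using weak_conv_vec_iexp[OF prob_space_multivariate_normal[OF C_pd] _ L _ w, of ?t] by simp
    qed
  qed
  moreover have "S4 \<Longrightarrow> S2"
    unfolding S4_def S2_def
  proof
    fix j assume "\<forall>j. weak_conv_m (\<lambda>n. distr M borel (F j n)) (?N j)"
    then have w: "weak_conv_m (\<lambda>n. distr M borel (F j n)) (?N j)" ..
    have sq: "(\<lambda>n. \<Sum>A\<in>Pow (V n). (a j n A)\<^sup>2) \<longlonglongrightarrow> C $ j $ j" using cov'[of j j] by (simp add: power2_eq_square)
    have ev: "\<forall>\<^sub>F n in sequentially. integrable (distr M borel (F j n)) (\<lambda>x. x ^ 6)
        \<and> (\<integral>x. x ^ 6 \<partial>distr M borel (F j n)) \<le> (hyp ^ q j * (C $ j $ j + 1)) ^ 3"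
      using order_tendstoD(2)[OF sq, of "C $ j $ j + 1", simplified] eventually_ge_at_top[of "1::nat"]
    proof eventually_elim
      case (elim n)
      have i: "integrable M (\<lambda>\<omega>. F j n \<omega> ^ 6)"
        unfolding F_eq[OF elim(2)] by (intro all_moments_integrable all_moments_power all_moments_mform V)
      have "(\<integral>\<omega>. F j n \<omega> ^ 6 \<partial>M) \<le> (hyp ^ q j * (\<Sum>A\<in>Pow (V n). (a j n A)\<^sup>2)) ^ 3"
        unfolding F_eq[OF elim(2)] by (rule sixth_moment_le_homogeneous[OF V]) (simp add: a_card)
      also have "\<dots> \<le> (hyp ^ q j * (C $ j $ j + 1)) ^ 3"
        using elim(1) hyp_ge_1 by (intro power_mono mult_left_mono mult_nonneg_nonneg sum_nonneg) auto
      finally show ?case using i by (simp add: integrable_distr_eq integral_distr)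
    qed
    have "(\<lambda>n. \<integral>x. x ^ 4 \<partial>distr M borel (F j n)) \<longlonglongrightarrow> (\<integral>x. x ^ 4 \<partial>?N j)"
      by (rule weak_conv_m_fourth_moment[OF F_real normal_real w ev normal_sixth_moment[OF sqrtC]])
    moreover have "sqrt (C $ j $ j) ^ 4 = (C $ j $ j)\<^sup>2"
      using Cpos[of j] by (simp add: power4_eq_xxxx power2_eq_square)
    ultimately show "(\<lambda>n. \<integral>\<omega>. (F j n \<omega>) ^ 4 \<partial>M) \<longlonglongrightarrow> 3 * (C $ j $ j)\<^sup>2"
      by (simp add: normal_fourth_moment[OF sqrtC] integral_distr)
  qed
  moreover have "S2 \<Longrightarrow> S3"
  proof -
    assume S2
    \<comment> \<open>Since the variances converge to \<open>C $ j $ j\<close>, the fourth moment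
      condition says that the fourth cumulants tend to zero.\<close>
    then have cum: "(\<lambda>n. (\<integral>\<omega>. (F j n \<omega>) ^ 4 \<partial>M) - 3 * (\<integral>\<omega>. (F j n \<omega>)\<^sup>2 \<partial>M)\<^sup>2) \<longlonglongrightarrow> 3 * (C $ j $ j)\<^sup>2 - 3 * (C $ j $ j)\<^sup>2" for j
      unfolding S2_def by (intro tendsto_intros var) auto
    show S3
      unfolding S3_def
    proof (intro conjI allI impI ballI)
      fix j r assume "2 \<le> q j" "r \<in> {1..q j - 1}"
      then have r: "1 \<le> r" "r < q j" by auto
      have "(\<lambda>n. contr (V n) r (a j n) (a j n)) \<longlonglongrightarrow> 0"
      proof (rule tendsto_sandwich[OF _ _ tendsto_const cum[of j, simplified]])
        show "\<forall>\<^sub>F n in sequentially. contr (V n) r (a j n) (a j n) \<le> (\<integral>\<omega>. (F j n \<omega>) ^ 4 \<partial>M) - 3 * (\<integral>\<omega>. (F j n \<omega>)\<^sup>2 \<partial>M)\<^sup>2"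
          using eventually_ge_at_top[of "1::nat"]
        proof eventually_elim
          case (elim n)
          show ?case unfolding F_eq[OF elim] by (rule fourth_cumulant_ge_contr[OF V _ r]) (rule a_card)
        qed
      qed (simp add: contr_nonneg)
      then have "(\<lambda>n. fact (q j - r) * fact r / (fact (q j))\<^sup>2 * sqrt (contr (V n) r (a j n) (a j n))) \<longlonglongrightarrow> fact (q j - r) * fact r / (fact (q j))\<^sup>2 * sqrt 0"
        by (intro tendsto_mult_left tendsto_real_sqrt)
      then have "(\<lambda>n. fact (q j - r) * fact r / (fact (q j))\<^sup>2 * sqrt (contr (V n) r (a j n) (a j n))) \<longlonglongrightarrow> 0" by simp
      then show "(\<lambda>n. L2_norm (power_measure \<mu> (2 * q j - 2 * r)) (contraction \<mu> (q j) r (g j n))) \<longlonglongrightarrow> 0"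
        by (rule Lim_transform_eventually)
          (use r in \<open>auto simp: norm_contr eventually_sequentially intro!: exI[of _ 1]\<close>)
    next
      fix j assume q: "q j = 1"
      show "(\<lambda>n. \<Sum>i=1..N j n. (f j n (\<lambda>_\<in>{..<1}. i)) ^ 4 * (1 / lam i)) \<longlonglongrightarrow> 0"
      proof (rule Lim_transform_eventually[OF cum[of j, simplified]])
        show "\<forall>\<^sub>F n in sequentially. (\<integral>\<omega>. (F j n \<omega>) ^ 4 \<partial>M) - 3 * (\<integral>\<omega>. (F j n \<omega>)\<^sup>2 \<partial>M)\<^sup>2
            = (\<Sum>i=1..N j n. (f j n (\<lambda>_\<in>{..<1}. i)) ^ 4 * (1 / lam i))"
          using eventually_ge_at_top[of "1::nat"]
        proof eventually_elim
          case (elim n)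
          show ?case
            unfolding lin_sum[OF elim q] F_eq[OF elim]
            using fourth_moment_card_1[OF V, of "a j n" n] a_card[of j n] q by simp
        qed
      qed
    qed
  qed
  moreover have "S3 \<Longrightarrow> S1"
  proof -
    assume S3
    have contr: "(\<lambda>n. contr (V n) r (a j n) (a j n)) \<longlonglongrightarrow> 0" if r: "1 \<le> r" "r < q j" for j r
    proof -
      let ?c = "fact (q j - r) * fact r / (fact (q j))\<^sup>2 :: real"
      have "(\<lambda>n. L2_norm (power_measure \<mu> (2 * q j - 2 * r)) (contraction \<mu> (q j) r (g j n))) \<longlonglongrightarrow> 0"
        using \<open>S3\<close> r unfolding S3_def by auto
      then have "(\<lambda>n. ?c * sqrt (contr (V n) r (a j n) (a j n))) \<longlonglongrightarrow> 0"
        by (rule Lim_transform_eventually)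
          (use r in \<open>auto simp: norm_contr eventually_sequentially intro!: exI[of _ 1]\<close>)
      \<comment> \<open>Division by the positive constant and squaring undo the square root in
        \<open>norm_contr\<close>.\<close>
      then have "(\<lambda>n. ((?c * sqrt (contr (V n) r (a j n) (a j n))) / ?c)\<^sup>2) \<longlonglongrightarrow> (0 / ?c)\<^sup>2"
        by (intro tendsto_intros) auto
      then show ?thesis by (simp add: contr_nonneg)
    qed
    have lin: "(\<lambda>n. \<Sum>i\<in>V n. (a j n {i}) ^ 4 * (1 / lam i)) \<longlonglongrightarrow> 0" if q: "q j = 1" for j
    proof -
      have "(\<lambda>n. \<Sum>i=1..N j n. (f j n (\<lambda>_\<in>{..<1}. i)) ^ 4 * (1 / lam i)) \<longlonglongrightarrow> 0"
        using \<open>S3\<close> q unfolding S3_def by auto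
      then show ?thesis
        by (rule Lim_transform_eventually)
          (use lin_sum[OF _ q] in \<open>auto simp: eventually_sequentially intro!: exI[of _ 1]\<close>)
    qed
    show S1
      unfolding S1_def
    proof (rule levy_continuity_vec[OF prob_space_multivariate_normal[OF C_pd] _ L])
      fix t :: "real ^ ('d::{finite,linorder})"
      have "(\<lambda>n. expectation (\<lambda>\<omega>. iexp (\<Sum>j\<in>UNIV. t $ j * mform (V n) (a j n) (\<lambda>c. P c \<omega>)))) \<longlonglongrightarrow> of_real (exp (- (t \<bullet> (C *v t)) / 2))"
        by (rule characteristic_function_tendsto[where p = q and C = "\<lambda>j k. C $ j $ k"])
          (intro finite V a_card q_pos quadratic_form_eq_sum cov' contr lin positive_definite_quadratic_nonneg[OF C_pd]; assumption)+
      then have "(\<lambda>n. \<integral>x. iexp (t \<bullet> x) \<partial>?L n) \<longlonglongrightarrow> of_real (exp (- (t \<bullet> (C *v t)) / 2))"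
        by (rule Lim_transform_eventually)
          (auto simp: L_iexp F eventually_sequentially intro!: exI[of _ 1])
      then show "(\<lambda>n. \<integral>x. iexp (t \<bullet> x) \<partial>?L n) \<longlonglongrightarrow> (\<integral>x. iexp (t \<bullet> x) \<partial>multivariate_normal C)"
        by (simp only: integral_multivariate_normal_iexp[OF C_pd])
    next
      fix e :: real assume e: "0 < e"
      \<comment> \<open>Tightness by Chebyshev: \<open>c\<close> eventually exceeds the sum of the
        second moments, and \<open>R^2 = c / e\<close> makes the probability of leaving the cube at
        most \<open>e\<close>.\<close>
      define c where "c = (\<Sum>j\<in>UNIV. C $ j $ j) + 1"
      have c: "0 < c" by (simp add: c_def add_nonneg_pos sum_nonneg Cpos less_imp_le)
      define R where "R = sqrt (c / e)"
      have R: "0 < R" "R\<^sup>2 = c / e" using c e by (simp_all add: R_def)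
      have "(\<lambda>n. \<Sum>j\<in>UNIV. \<integral>\<omega>. (F j n \<omega>)\<^sup>2 \<partial>M) \<longlonglongrightarrow> (\<Sum>j\<in>UNIV. C $ j $ j)"
        by (intro tendsto_sum var)
      then have "\<forall>\<^sub>F n in sequentially. (\<Sum>j\<in>UNIV. \<integral>\<omega>. (F j n \<omega>)\<^sup>2 \<partial>M) < c"
        by (rule order_tendstoD(2)) (simp add: c_def)
      then have "\<forall>\<^sub>F n in sequentially. measure (?L n) {x. \<exists>i. R < \<bar>x $ i\<bar>} \<le> e"
        using eventually_ge_at_top[of "1::nat"]
      proof eventually_elim
        case (elim n)
        have "measure (?L n) {x. \<exists>i. R < \<bar>x $ i\<bar>} = prob {\<omega> \<in> space M. \<exists>j. R < \<bar>F j n \<omega>\<bar>}"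
          by (subst measure_distr) (auto intro!: arg_cong[where f = prob])
        also have "\<dots> = expectation (indicator {\<omega> \<in> space M. \<exists>j. R < \<bar>F j n \<omega>\<bar>})" by simp
        also have "\<dots> \<le> expectation (\<lambda>\<omega>. (\<Sum>j\<in>UNIV. (F j n \<omega>)\<^sup>2) / R\<^sup>2)"
        proof (rule integral_mono)
          show "integrable M (\<lambda>\<omega>. (\<Sum>j\<in>UNIV. (F j n \<omega>)\<^sup>2) / R\<^sup>2)"
            unfolding F_eq[OF elim(2)]
            by (intro all_moments_integrable all_moments_divide all_moments_sum all_moments_power all_moments_mform V)
          fix \<omega>
          show "indicator {\<omega> \<in> space M. \<exists>j. R < \<bar>F j n \<omega>\<bar>} \<omega> \<le> (\<Sum>j\<in>UNIV. (F j n \<omega>)\<^sup>2) / R\<^sup>2"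
          proof (cases "\<exists>j. R < \<bar>F j n \<omega>\<bar>")
            case True
            then obtain j where "R < \<bar>F j n \<omega>\<bar>" by auto
            then have "R\<^sup>2 \<le> (F j n \<omega>)\<^sup>2" using R(1) power_mono[of R "\<bar>F j n \<omega>\<bar>" 2] by simp
            also have "\<dots> \<le> (\<Sum>j\<in>UNIV. (F j n \<omega>)\<^sup>2)" by (rule member_le_sum) auto
            finally have "1 \<le> (\<Sum>j\<in>UNIV. (F j n \<omega>)\<^sup>2) / R\<^sup>2" using R(1) by (simp add: pos_le_divide_eq)
            then show ?thesis by (simp add: indicator_def)
          qed (auto simp: sum_nonneg)
        qed (auto intro!: integrable_real_indicator simp: emeasure_eq_measure)
        also have "\<dots> = (\<Sum>j\<in>UNIV. \<integral>\<omega>. (F j n \<omega>)\<^sup>2 \<partial>M) / R\<^sup>2"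
        proof -
          have "integrable M (\<lambda>\<omega>. (F j n \<omega>)\<^sup>2)" for j
            unfolding F_eq[OF elim(2)] by (intro all_moments_integrable all_moments_power all_moments_mform V)
          then show ?thesis by simp
        qed
        also have "\<dots> \<le> c / R\<^sup>2" using elim(1) by (intro divide_right_mono) auto
        also have "\<dots> = e" unfolding R(2) using c e by simp
        finally show ?case .
      qed
      then show "\<exists>R>0. \<forall>\<^sub>F n in sequentially. measure (?L n) {x. \<exists>i. R < \<bar>x $ i\<bar>} \<le> e" using R(1) by blast
    qed auto
  qed
  ultimately have equiv: "(S1 \<longleftrightarrow> S2) \<and> (S2 \<longleftrightarrow> S3) \<and> (S3 \<longleftrightarrow> S4)" by blast

  \<comment> \<open>Each kernel lies in the class of elementary functions, so the representation as
    a multiple integral needs no limit procedure.\<close>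
  have "has_multiple_integral M \<mu> \<eta> (q j) (g j n) (F j n)"
    if \<eta>: "compensated_poisson_measure M \<mu> \<eta>" "\<forall>i\<ge>1. AE \<omega> in M. P i \<omega> = \<eta> (A i) \<omega> / sqrt (lam i)" and n: "n \<ge> 1" for \<eta> j n
  proof -
    have "\<eta> (A i) \<in> borel_measurable M" if "i \<ge> 1" for i
      using \<eta>(1) A_sets[OF that] A_measure[OF that] unfolding compensated_poisson_measure_def by auto
    then have "has_multiple_integral M \<mu> \<eta> (q j) (tensor_sum (q j) (N j n) (f j n) (\<lambda>i z. indicator (A i) z / sqrt (lam i)))
        (hom_sum (q j) (N j n) (f j n) P)"
      using \<eta>(2) X_measurable
      by (intro has_multiple_integral_hom_sum[OF \<mu>(1) A_sets A_disj A_measure lam_pos _ _ _ f_diag[OF n]]) auto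
    then show ?thesis unfolding g_def F_def .
  qed
  with equiv show ?thesis unfolding Let_def S1_def S2_def S3_def S4_def by blast
qed

end
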